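(* $$L(f,3)=\frac{\pi^{2}}{96}\,F^{1;2;2}_{1;1;1}\left[\left.\begin{matrix}2\\ \tfrac52\end{matrix};\begin{matrix}1,1\\ 2\end{matrix};\begin{matrix}\tfrac12,\tfrac12\\ 1\end{matrix}\right|1,1\right].$$
   Context: For $|q|<1$ let $\theta_2(q)=\sum_{n\in\mathbb Z}q^{(n+1/2)^2}$, $\theta_3(q)=\sum_{n\in\mathbb Z}q^{n^2}$, $\theta_4(q)=\sum_{n\in\mathbb Z}(-1)^nq^{n^2}$ (Jacobi theta series). Let $f(q)=\frac1{16}\theta_2^4(q)\theta_4^2(q)=\sum_{n\ge0}a_nq^n$, a modular form of weight 3. Its $L$-function is $L(f,s)=\sum_{n\ge1}a_nn^{-s}$, understood at $s=3$ via its analytic continuation (which is entire). $(a)_n=\Gamma(a+n)/\Gamma(a)$ is the Pochhammer symbol. The Kampé de Fériet function is $$F^{A;B;B'}_{C;D;D'}\left[\left.\begin{matrix}a_1,\dots,a_A\\ c_1,\dots,c_C\end{matrix};\begin{matrix}b_1,\dots,b_B\\ d_1,\dots,d_D\end{matrix};\begin{matrix}b'_1,\dots,b'_{B'}\\ d'_1,\dots,d'_{D'}\end{matrix}\right|x,y\right]=\sum_{m,n\ge0}\frac{\prod_i(a_i)_{m+n}\prod_i(b_i)_m\prod_i(b'_i)_n}{\prod_i(c_i)_{m+n}\prod_i(d_i)_m\prod_i(d'_i)_n}\frac{x^my^n}{m!\,n!},$$ which converges absolutely at $x=y=1$ for the parameters used here. *)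

theory Defs
  imports "HOL-Analysis.Analysis"
begin

text \<open>Coefficients a_N of f(q) = theta2(q)^4 theta4(q)^2 / 16.
  Since (n+1/2)^2 = n(n+1) + 1/4, theta2(q)^4 = q * (sum_n q^(n(n+1)))^4, so the
  coefficient of q^N in the product of the six series is the signed count below
  (a finite sum, as every exponent is nonnegative).\<close>
definition fcoeff :: "nat \<Rightarrow> real" where
  "fcoeff N = (\<Sum>(n1, n2, n3, n4, m1, m2) \<in>
      {t :: int \<times> int \<times> int \<times> int \<times> int \<times> int.
        case t of (n1, n2, n3, n4, m1, m2) \<Rightarrow>
        1 + n1 * (n1 + 1) + n2 * (n2 + 1) + n3 * (n3 + 1) + n4 * (n4 + 1)
          + m1 ^ 2 + m2 ^ 2 = int N}.
      (-1::real) ^ nat \<bar>m1 + m2\<bar>) / 16"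

definition kdf :: "real list \<Rightarrow> real list \<Rightarrow> real list \<Rightarrow> real list \<Rightarrow> real list \<Rightarrow> real list
    \<Rightarrow> real \<Rightarrow> real \<Rightarrow> real" where
  "kdf as cs bs ds bs' ds' x y =
     (\<Sum>\<^sub>\<infinity>(m, n) \<in> (UNIV :: (nat \<times> nat) set).
        (prod_list (map (\<lambda>a. pochhammer a (m + n)) as)
         * prod_list (map (\<lambda>b. pochhammer b m) bs)
         * prod_list (map (\<lambda>b. pochhammer b n) bs'))
        / (prod_list (map (\<lambda>c. pochhammer c (m + n)) cs)
         * prod_list (map (\<lambda>d. pochhammer d m) ds)
         * prod_list (map (\<lambda>d. pochhammer d n) ds'))
        * x ^ m * y ^ n / (fact m * fact n))"

end

(*
  The form f is an Eisenstein series: a_N is the sum of (-1)^(d-1+k) d^2 over d (2k+1) = N, so that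
  L(f,s) = eta(s-2) beta(s) with eta(s) = sum (-1)^(n-1) n^(-s) and beta(s) = sum (-1)^k (2k+1)^(-s),
  and L(f,3) = eta(1) beta(3) = pi^3 ln 2 / 32.

  Coefficients. Put q = exp(-x) and P, M = sum over integers n of sech(n x), resp. (-1)^n sech(n x).
  Since sech a sech b = (tanh a + tanh b) / sinh(a + b), the convolution square of n |-> sech(n x)
  telescopes to 2 n / sinh(n x); one more convolution expresses M^3, and hence the second moment
  sum (-1)^n n^2 sech(n x), through P and M. This moment is the Lambert series above. The
  telescoping also yields (P(x) - P(2x))^2 = 4 (P(2x) - P(4x)) P(4x), a recursion that theta3^2
  satisfies as well; it determines the function from its behaviour as x tends to infinity,
  so P = theta3^2 and M = theta4^2, which turns the moment into theta2^4 theta4^2 / 16.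

  Continuation. The k-th difference of x^(-s) is O(x^(-Re s - k)), so Euler's transformation
  sum (-1)^n g(n) = sum_(j<k) D^j g(0) / 2^(j+1) + 2^(-k) sum (-1)^n D^k g(n), D g(n) = g(n) - g(n+1),
  continues eta and beta to Re s > 1 - k for every k.

  Double series. The inner sums telescope, which reduces the claim to
  sum_n C(2n,n) 4^(-n) (1 + 1/3 + ... + 1/(2n+1)) / (2n+1) = pi ln 2. With b_n = C(2n,n) 4^(-n)
  this follows by summing b_n / (2N (2n + 2N + 1)) over n >= 0, N >= 1 in both orders, using
  sum_n b_n / (2n + 2N + 1) = pi b_N / 2 and sum_(N >= 1) b_N / (2N) = ln 2.
*)
theory Submission
  imports Defs "HOL-Complex_Analysis.Complex_Analysis"
begin

section \<open>Summation over product sets and over the integers\<close>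

text \<open>Behind the recursion stands the arithmetic-geometric mean: even indices give P(2x) =
  (P(x) + M(x)) / 2, and squaring the odd-indexed part amounts to M(2x)^2 = P(x) M(x). Eliminating M
  leaves an equation in P alone. The limit 1 at infinity does not single out a solution, since P(c
  x) solves the same equation with the same limit for every c > 0. The scale is fixed by the leading
  term: P(x) - P(2x) and its theta counterpart are both asymptotic to 4 exp(-x). Real x > 0 suffices
  for the coefficients, as the points q = exp(-x) accumulate at 0. The point s = 3 lies on the line
  where the series of eta(s - 2) stops converging absolutely. The product eta(s - 2) beta(s) is
  therefore expanded and regrouped only for Re s > 3, and s = 3 is reached through the continuation.
  Most closed sums come from certificates: a difference in a parameter is written as a difference in
  the summation index. The constant pi^2 / 96 fits because the double series has the value 3 pi ln
  2.\<close>

lemma has_sum_Times: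
  fixes f :: "'a \<Rightarrow> 'c::{real_normed_field,banach}" and g :: "'b \<Rightarrow> 'c"
  assumes f: "(\<lambda>a. norm (f a)) summable_on A" and g: "(\<lambda>b. norm (g b)) summable_on B"
  shows "((\<lambda>(a, b). f a * g b) has_sum (infsum f A * infsum g B)) (A \<times> B)"
proof -
  have *: "(\<lambda>(a, b). norm (f a * g b)) summable_on A \<times> B"
  proof (rule summable_on_SigmaI)
    show "((\<lambda>b. case (a, b) of (a, b) \<Rightarrow> norm (f a * g b)) has_sum
        norm (f a) * infsum (\<lambda>b. norm (g b)) B) B" for a
      using g by (simp add: norm_mult has_sum_cmult_right)
  qed (use f in \<open>auto intro: summable_on_cmult_left\<close>)
  have "(\<lambda>p. norm (case p of (a, b) \<Rightarrow> f a * g b)) = (\<lambda>(a, b). norm (f a * g b))"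
    by auto
  with * have "(\<lambda>p. norm (case p of (a, b) \<Rightarrow> f a * g b)) summable_on A \<times> B"
    by (simp only:)
  hence s: "(\<lambda>(a, b). f a * g b) summable_on A \<times> B"
    by (rule abs_summable_summable)
  have "infsum (\<lambda>(a, b). f a * g b) (A \<times> B) = infsum (\<lambda>a. infsum (\<lambda>b. f a * g b) B) A"
    using infsum_Sigma'_banach[OF s] by (rule sym)
  also have "\<dots> = infsum f A * infsum g B"
    using abs_summable_summable[OF f] by (simp only: infsum_cmult_right' infsum_cmult_left)
  finally show "((\<lambda>(a, b). f a * g b) has_sum (infsum f A * infsum g B)) (A \<times> B)"
    using s by (simp only: has_sum_iff)
qed

text \<open>Summability makes regrouping along the fibres of \<open>key\<close> legitimate. With an
  exponent or a product of divisors as key, families over lattice points or factorisations turn into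
  power series and Dirichlet series.\<close>

lemma has_sum_by_key:
  fixes f :: "'a \<Rightarrow> 'c::banach"
  assumes "f summable_on A"
  shows "((\<lambda>k. infsum f {t \<in> A. key t = k}) has_sum infsum f A) UNIV"
proof -
  let ?B = "\<lambda>k. {t \<in> A. key t = k}"
  have "((\<lambda>(k, t). f t) has_sum infsum f A) (Sigma UNIV ?B)
      \<longleftrightarrow> (f has_sum infsum f A) A"
    by (rule has_sum_reindex_bij_witness[where i = "\<lambda>t. (key t, t)" and j = snd]) auto
  with assms have "((\<lambda>(k, t). f t) has_sum infsum f A) (Sigma UNIV ?B)"
    by simp
  moreover have "((\<lambda>t. (\<lambda>(k, t). f t) (k, t)) has_sum infsum f (?B k)) (?B k)" for k
    using summable_on_subset_banach[OF assms, of "?B k"] by auto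
  ultimately show ?thesis
    by (rule has_sum_SigmaD)
qed

lemma summable_on_intI:
  fixes f :: "int \<Rightarrow> real"
  assumes "(\<lambda>n. f (int n)) summable_on UNIV" and "(\<lambda>n. f (- int n)) summable_on UNIV"
  shows "f summable_on UNIV"
proof -
  have "f summable_on range int"
    using assms(1) by (subst summable_on_reindex) (auto simp: o_def)
  moreover have "f summable_on range (\<lambda>n. - int n)"
    using assms(2) by (subst summable_on_reindex) (auto simp: o_def inj_on_def)
  moreover have "range int \<union> range (\<lambda>n. - int n) = UNIV"
    by (auto simp: image_iff) (metis int_cases2)
  ultimately show ?thesis
    by (metis summable_on_union)
qed

lemma summable_on_int_power_exp:
  assumes x: "x > 0"
  shows "(\<lambda>n::int. real_of_int \<bar>n\<bar> ^ k * exp (- x * real_of_int \<bar>n\<bar>)) summable_on UNIV"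
proof -
  have "(\<lambda>n. (real n / real (Suc n)) ^ k) \<longlonglongrightarrow> 1 ^ k"
    by (intro tendsto_power LIMSEQ_n_over_Suc_n)
  hence "conv_radius (\<lambda>n. real n ^ k) = 1"
    by (intro conv_radius_ratio_limit_nonzero[where c = 1])
       (auto simp: power_divide one_ereal_def intro: eventually_mono[OF eventually_gt_at_top[of 0]])
  with x have "summable (\<lambda>n. real n ^ k * exp (- x) ^ n)"
    by (intro summable_in_conv_radius) auto
  hence *: "summable (\<lambda>n. real n ^ k * exp (- x * real n))"
    by (simp add: exp_of_nat_mult [symmetric] mult.commute)
  have "(\<lambda>n. real n ^ k * exp (- x * real n)) summable_on UNIV"
    using * by (rule summable_nonneg_imp_summable_on) auto
  thus ?thesis
    by (intro summable_on_intI) auto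
qed

section \<open>Series of hyperbolic secants\<close>

text \<open>Monotonicity makes all differences nonnegative, so both one-sided telescoping series
  converge unconditionally and can be glued at 0.\<close>

lemma has_sum_telescope_int:
  fixes h :: "int \<Rightarrow> real"
  assumes "mono h" and "(\<lambda>n. h (int n)) \<longlonglongrightarrow> L" and "(\<lambda>n. h (- int n)) \<longlonglongrightarrow> L'"
  shows "((\<lambda>k. h k - h (k - 1)) has_sum (L - L')) UNIV"
proof -
  let ?d = "\<lambda>k. h k - h (k - 1)"
  have nn: "?d k \<ge> 0" for k
    using \<open>mono h\<close> by (simp add: monoD)
  have "(\<lambda>n. h (int (Suc n)) - h (int n)) sums (L - h (int 0))"
    by (rule telescope_sums) fact
  hence "(\<lambda>n. ?d (int n + 1)) sums (L - h 0)"
    by (simp add: add.commute)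
  hence "((\<lambda>n. ?d (int n + 1)) has_sum (L - h 0)) UNIV"
    by (rule sums_nonneg_imp_has_sum) (rule nn)
  moreover have "((\<lambda>n. ?d (int n + 1)) has_sum (L - h 0)) UNIV \<longleftrightarrow> (?d has_sum (L - h 0)) {1..}"
    by (rule has_sum_reindex_bij_witness[where i = "\<lambda>k. nat (k - 1)" and j = "\<lambda>n. int n + 1"]) auto
  ultimately have pos: "(?d has_sum (L - h 0)) {1..}" by simp
  have "(\<lambda>n. h (- int n) - h (- int (Suc n))) sums (h (- int 0) - L')"
    by (rule telescope_sums') fact
  moreover have "- int (Suc n) = - int n - 1" for n by simp
  ultimately have "(\<lambda>n. ?d (- int n)) sums (h 0 - L')"
    by (simp only: of_nat_0 minus_zero)
  hence "((\<lambda>n. ?d (- int n)) has_sum (h 0 - L')) UNIV"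
    by (rule sums_nonneg_imp_has_sum) (rule nn)
  moreover have "((\<lambda>n. ?d (- int n)) has_sum (h 0 - L')) UNIV \<longleftrightarrow> (?d has_sum (h 0 - L')) {..0}"
    by (rule has_sum_reindex_bij_witness[where i = "\<lambda>k. nat (- k)" and j = "\<lambda>n. - int n"]) auto
  ultimately have "(?d has_sum (h 0 - L')) {..0}" by simp
  from has_sum_Un_disjoint[OF this pos] have "(?d has_sum (L - L')) ({..0} \<union> {1..})"
    by (simp add: disjoint_iff)
  moreover have "{..0} \<union> {1..} = (UNIV :: int set)" by auto
  ultimately show ?thesis by simp
qed

lemma has_sum_int_shift:
  fixes f :: "int \<Rightarrow> real"
  shows "((\<lambda>k. f (k + m)) has_sum s) UNIV \<longleftrightarrow> (f has_sum s) UNIV"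
  by (rule has_sum_reindex_bij_witness[where i = "\<lambda>n. n - m" and j = "\<lambda>n. n + m"]) auto

text \<open>\<open>h k - h (k - m)\<close> is made up of m translates of the unit difference, all
  with the same sum D; negative m reverses the sign.\<close>

lemma has_sum_shift_diff:
  fixes h :: "int \<Rightarrow> real"
  assumes "((\<lambda>k. h k - h (k - 1)) has_sum D) UNIV"
  shows "((\<lambda>k. h k - h (k - m)) has_sum (of_int m * D)) UNIV"
proof (induction m rule: int_induct[where k = 0])
  case base
  show ?case by simp
next
  case (step1 i)
  have "((\<lambda>k. h (k + (- i)) - h (k + (- i) - 1)) has_sum D) UNIV"
    using has_sum_int_shift[of "\<lambda>k. h k - h (k - 1)" "- i"] assms by simp
  from has_sum_add[OF step1(2) this] show ?case
    by (simp add: algebra_simps)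
next
  case (step2 i)
  have "((\<lambda>k. h (k + (1 - i)) - h (k + (1 - i) - 1)) has_sum D) UNIV"
    using has_sum_int_shift[of "\<lambda>k. h k - h (k - 1)" "1 - i"] assms by simp
  from has_sum_add[OF step2(2) has_sum_uminusI[OF this]] show ?case
    by (simp add: algebra_simps)
qed

text \<open>The factor 2 is the total rise of tanh from -1 to 1. The offset \<open>c\<close> serves
  sums over odd indices, whose arguments are x (2k + 1).\<close>

lemma tanh_telescope:
  fixes x c :: real
  assumes "x > 0"
  shows "((\<lambda>k::int. tanh (x * of_int k + c) - tanh (x * of_int (k - m) + c)) has_sum
           (2 * of_int m)) UNIV"
proof -
  let ?h = "\<lambda>k::int. tanh (x * of_int k + c)"
  have "mono ?h"
    using assms by (auto intro!: monoI)
  moreover have "(\<lambda>n. ?h (int n)) \<longlonglongrightarrow> 1"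
    using assms by (intro filterlim_compose[OF tanh_real_at_top]) (simp, real_asymp)
  moreover have "(\<lambda>n. ?h (- int n)) \<longlonglongrightarrow> - 1"
    using assms by (intro filterlim_compose[OF tanh_real_at_bot]) (simp, real_asymp)
  ultimately have "((\<lambda>k. ?h k - ?h (k - 1)) has_sum (1 - (-1))) UNIV"
    by (rule has_sum_telescope_int)
  from has_sum_shift_diff[OF this, of m] show ?thesis by (simp add: mult.commute)
qed

lemma has_sum_convolution:
  fixes f g :: "int \<Rightarrow> real"
  assumes f: "f summable_on UNIV" and g: "g summable_on UNIV"
    and c: "\<And>n. ((\<lambda>b. f (n - b) * g b) has_sum c n) UNIV"
  shows "(c has_sum (infsum f UNIV * infsum g UNIV)) UNIV"
proof -
  have "((\<lambda>(a, b). f a * g b) has_sum (infsum f UNIV * infsum g UNIV)) (UNIV \<times> UNIV)"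
    using f g by (intro has_sum_Times) (metis summable_on_iff_abs_summable_on_real)+
  also have "?this \<longleftrightarrow> ((\<lambda>(n, b). f (n - b) * g b) has_sum (infsum f UNIV * infsum g UNIV)) (UNIV \<times> UNIV)"
    by (rule has_sum_reindex_bij_witness[where i = "\<lambda>(n, b). (n - b, b)" and j = "\<lambda>(a, b). (a + b, b)"])
       auto
  finally show ?thesis
    by (rule has_sum_SigmaD) (use c in simp)
qed

section \<open>Hyperbolic secants, their convolution squares and the second moment\<close>

definition sech :: "real \<Rightarrow> int \<Rightarrow> real" where
  "sech x n = 1 / cosh (x * of_int n)"

definition altsgn :: "int \<Rightarrow> real" where
  "altsgn n = (if even n then 1 else -1)"

lemma altsgn_add: "altsgn (m + n) = altsgn m * altsgn n"
  by (auto simp: altsgn_def)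

lemma altsgn_diff_mult: "altsgn (m - n) * altsgn n = altsgn m"
  by (auto simp: altsgn_def)

lemma abs_altsgn [simp]: "\<bar>altsgn n\<bar> = 1"
  by (auto simp: altsgn_def)

lemma sech_pos: "sech x n > 0"
  by (simp add: sech_def)

lemma sech_minus [simp]: "sech x (- n) = sech x n"
  by (simp add: sech_def)

lemma sech_le_exp:
  assumes "x > 0"
  shows "sech x n \<le> 2 * exp (- x * of_int \<bar>n\<bar>)"
proof -
  have "exp (x * of_int \<bar>n\<bar>) \<le> 2 * cosh (x * of_int \<bar>n\<bar>)"
    by (simp add: cosh_def)
  also have "cosh (x * of_int \<bar>n\<bar>) = cosh (x * of_int n)"
    by (cases "n \<ge> 0") auto
  finally show ?thesis
    by (simp add: sech_def exp_minus field_simps)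
qed

lemma summable_power_sech:
  assumes "x > 0"
  shows "(\<lambda>n. of_int \<bar>n\<bar> ^ k * sech x n) summable_on UNIV"
proof (rule summable_on_comparison_test)
  show "(\<lambda>n. 2 * (of_int \<bar>n\<bar> ^ k * exp (- x * of_int \<bar>n\<bar>))) summable_on UNIV"
    using summable_on_int_power_exp[OF assms, of k] by (intro summable_on_cmult_right)
  show "of_int \<bar>n\<bar> ^ k * sech x n \<le> 2 * (of_int \<bar>n\<bar> ^ k * exp (- x * of_int \<bar>n\<bar>))" for n
    using mult_left_mono[OF sech_le_exp[OF assms, of n], of "of_int \<bar>n\<bar> ^ k"] by simp
qed (simp add: sech_pos less_imp_le)

lemma summable_on_real_bound:
  fixes f g :: "'a \<Rightarrow> real"
  assumes "g summable_on A" "\<And>n. n \<in> A \<Longrightarrow> \<bar>f n\<bar> \<le> g n"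
  shows "f summable_on A"
  by (rule abs_summable_summable, rule Infinite_Sum.abs_summable_on_comparison_test'[OF assms(1)])
     (use assms(2) in auto)

lemma summable_sech: "x > 0 \<Longrightarrow> sech x summable_on UNIV"
  using summable_power_sech[of x 0] by simp

lemma summable_altsgn_sech: "x > 0 \<Longrightarrow> (\<lambda>n. altsgn n * sech x n) summable_on UNIV"
  by (rule summable_on_real_bound[OF summable_sech]) (auto simp: abs_mult sech_pos less_imp_le)

lemma sech_le_1: "sech x n \<le> 1"
  by (simp add: sech_def cosh_real_ge_1)

lemma summable_sech_sq:
  assumes "x > 0" shows "(\<lambda>n. sech x n ^ 2) summable_on UNIV"
  by (rule summable_on_real_bound[OF summable_sech[OF assms]])
     (use sech_le_1[of x] in \<open>simp add: power2_eq_square mult_le_cancel_left2 sech_pos less_imp_le not_less\<close>)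

text \<open>The convolution square of \<open>sech x\<close>. At n = 0 the closed form degenerates to
  0 / 0, hence the separate value there.\<close>

definition sech_conv :: "real \<Rightarrow> int \<Rightarrow> real" where
  "sech_conv x n = (if n = 0 then infsum (\<lambda>b. sech x b ^ 2) UNIV
     else 2 * of_int n / sinh (x * of_int n))"

text \<open>The addition rule for sech a sech b at a = x (n - b). As tanh is odd, the sum of two
  tanh values becomes a difference of one sequence at b and b - n, which telescopes in b.\<close>

lemma sech_mult_eq:
  assumes "x > 0" "n \<noteq> 0"
  shows "sech x (n - b) * sech x b =
    (tanh (x * of_int b) - tanh (x * of_int (b - n))) / sinh (x * of_int n)"
proof -
  have "sinh (x * of_int n) = sinh (x * of_int b - x * of_int (b - n))"
    by (simp add: algebra_simps)
  also have "\<dots> = sinh (x * of_int b) * cosh (x * of_int (b - n)) - cosh (x * of_int b) * sinh (x * of_int (b - n))"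
    by (rule sinh_diff)
  finally have "(tanh (x * of_int b) - tanh (x * of_int (b - n))) =
      sinh (x * of_int n) * (1 / cosh (x * of_int b) * (1 / cosh (x * of_int (b - n))))"
    by (simp add: tanh_def field_simps)
  moreover have "1 / cosh (x * of_int (b - n)) = sech x (n - b)"
    using sech_minus[of x "b - n"] by (simp add: sech_def)
  moreover have "sinh (x * of_int n) \<noteq> 0" using assms by simp
  ultimately show ?thesis by (simp add: sech_def)
qed

lemma has_sum_sech_conv:
  assumes "x > 0"
  shows "((\<lambda>b. sech x (n - b) * sech x b) has_sum sech_conv x n) UNIV"
proof (cases "n = 0")
  case True
  thus ?thesis
    using summable_sech_sq[OF assms] by (simp add: sech_conv_def power2_eq_square)
next
  case False
  show ?thesis
    using has_sum_divide_const[OF tanh_telescope[OF assms, of 0 n], of "sinh (x * of_int n)"]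
    by (simp add: sech_mult_eq[OF assms False] sech_conv_def False)
qed

lemma sech_sum_sq:
  assumes "x > 0"
  shows "(sech_conv x has_sum (infsum (sech x) UNIV)\<^sup>2) UNIV"
  using has_sum_convolution[OF summable_sech summable_sech has_sum_sech_conv] assms
  by (simp add: power2_eq_square)

lemma altsgn_sech_sum_sq:
  assumes "x > 0"
  shows "((\<lambda>n. altsgn n * sech_conv x n) has_sum (infsum (\<lambda>n. altsgn n * sech x n) UNIV)\<^sup>2) UNIV"
  unfolding power2_eq_square
proof (rule has_sum_convolution)
  show "((\<lambda>b. altsgn (n - b) * sech x (n - b) * (altsgn b * sech x b)) has_sum
      altsgn n * sech_conv x n) UNIV" for n
  proof -
    have "altsgn (n - b) * sech x (n - b) * (altsgn b * sech x b) =
        altsgn n * (sech x (n - b) * sech x b)" for b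
      by (subst altsgn_diff_mult[of n b, symmetric]) (simp add: mult_ac)
    thus ?thesis
      using has_sum_cmult_right[OF has_sum_sech_conv[OF assms, of n], of "altsgn n"] by (simp only:)
  qed
qed (use summable_altsgn_sech assms in auto)

lemma
  fixes f :: "int \<Rightarrow> real"
  assumes "f summable_on UNIV"
  shows infsum_even_int: "infsum (\<lambda>n. f (2 * n)) UNIV =
            (infsum f UNIV + infsum (\<lambda>n. altsgn n * f n) UNIV) / 2"
    and infsum_odd_int: "infsum (\<lambda>n. if odd n then f n else 0) UNIV =
            (infsum f UNIV - infsum (\<lambda>n. altsgn n * f n) UNIV) / 2"
proof -
  have s: "(\<lambda>n. altsgn n * f n) summable_on UNIV"
    using assms unfolding summable_on_iff_abs_summable_on_real[of f]
    by (rule summable_on_real_bound) (simp add: abs_mult)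
  have F: "(f has_sum infsum f UNIV) UNIV"
    and G: "((\<lambda>n. altsgn n * f n) has_sum infsum (\<lambda>n. altsgn n * f n) UNIV) UNIV"
    using assms s by simp_all
  have "((\<lambda>n. (f n + altsgn n * f n) / 2) has_sum
      (infsum f UNIV + infsum (\<lambda>n. altsgn n * f n) UNIV) / 2) UNIV"
    by (intro has_sum_divide_const has_sum_add F G)
  also have "?this \<longleftrightarrow> (f has_sum
      (infsum f UNIV + infsum (\<lambda>n. altsgn n * f n) UNIV) / 2) {n. even n}"
    by (rule has_sum_cong_neutral) (auto simp: altsgn_def)
  also have "\<dots> \<longleftrightarrow> ((\<lambda>n. f (2 * n)) has_sum
      (infsum f UNIV + infsum (\<lambda>n. altsgn n * f n) UNIV) / 2) UNIV"
    by (rule has_sum_reindex_bij_witness[where i = "\<lambda>n. 2 * n" and j = "\<lambda>n. n div 2"]) auto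
  finally show "infsum (\<lambda>n. f (2 * n)) UNIV =
            (infsum f UNIV + infsum (\<lambda>n. altsgn n * f n) UNIV) / 2"
    by (rule infsumI)
  have "((\<lambda>n. (f n + - (altsgn n * f n)) / 2) has_sum
      (infsum f UNIV + - infsum (\<lambda>n. altsgn n * f n) UNIV) / 2) UNIV"
    by (intro has_sum_divide_const has_sum_add has_sum_uminusI F G)
  also have "(\<lambda>n. (f n + - (altsgn n * f n)) / 2) = (\<lambda>n. if odd n then f n else 0)"
    by (auto simp: altsgn_def)
  finally show "infsum (\<lambda>n. if odd n then f n else 0) UNIV =
            (infsum f UNIV - infsum (\<lambda>n. altsgn n * f n) UNIV) / 2"
    by (simp add: infsumI)
qed

text \<open>The unit difference of tanh has total mass 2 and is symmetric about 1/2, so its first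
  moment is 1. Translated by m it has first moment 1 + 2m, and the first n odd numbers add up to
  n^2.\<close>

lemma has_sum_int_times_tanh_diff:
  fixes x :: real
  assumes x: "x > 0"
  shows "((\<lambda>b::int. of_int b * (tanh (x * of_int b) - tanh (x * of_int (b - n)))) has_sum
           (of_int n)\<^sup>2) UNIV"
proof -
  let ?g = "\<lambda>b::int. tanh (x * of_int b)"
  have d: "?g b - ?g (b - 1) = sinh x * (sech x (1 - b) * sech x b)" for b
    using sech_mult_eq[OF x, of 1 b] x by simp
  have D: "((\<lambda>b. ?g b - ?g (b - 1)) has_sum 2) UNIV"
    using tanh_telescope[OF x, of 0 1] by simp
  have "(\<lambda>b. of_int b * (?g b - ?g (b - 1))) summable_on UNIV"
  proof (rule summable_on_real_bound)
    show "(\<lambda>b. sinh x * (of_int \<bar>b\<bar> ^ 1 * sech x b)) summable_on UNIV"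
      by (intro summable_on_cmult_right summable_power_sech x)
    show "\<bar>of_int b * (?g b - ?g (b - 1))\<bar> \<le> sinh x * (of_int \<bar>b\<bar> ^ 1 * sech x b)" for b
    proof -
      have "(sinh x * (of_int \<bar>b\<bar> ^ 1 * sech x b)) * sech x (1 - b) \<le> (sinh x * (of_int \<bar>b\<bar> ^ 1 * sech x b)) * 1"
        using x by (intro mult_left_mono sech_le_1) (simp add: sech_pos less_imp_le)
      thus ?thesis
        unfolding d using x by (simp add: abs_mult sech_pos less_imp_le mult_ac)
    qed
  qed
  then obtain E where E: "((\<lambda>b. of_int b * (?g b - ?g (b - 1))) has_sum E) UNIV"
    unfolding summable_on_def by blast
  \<comment> \<open>The reflection b \<mapsto> 1 - b fixes the difference and so evaluates E.\<close>
  have "((\<lambda>b. of_int (1 - b) * (?g b - ?g (b - 1))) has_sum E) UNIV"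
  proof -
    have "((\<lambda>b. of_int (1 - b) * (?g b - ?g (b - 1))) has_sum E) UNIV \<longleftrightarrow>
          ((\<lambda>b. of_int b * (?g b - ?g (b - 1))) has_sum E) UNIV"
    proof (rule has_sum_reindex_bij_witness[where i = "\<lambda>b. 1 - b" and j = "\<lambda>b. 1 - b"])
      fix b :: int
      have "?g (1 - b) - ?g (1 - b - 1) = ?g b - ?g (b - 1)"
        unfolding d by (simp add: mult.commute)
      thus "of_int (1 - b) * (?g (1 - b) - ?g (1 - b - 1)) = of_int (1 - b) * (?g b - ?g (b - 1))"
        by (simp only:)
    qed auto
    with E show ?thesis by simp
  qed
  from has_sum_add[OF this E] have "((\<lambda>b. ?g b - ?g (b - 1)) has_sum (E + E)) UNIV"
    by (simp add: algebra_simps)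
  from has_sum_unique[OF this D] have "E = 1" by simp
  with E have E1: "((\<lambda>b. of_int b * (?g b - ?g (b - 1))) has_sum 1) UNIV" by simp
  have shifted: "((\<lambda>b. of_int b * (?g (b - m) - ?g (b - m - 1))) has_sum (1 + 2 * of_int m)) UNIV" for m
  proof -
    have "((\<lambda>b. of_int b * (?g b - ?g (b - 1)) + of_int m * (?g b - ?g (b - 1))) has_sum
        (1 + of_int m * 2)) UNIV"
      by (intro has_sum_add has_sum_cmult_right E1 D)
    hence "((\<lambda>b. (of_int b + of_int m) * (?g b - ?g (b - 1))) has_sum (1 + 2 * of_int m)) UNIV"
      by (simp add: distrib_right mult.commute)
    from this[THEN has_sum_int_shift[THEN iffD2, of _ _ "- m"]] show ?thesis by simp
  qed
  show ?thesis
  proof (induction n rule: int_induct[where k = 0])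
    case base
    show ?case by simp
  next
    case (step1 i)
    from has_sum_add[OF step1(2) shifted[of i]] show ?case
      by (simp add: algebra_simps power2_eq_square)
  next
    case (step2 i)
    from has_sum_add[OF step2(2) has_sum_uminusI[OF shifted[of "i - 1"]]] show ?case
      by (simp add: algebra_simps power2_eq_square)
  qed
qed

text \<open>Partial fractions for 1 / (cosh v sinh u) with u = x b, v = x (b - n). The part 2b /
  (sinh u cosh u) equals 4b / sinh (2u), an even-indexed entry of the convolution square, and the
  rest is the summand of the first moment above; both can be summed over b.\<close>

lemma sech_times_conv:
  assumes x: "x > 0"
  shows "sech x (n - b) * sech_conv x b = sech x n *
    (sech_conv x (2 * b) + 2 * (of_int b * (tanh (x * of_int b) - tanh (x * of_int (b - n)))))"
proof (cases "b = 0")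
  case False
  define u v where "u = x * of_int b" and "v = x * of_int (b - n)"
  have n: "x * of_int n = u - v" "x * of_int (n - b) = - v"
    by (simp_all add: u_def v_def algebra_simps)
  have nz: "u \<noteq> 0" "sinh u \<noteq> 0" "cosh u \<noteq> 0" "cosh v \<noteq> 0" "cosh (u - v) \<noteq> 0"
    using x False by (simp_all add: u_def)
  have "1 / (sinh u * cosh u) + (tanh u - tanh v) =
      ((1 + (sinh u)\<^sup>2) * cosh v - sinh u * cosh u * sinh v) / (sinh u * cosh u * cosh v)"
    using nz by (simp add: tanh_def field_simps power2_eq_square)
  also have "1 + (sinh u)\<^sup>2 = (cosh u)\<^sup>2"
    by (simp add: cosh_square_eq)
  also have "(cosh u)\<^sup>2 * cosh v - sinh u * cosh u * sinh v = cosh u * cosh (u - v)"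
    unfolding cosh_diff by (simp add: power2_eq_square algebra_simps)
  also have "cosh u * cosh (u - v) / (sinh u * cosh u * cosh v) = cosh (u - v) / (sinh u * cosh v)"
    using nz by simp
  finally have key: "1 / cosh v * (1 / sinh u) =
      1 / cosh (u - v) * (1 / (sinh u * cosh u) + (tanh u - tanh v))"
    using nz by simp
  have "sech x (n - b) * sech_conv x b = 2 * of_int b * (1 / cosh v * (1 / sinh u))"
    using False unfolding sech_def sech_conv_def n u_def [symmetric] by simp
  also have "\<dots> = 1 / cosh (u - v) *
      (4 * of_int b / (2 * sinh u * cosh u) + 2 * (of_int b * (tanh u - tanh v)))"
    unfolding key by (simp add: algebra_simps)
  also have "4 * of_int b / (2 * sinh u * cosh u) = sech_conv x (2 * b)"
  proof -
    have "x * of_int (2 * b) = 2 * u" by (simp add: u_def)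
    hence "sech_conv x (2 * b) = 2 * of_int (2 * b) / (2 * sinh u * cosh u)"
      using False by (simp only: sech_conv_def sinh_double) simp
    thus ?thesis by simp
  qed
  finally show ?thesis
    unfolding sech_def n u_def v_def .
qed (simp add: sech_conv_def)

lemma summable_sech_conv: "x > 0 \<Longrightarrow> sech_conv x summable_on UNIV"
  using sech_sum_sq by (auto simp: summable_on_def)

lemma summable_sech_conv_even:
  assumes "x > 0"
  shows "(\<lambda>b. sech_conv x (2 * b)) summable_on UNIV"
proof -
  have "sech_conv x summable_on range (\<lambda>b. 2 * b)"
    by (rule summable_on_subset_banach[OF summable_sech_conv[OF assms]]) auto
  thus ?thesis by (subst (asm) summable_on_reindex) (auto simp: inj_on_def o_def)
qed

text \<open>Convolving the alternating sequence with its own convolution square gives M^3. By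
  \<open>sech_times_conv\<close> the same convolution is
  \<open>altsgn n * sech x n * (C + 2 n^2)\<close>, so twice the moment is M^3 - C M.\<close>

lemma altsgn_sech_second_moment:
  assumes x: "x > 0"
  defines "P \<equiv> infsum (sech x) UNIV" and "M \<equiv> infsum (\<lambda>n. altsgn n * sech x n) UNIV"
  shows "((\<lambda>n. altsgn n * (of_int n)\<^sup>2 * sech x n) has_sum (- M * (P\<^sup>2 - M\<^sup>2) / 4)) UNIV"
proof -
  define C where "C = infsum (\<lambda>b. sech_conv x (2 * b)) UNIV"
  \<comment> \<open>The even entries of the convolution square sum to the mean of its plain sum P^2
    and its alternating sum M^2.\<close>
  have C: "C = (P\<^sup>2 + M\<^sup>2) / 2"
    using infsum_even_int[OF summable_sech_conv[OF x]] sech_sum_sq[OF x] altsgn_sech_sum_sq[OF x]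
    by (simp add: C_def P_def M_def has_sum_iff)
  have inner: "((\<lambda>b. altsgn (n - b) * sech x (n - b) * (altsgn b * sech_conv x b)) has_sum
      (altsgn n * (sech x n * (C + 2 * (of_int n)\<^sup>2)))) UNIV" for n
  proof -
    have "((\<lambda>b. altsgn n * (sech x n *
      (sech_conv x (2 * b) + 2 * (of_int b * (tanh (x * of_int b) - tanh (x * of_int (b - n))))))) has_sum
      (altsgn n * (sech x n * (C + 2 * (of_int n)\<^sup>2)))) UNIV"
      unfolding C_def
      by (intro has_sum_cmult_right has_sum_add has_sum_int_times_tanh_diff x has_sum_infsum
          summable_sech_conv_even)
    moreover have "altsgn (n - b) * sech x (n - b) * (altsgn b * sech_conv x b) =
        altsgn n * (sech x (n - b) * sech_conv x b)" for b
      by (subst altsgn_diff_mult[of n b, symmetric]) (simp add: mult_ac)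
    ultimately show ?thesis
      by (simp only: sech_times_conv[OF x])
  qed
  have "((\<lambda>n. altsgn n * (sech x n * (C + 2 * (of_int n)\<^sup>2))) has_sum (M * M\<^sup>2)) UNIV"
    using has_sum_convolution[OF summable_altsgn_sech[OF x] _ inner] altsgn_sech_sum_sq[OF x]
    by (simp add: M_def has_sum_iff)
  moreover have "((\<lambda>n. C * (altsgn n * sech x n)) has_sum (C * M)) UNIV"
    using summable_altsgn_sech[OF x] unfolding M_def
    by (intro has_sum_cmult_right has_sum_infsum)
  ultimately have "((\<lambda>n. altsgn n * (sech x n * (C + 2 * (of_int n)\<^sup>2)) + - (C * (altsgn n * sech x n)))
      has_sum (M * M\<^sup>2 + - (C * M))) UNIV"
    by (intro has_sum_add has_sum_uminusI)
  hence "((\<lambda>n. (1/2) * (altsgn n * (sech x n * (C + 2 * (of_int n)\<^sup>2)) + - (C * (altsgn n * sech x n))))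
      has_sum ((1/2) * (M * M\<^sup>2 + - (C * M)))) UNIV"
    by (rule has_sum_cmult_right)
  moreover have "(1/2) * (altsgn n * (sech x n * (C + 2 * (of_int n)\<^sup>2)) + - (C * (altsgn n * sech x n)))
      = altsgn n * (of_int n)\<^sup>2 * sech x n" for n
    by (simp add: algebra_simps)
  moreover have "(1/2) * (M * M\<^sup>2 + - (C * M)) = - M * (P\<^sup>2 - M\<^sup>2) / 4"
    by (simp add: C field_simps)
  ultimately show ?thesis by simp
qed

section \<open>Squares of sech at odd indices as a Lambert series\<close>

lemma alternating_geometric_deriv_sums:
  fixes r :: real
  assumes "0 < r" "r < 1"
  shows "((\<lambda>i. (-1) ^ i * of_nat (Suc i) * r ^ Suc i) has_sum (r / (1 + r)\<^sup>2)) UNIV"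
    and "(\<lambda>i. of_nat (Suc i) * r ^ Suc i) summable_on UNIV"
proof -
  have "(\<lambda>i. r * (of_nat (Suc i) * r ^ i)) sums (r * (1 / (1 - r)\<^sup>2))"
    using assms by (intro sums_mult geometric_deriv_sums) auto
  hence s: "summable (\<lambda>i. of_nat (Suc i) * r ^ Suc i)"
    by (simp add: sums_iff mult_ac)
  show "(\<lambda>i. of_nat (Suc i) * r ^ Suc i) summable_on UNIV"
    by (rule summable_nonneg_imp_summable_on[OF s]) (use assms in auto)
  have "(\<lambda>i. r * (of_nat (Suc i) * (- r) ^ i)) sums (r * (1 / (1 - (- r))\<^sup>2))"
    using assms by (intro sums_mult geometric_deriv_sums) auto
  also have "(\<lambda>i. r * (of_nat (Suc i) * (- r) ^ i)) = (\<lambda>i. (-1) ^ i * of_nat (Suc i) * r ^ Suc i)"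
    by (simp add: fun_eq_iff power_minus[of r] mult_ac)
  finally have "(\<lambda>i. (-1) ^ i * of_nat (Suc i) * r ^ Suc i) sums (r / (1 + r)\<^sup>2)" by simp
  moreover have "summable (\<lambda>i. norm ((-1) ^ i * of_nat (Suc i) * r ^ Suc i))"
    using s assms by (simp add: abs_mult power_abs)
  ultimately show "((\<lambda>i. (-1) ^ i * of_nat (Suc i) * r ^ Suc i) has_sum (r / (1 + r)\<^sup>2)) UNIV"
    by (intro norm_summable_imp_has_sum)
qed

lemma has_sum_int_even_fun:
  fixes f :: "int \<Rightarrow> real"
  assumes "\<And>n. f (- n) = f n" and "((\<lambda>i. f (int (Suc i))) has_sum s) UNIV"
  shows "(f has_sum (2 * s)) (UNIV - {0})"
proof -
  have "((\<lambda>i. f (int (Suc i))) has_sum s) UNIV \<longleftrightarrow> (f has_sum s) {0<..}"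
    by (rule has_sum_reindex_bij_witness[where i = "\<lambda>n. nat (n - 1)" and j = "\<lambda>i. int (Suc i)"]) auto
  moreover have "((\<lambda>i. f (int (Suc i))) has_sum s) UNIV \<longleftrightarrow> (f has_sum s) {..<0}"
  proof (rule has_sum_reindex_bij_witness[where i = "\<lambda>n. nat (- n - 1)" and j = "\<lambda>i. - int (Suc i)"])
    show "f (- int (Suc i)) = f (int (Suc i))" for i by (rule assms(1))
  qed auto
  ultimately have "(f has_sum (s + s)) ({0<..} \<union> {..<0})"
    using assms(2) by (intro has_sum_Un_disjoint) auto
  moreover have "{0<..} \<union> {..<0} = UNIV - {0::int}" by auto
  ultimately show ?thesis by simp
qed

lemma has_sum_int_odd_even_fun:
  fixes f :: "int \<Rightarrow> real"
  assumes "\<And>n. f (- n) = f n" and "((\<lambda>j. f (2 * int j + 1)) has_sum s) UNIV"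
  shows "((\<lambda>n. if odd n then f n else 0) has_sum (2 * s)) UNIV"
proof -
  have "((\<lambda>j. f (2 * int j + 1)) has_sum s) UNIV \<longleftrightarrow> (f has_sum s) {n. odd n \<and> n > 0}"
    by (rule has_sum_reindex_bij_witness[where i = "\<lambda>n. nat (n div 2)" and j = "\<lambda>i. 2 * int i + 1"])
       (auto elim!: oddE)
  moreover have "((\<lambda>j. f (2 * int j + 1)) has_sum s) UNIV \<longleftrightarrow> (f has_sum s) {n. odd n \<and> n < 0}"
  proof (rule has_sum_reindex_bij_witness[where i = "\<lambda>n. nat ((- n) div 2)" and j = "\<lambda>i. - (2 * int i + 1)"])
    show "f (- (2 * int i + 1)) = f (2 * int i + 1)" for i by (rule assms(1))
    show "- (2 * int (nat (- b div 2)) + 1) = b" if "b \<in> {n. odd n \<and> n < 0}" for b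
      using that by (auto elim!: oddE)
  qed auto
  ultimately have "(f has_sum (s + s)) ({n. odd n \<and> n > 0} \<union> {n. odd n \<and> n < 0})"
    using assms(2) by (intro has_sum_Un_disjoint) auto
  moreover have "{n. odd n \<and> n > 0} \<union> {n. odd n \<and> n < 0} = {n::int. odd n}"
    by auto presburger
  ultimately have "(f has_sum (2 * s)) {n. odd n}" by simp
  thus ?thesis
    by (subst has_sum_cong_neutral[where T = "{n. odd n}" and g = f]) auto
qed

lemma sech_sq_exp:
  fixes y :: real
  assumes "y > 0"
  shows "(1 / cosh y)\<^sup>2 = 4 * (exp (- 2 * y) / (1 + exp (- 2 * y))\<^sup>2)"
proof -
  define u where "u = exp y"
  have u: "u > 0" by (simp add: u_def)
  have e: "exp (- 2 * y) = 1 / (u * u)"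
    by (simp add: u_def exp_minus divide_inverse flip: exp_add)
  have "1 / cosh y = 2 * u / (1 + u * u)"
    using u by (simp add: cosh_def exp_minus u_def [symmetric] field_simps add_pos_pos)
  also have "\<dots> ^ 2 = 4 * (exp (- 2 * y) / (1 + exp (- 2 * y))\<^sup>2)"
    unfolding e using u by (simp add: power2_eq_square divide_simps add_pos_pos add.commute)
  finally show ?thesis .
qed

lemma inverse_sinh_exp:
  fixes y :: real
  assumes "y > 0"
  shows "1 / sinh y = 2 * (exp (- y) / (1 - exp (- 2 * y)))"
proof -
  have "exp (- 2 * y) = exp (- y) * exp (- y)" by (simp flip: exp_add)
  moreover have "exp (- y) * exp y = 1" by (simp flip: exp_add)
  moreover have "exp (- 2 * y) < 1" "exp (- y) < exp y" using assms by auto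
  moreover define u v where "u = exp y" and "v = exp (- y)"
  ultimately have "exp (- 2 * y) = v * v" "v * u = 1" "v * v < 1" "v < u" by auto
  thus ?thesis
    by (simp add: sinh_def u_def [symmetric] v_def [symmetric] field_simps)
qed

text \<open>Both sides are the Lambert series
  \<open>8 (\<Sum>j\<ge>0. \<Sum>m\<ge>1. (-1)^(m-1) m exp (- 2 m (2 j + 1) x))\<close>.\<close>
lemma sum_odd_sech_sq:
  assumes x: "x > 0"
  shows "((\<lambda>n. if odd n then (sech x n)\<^sup>2 else 0) has_sum
          (- infsum (\<lambda>m. altsgn m * sech_conv (2 * x) m) (UNIV - {0}))) UNIV"
proof -
  \<comment> \<open>Here m = i + 1. The factor is 4, half of 8, because only positive m and positive
    odd n are summed; evenness doubles both sides at the end.\<close>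
  define F :: "nat \<Rightarrow> nat \<Rightarrow> real" where
    "F i j = 4 * ((-1) ^ i * of_nat (Suc i) * exp (- 2 * ((2 * real j + 1) * x)) ^ Suc i)" for i j
  have F_alt: "F i j = 4 * (-1) ^ i * of_nat (Suc i) * exp (- 2 * (Suc i * x)) *
      exp (- 4 * (Suc i * x)) ^ j" for i j
    unfolding F_def by (simp add: algebra_simps flip: exp_add exp_of_nat_mult)
  let ?a = "\<lambda>i. 4 * of_nat (Suc i) * exp (- 2 * (Suc i * x)) * (1 / (1 - exp (- 4 * (Suc i * x))))"
  have a: "?a i = sech_conv (2 * x) (int (Suc i))" for i
  proof -
    have e: "- 2 * (real (Suc i) * x) = - (2 * x * real (Suc i))"
        "- 4 * (real (Suc i) * x) = - 2 * (2 * x * real (Suc i))"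
      by simp_all
    have "sech_conv (2 * x) (int (Suc i)) = 2 * real (Suc i) * (1 / sinh (2 * x * real (Suc i)))"
      by (simp add: sech_conv_def del: of_nat_Suc)
    also have "1 / sinh (2 * x * real (Suc i)) =
        2 * (exp (- (2 * x * real (Suc i))) / (1 - exp (- 2 * (2 * x * real (Suc i)))))"
      using x by (intro inverse_sinh_exp) simp
    finally show ?thesis
      unfolding e by simp
  qed
  have geo: "((\<lambda>j. exp (- 4 * (Suc i * x)) ^ j) has_sum (1 / (1 - exp (- 4 * (Suc i * x))))) UNIV" for i
    using x by (intro sums_nonneg_imp_has_sum geometric_sums) auto
  have inner: "(F i has_sum ((-1) ^ i * ?a i)) UNIV" for i
  proof -
    have "(F i has_sum (4 * (-1) ^ i * of_nat (Suc i) * exp (- 2 * (Suc i * x)) *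
        (1 / (1 - exp (- 4 * (Suc i * x)))))) UNIV"
      unfolding F_alt [abs_def] by (intro has_sum_cmult_right geo)
    thus ?thesis by (simp only: mult_ac)
  qed
  have s0: "sech_conv (2 * x) summable_on UNIV" using x by (intro summable_sech_conv) simp
  have "(\<lambda>i. sech_conv (2 * x) (int (Suc i))) summable_on UNIV"
  proof -
    have "sech_conv (2 * x) summable_on range (\<lambda>i. int (Suc i))"
      by (rule summable_on_subset_banach[OF s0]) auto
    thus ?thesis by (subst (asm) summable_on_reindex) (auto simp: inj_on_def o_def)
  qed
  hence sa: "?a summable_on UNIV" by (simp only: a)
  have absF: "\<bar>F i j\<bar> = 4 * of_nat (Suc i) * exp (- 2 * (Suc i * x)) * exp (- 4 * (Suc i * x)) ^ j" for i j
    by (simp add: F_alt abs_mult power_abs)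
  have sF: "(\<lambda>(i, j). F i j) summable_on UNIV \<times> UNIV"
  proof (rule summable_on_real_bound)
    show "(\<lambda>(i, j). \<bar>F i j\<bar>) summable_on UNIV \<times> UNIV"
    proof (rule summable_on_SigmaI[OF _ sa])
      show "((\<lambda>j. case (i, j) of (i, j) \<Rightarrow> \<bar>F i j\<bar>) has_sum ?a i) UNIV" for i
        unfolding prod.case absF by (intro has_sum_cmult_right geo)
    qed auto
  qed auto
  define Z where "Z = infsum (\<lambda>(i, j). F i j) (UNIV \<times> UNIV)"
  have Z: "((\<lambda>(i, j). F i j) has_sum Z) (UNIV \<times> UNIV)"
    using sF unfolding Z_def by simp
  have "((\<lambda>i. (-1) ^ i * ?a i) has_sum Z) UNIV"
    by (rule has_sum_SigmaD[OF Z]) (use inner in simp)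
  moreover have "(-1) ^ i * ?a i = - (altsgn (int (Suc i)) * sech_conv (2 * x) (int (Suc i)))" for i
    unfolding a by (cases "even i") (simp_all add: altsgn_def)
  ultimately have "((\<lambda>i. - (altsgn (int (Suc i)) * sech_conv (2 * x) (int (Suc i)))) has_sum Z) UNIV"
    by (simp only:)
  hence Z1: "((\<lambda>m. - (altsgn m * sech_conv (2 * x) m)) has_sum (2 * Z)) (UNIV - {0})"
    by (intro has_sum_int_even_fun) (simp_all add: altsgn_def sech_conv_def)
  have "((\<lambda>j. 4 * (exp (- 2 * ((2 * real j + 1) * x)) / (1 + exp (- 2 * ((2 * real j + 1) * x)))\<^sup>2)) has_sum Z) (UNIV :: nat set)"
  proof (rule has_sum_SigmaD)
    show "((\<lambda>(j, i). F i j) has_sum Z) (UNIV \<times> UNIV)"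
      using Z by (subst has_sum_swap) simp
    show "((\<lambda>i. case (j, i) of (j, i) \<Rightarrow> F i j) has_sum
        4 * (exp (- 2 * ((2 * real j + 1) * x)) / (1 + exp (- 2 * ((2 * real j + 1) * x)))\<^sup>2)) UNIV" for j
      unfolding F_def prod.case using x
      by (intro has_sum_cmult_right alternating_geometric_deriv_sums) auto
  qed
  also have "(\<lambda>j. 4 * (exp (- 2 * ((2 * real j + 1) * x)) / (1 + exp (- 2 * ((2 * real j + 1) * x)))\<^sup>2)) =
      (\<lambda>j. (sech x (2 * int j + 1))\<^sup>2)"
    using x by (intro ext, subst sech_sq_exp [symmetric]) (simp_all add: sech_def mult.commute)
  finally have "((\<lambda>n. if odd n then (sech x n)\<^sup>2 else 0) has_sum (2 * Z)) UNIV"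
    by (intro has_sum_int_odd_even_fun) auto
  moreover from Z1 have "2 * Z = - infsum (\<lambda>m. altsgn m * sech_conv (2 * x) m) (UNIV - {0})"
    by (subst infsum_uminus [symmetric]) (simp add: infsumI)
  ultimately show ?thesis by simp
qed

section \<open>The duplication recursion\<close>

text \<open>Doubling the index is the same as doubling x: this is where arguments 2x and 4x come
  from.\<close>

lemma infsum_even_sech: "infsum (\<lambda>n. sech x (2 * n)) UNIV = infsum (sech (2 * x)) UNIV"
  by (rule infsum_cong) (simp add: sech_def mult_ac)

text \<open>The odd-indexed part \<open>w\<close> has sum P(x) - P(2x). Its convolution square lives
  on even n = 2m and equals 2m / sinh (2mx) for m nonzero, which is the convolution square belonging
  to 2x. Hence the left side is P(2x)^2 - M(2x)^2, and M(2x) = 2 P(4x) - P(2x).\<close>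

lemma sech_agm:
  assumes x: "x > 0"
  defines "P \<equiv> \<lambda>y. infsum (sech y) UNIV"
  shows "(P x - P (2 * x))\<^sup>2 = 4 * (P (2 * x) - P (4 * x)) * P (4 * x)"
proof -
  define M where "M y = infsum (\<lambda>n. altsgn n * sech y n) UNIV" for y
  have even: "P (2 * y) = (P y + M y) / 2" if "y > 0" for y
    using infsum_even_int[OF summable_sech[OF that]] unfolding infsum_even_sech P_def M_def .
  define w where "w n = (if odd n then sech x n else 0)" for n
  have w: "infsum w UNIV = P x - P (2 * x)"
    using infsum_odd_int[OF summable_sech[OF x]] even[OF x]
    unfolding w_def P_def M_def by (simp add: field_simps)
  have sw: "w summable_on UNIV"
    by (rule summable_on_real_bound[OF summable_sech[OF x]]) (simp add: w_def sech_pos less_imp_le)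
  define Od where "Od = - infsum (\<lambda>m. altsgn m * sech_conv (2 * x) m) (UNIV - {0})"
  define c where "c n = (if odd n then 0 else if n = 0 then Od else sech_conv (2 * x) (n div 2))" for n
  have c: "((\<lambda>b. w (n - b) * w b) has_sum c n) UNIV" for n
  proof (cases "odd n \<or> n = 0")
    case True
    thus ?thesis
    proof
      assume "odd n"
      hence "(\<lambda>b. w (n - b) * w b) = (\<lambda>_. 0)" "c n = 0" by (auto simp: w_def c_def)
      thus ?thesis by simp
    next
      assume "n = 0"
      hence "(\<lambda>b. w (n - b) * w b) = (\<lambda>n. if odd n then (sech x n)\<^sup>2 else 0)" "c n = Od"
        by (auto simp: w_def c_def power2_eq_square)
      thus ?thesis using sum_odd_sech_sq[OF x] unfolding Od_def by simp
    qed
  next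
    case False
    then obtain m where n: "n = 2 * m" and m: "m \<noteq> 0" by auto
    \<comment> \<open>Odd indices are b = 2k + 1: the step in k is 2x, the offset is x, and a shift
      of b by n = 2m is a shift of k by m.\<close>
    have "((\<lambda>k. tanh (2 * x * of_int k + x) - tanh (2 * x * of_int (k - m) + x)) has_sum (2 * of_int m)) UNIV"
      using x by (intro tanh_telescope) simp
    hence "((\<lambda>k. (tanh (2 * x * of_int k + x) - tanh (2 * x * of_int (k - m) + x)) / sinh (x * of_int n))
        has_sum (2 * of_int m / sinh (x * of_int n))) UNIV"
      by (rule has_sum_divide_const)
    moreover have "(tanh (2 * x * of_int k + x) - tanh (2 * x * of_int (k - m) + x)) / sinh (x * of_int n) =
        sech x (n - (2 * k + 1)) * sech x (2 * k + 1)" for k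
    proof -
      have "2 * x * of_int k + x = x * of_int (2 * k + 1)"
        and "2 * x * of_int (k - m) + x = x * of_int (2 * k + 1 - n)"
        by (simp_all add: n algebra_simps)
      moreover have "n \<noteq> 0" using n m by simp
      note sech_mult_eq[OF x this, of "2 * k + 1"]
      ultimately show ?thesis by (simp only:)
    qed
    ultimately have "((\<lambda>k. sech x (n - (2 * k + 1)) * sech x (2 * k + 1)) has_sum
        (2 * of_int m / sinh (x * of_int n))) UNIV"
      by (simp only:)
    also have "2 * of_int m / sinh (x * of_int n) = c n"
      using m by (simp add: c_def sech_conv_def n mult_ac)
    also have "((\<lambda>k. sech x (n - (2 * k + 1)) * sech x (2 * k + 1)) has_sum c n) UNIV \<longleftrightarrow>
        ((\<lambda>b. w (n - b) * w b) has_sum c n) {b. odd b}"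
      by (rule has_sum_reindex_bij_witness[where i = "\<lambda>b. b div 2" and j = "\<lambda>k. 2 * k + 1"])
         (auto simp: w_def n)
    also have "\<dots> \<longleftrightarrow> ((\<lambda>b. w (n - b) * w b) has_sum c n) UNIV"
      by (rule has_sum_cong_neutral) (auto simp: w_def)
    finally show ?thesis .
  qed
  have "(c has_sum (infsum w UNIV)\<^sup>2) UNIV"
    using has_sum_convolution[OF sw sw c] by (simp add: power2_eq_square)
  also have "?this \<longleftrightarrow> (c has_sum (infsum w UNIV)\<^sup>2) {n. even n}"
    by (rule has_sum_cong_neutral) (auto simp: c_def)
  also have "\<dots> \<longleftrightarrow> ((\<lambda>m. c (2 * m)) has_sum (infsum w UNIV)\<^sup>2) UNIV"
    by (rule has_sum_reindex_bij_witness[where i = "\<lambda>n. 2 * n" and j = "\<lambda>n. n div 2"]) auto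
  finally have W: "((\<lambda>m. c (2 * m)) has_sum (infsum w UNIV)\<^sup>2) UNIV" .
  have "infsum (\<lambda>m. c (2 * m)) UNIV = Od + infsum (\<lambda>m. c (2 * m)) (UNIV - {0})"
  proof -
    have "infsum (\<lambda>m. c (2 * m)) (insert 0 (UNIV - {0})) = c (2 * 0) + infsum (\<lambda>m. c (2 * m)) (UNIV - {0})"
      by (rule infsum_insert) (use W in \<open>auto simp: has_sum_iff intro: summable_on_subset_banach\<close>)
    thus ?thesis by (simp add: c_def insert_UNIV flip: insert_Diff_if)
  qed
  hence "(infsum w UNIV)\<^sup>2 = Od + infsum (\<lambda>m. c (2 * m)) (UNIV - {0})"
    using W by (simp add: infsumI)
  also have "infsum (\<lambda>m. c (2 * m)) (UNIV - {0}) = infsum (sech_conv (2 * x)) (UNIV - {0})"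
    by (rule infsum_cong) (simp add: c_def)
  \<comment> \<open>The entry at 0 enters the plain and the alternating sum with the same sign, so
    it can be inserted into both and cancels.\<close>
  also have "Od + infsum (sech_conv (2 * x)) (UNIV - {0}) =
      (sech_conv (2 * x) 0 + infsum (sech_conv (2 * x)) (UNIV - {0})) -
      (altsgn 0 * sech_conv (2 * x) 0 + infsum (\<lambda>m. altsgn m * sech_conv (2 * x) m) (UNIV - {0}))"
    by (simp add: Od_def altsgn_def)
  also have "\<dots> = infsum (sech_conv (2 * x)) UNIV - infsum (\<lambda>m. altsgn m * sech_conv (2 * x) m) UNIV"
  proof -
    have "infsum f (insert 0 (UNIV - {0})) = f 0 + infsum f (UNIV - {0})"
      if "f summable_on UNIV" for f :: "int \<Rightarrow> real"
      by (rule infsum_insert) (use that in \<open>auto intro: summable_on_subset_banach\<close>)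
    moreover have "insert 0 (UNIV - {0}) = (UNIV :: int set)" by auto
    ultimately have "infsum f UNIV = f 0 + infsum f (UNIV - {0})"
      if "f summable_on UNIV" for f :: "int \<Rightarrow> real"
      using that by metis
    note split0 = this
    show ?thesis
      using sech_sum_sq[of "2 * x"] altsgn_sech_sum_sq[of "2 * x"] x
      by (subst (1 2) split0) (auto simp: has_sum_iff)
  qed
  also have "\<dots> = (P (2 * x))\<^sup>2 - (M (2 * x))\<^sup>2"
    using sech_sum_sq[of "2 * x"] altsgn_sech_sum_sq[of "2 * x"] x
    by (simp add: P_def M_def infsumI)
  also have "M (2 * x) = 2 * P (4 * x) - P (2 * x)"
    using even[of "2 * x"] x by simp
  also have "(P (2 * x))\<^sup>2 - (2 * P (4 * x) - P (2 * x))\<^sup>2 = 4 * (P (2 * x) - P (4 * x)) * P (4 * x)"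
    by (simp add: power2_eq_square algebra_simps)
  finally show ?thesis by (simp add: w)
qed

text \<open>A comparison \<open>w \<le> c w'\<close> near infinity passes to \<open>a = 1 + \<Sum>k. w (2^k x)\<close> and then, through the
  recursion for \<open>w\<^sup>2\<close>, to arguments half as large.\<close>
lemma agm_le:
  fixes a a' :: "real \<Rightarrow> real"
  assumes a_pos: "\<And>x. x > 0 \<Longrightarrow> a x > 0" "\<And>x. x > 0 \<Longrightarrow> a' x > 0"
    and w_pos: "\<And>x. x > 0 \<Longrightarrow> a x - a (2 * x) > 0" "\<And>x. x > 0 \<Longrightarrow> a' x - a' (2 * x) > 0"
    and agm: "\<And>x. x > 0 \<Longrightarrow> (a x - a (2 * x))\<^sup>2 = 4 * (a (2 * x) - a (4 * x)) * a (4 * x)"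
      "\<And>x. x > 0 \<Longrightarrow> (a' x - a' (2 * x))\<^sup>2 = 4 * (a' (2 * x) - a' (4 * x)) * a' (4 * x)"
    and lim: "(a \<longlongrightarrow> 1) at_top" "(a' \<longlongrightarrow> 1) at_top"
    and ratio: "((\<lambda>x. (a x - a (2 * x)) / (a' x - a' (2 * x))) \<longlongrightarrow> 1) at_top"
    and x: "x > 0"
  shows "a x \<le> a' x"
proof -
  define w w' where "w y = a y - a (2 * y)" and "w' y = a' y - a' (2 * y)" for y
  \<comment> \<open>Along y, 2y, 4y, ... the quantity \<open>c * a' - a\<close> decreases, and its
    limit c - 1 is nonnegative.\<close>
  have a_le: "a y \<le> c * a' y" if c: "c \<ge> 1" and y: "y > 0" and le: "\<And>z. z \<ge> y \<Longrightarrow> w z \<le> c * w' z" for c y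
  proof -
    let ?d = "\<lambda>k. c * a' (2 ^ k * y) - a (2 ^ k * y)"
    have "?d (Suc k) \<le> ?d k" for k
    proof -
      have "y * 1 \<le> y * 2 ^ k" using y by (intro mult_left_mono) auto
      hence "w (2 ^ k * y) \<le> c * w' (2 ^ k * y)" by (intro le) (simp add: mult.commute)
      thus ?thesis by (simp add: w_def w'_def algebra_simps)
    qed
    hence "decseq ?d" by (rule decseq_SucI)
    moreover have "filterlim (\<lambda>k. 2 ^ k * y) at_top sequentially"
      using y by real_asymp
    hence "?d \<longlonglongrightarrow> c * 1 - 1"
      by (intro tendsto_intros filterlim_compose[OF lim(1)] filterlim_compose[OF lim(2)])
    ultimately have "c * 1 - 1 \<le> ?d 0" by (rule decseq_ge)
    with c show ?thesis by simp
  qed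
  have "w y \<le> c * w' y" if c: "c > 1" and y: "y > 0" for c y
  proof -
    have "eventually (\<lambda>x. w x / w' x < c) at_top"
      using order_tendstoD(2)[OF ratio c] by (simp add: w_def w'_def)
    then obtain X0 where X0: "\<And>x. x \<ge> X0 \<Longrightarrow> w x / w' x < c"
      by (auto simp: eventually_at_top_linorder)
    define X where "X = max X0 1"
    have base: "w z \<le> c * w' z" if "z \<ge> X" for z
      using X0[of z] that w_pos(2)[of z] unfolding X_def w'_def [symmetric] by (simp add: divide_less_eq)
    have "\<forall>z > 0. z \<ge> X / 2 ^ k \<longrightarrow> w z \<le> c * w' z" for k
    proof (induction k)
      case 0
      thus ?case using base by simp
    next
      case (Suc k)
      show ?case
      proof (intro allI impI)
        fix z assume z: "z > 0" "z \<ge> X / 2 ^ Suc k"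
        have le: "w u \<le> c * w' u" if "u \<ge> 2 * z" for u
        proof -
          have "X / 2 ^ k = 2 * (X / 2 ^ Suc k)" by simp
          with z that have "u > 0" "X / 2 ^ k \<le> u" by linarith+
          with Suc show ?thesis by blast
        qed
        have "(w z)\<^sup>2 = 4 * w (2 * z) * a (4 * z)"
          using agm(1)[OF z(1)] by (simp add: w_def)
        \<comment> \<open>Each of the two factors costs one c, and the square root of c^2 is c
          again: the constant does not deteriorate when the argument is halved.\<close>
        also have "\<dots> \<le> 4 * (c * w' (2 * z)) * (c * a' (4 * z))"
          using z c le a_pos w_pos[of "2 * z"]
          by (intro mult_mono a_le le) (auto simp: w_def w'_def less_imp_le)
        also have "\<dots> = c\<^sup>2 * (4 * w' (2 * z) * a' (4 * z))"
          by (simp add: power2_eq_square)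
        also have "4 * w' (2 * z) * a' (4 * z) = (w' z)\<^sup>2"
          using agm(2)[OF z(1)] by (simp add: w'_def)
        also have "c\<^sup>2 * (w' z)\<^sup>2 = (c * w' z)\<^sup>2" by (simp add: power_mult_distrib)
        finally show "w z \<le> c * w' z"
          by (rule power2_le_imp_le) (use c w_pos(2)[OF z(1)] in \<open>auto simp: w'_def\<close>)
      qed
    qed
    moreover obtain k where "X / y < 2 ^ k"
      using real_arch_pow[of 2 "X / y"] by auto
    hence "y \<ge> X / 2 ^ k" using y by (simp add: field_simps)
    ultimately show ?thesis using y by blast
  qed
  hence le: "a x \<le> c * a' x" if "c > 1" for c
    using that x by (intro a_le) auto
  have "a x \<le> a' x + e" if "e > 0" for e
  proof -
    have "(1 + e / a' x) * a' x = a' x + e" using a_pos(2)[OF x] by (simp add: field_simps)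
    with le[of "1 + e / a' x"] that a_pos(2)[OF x] show ?thesis by simp
  qed
  thus ?thesis by (rule field_le_epsilon)
qed

section \<open>Theta series\<close>

text \<open>Tannery's theorem: the bound \<open>M\<close> makes the finite partial sums converge
  uniformly on \<open>Y\<close>, so the two limits commute.\<close>

lemma tendsto_infsum_dominated:
  fixes f :: "'a \<Rightarrow> 'b \<Rightarrow> real"
  assumes lim: "\<And>n. n \<in> X \<Longrightarrow> (f n \<longlongrightarrow> L n) F"
    and bound: "\<And>n x. n \<in> X \<Longrightarrow> x \<in> Y \<Longrightarrow> \<bar>f n x\<bar> \<le> M n"
    and M: "M summable_on X" and Y: "eventually (\<lambda>x. x \<in> Y) F" and "F \<noteq> bot"
  shows "((\<lambda>x. infsum (\<lambda>n. f n x) X) \<longlongrightarrow> infsum L X) F"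
proof (rule swap_uniform_limit')
  show "uniform_limit Y (\<lambda>A x. \<Sum>n\<in>A. f n x) (\<lambda>x. infsum (\<lambda>n. f n x) X) (finite_subsets_at_top X)"
    by (rule Weierstrass_m_test_general) (use bound M in auto)
  show "\<forall>\<^sub>F A in finite_subsets_at_top X. ((\<lambda>x. \<Sum>n\<in>A. f n x) \<longlongrightarrow> (\<Sum>n\<in>A. L n)) F"
    by (intro eventually_finite_subsets_at_top_weakI tendsto_sum lim) auto
  have "\<bar>L n\<bar> \<le> M n" if n: "n \<in> X" for n
  proof (rule tendsto_upperbound)
    show "((\<lambda>x. \<bar>f n x\<bar>) \<longlongrightarrow> \<bar>L n\<bar>) F" by (intro tendsto_rabs lim n)
    show "\<forall>\<^sub>F x in F. \<bar>f n x\<bar> \<le> M n" using Y by eventually_elim (use bound n in auto)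
  qed fact
  hence "L summable_on X" by (intro summable_on_real_bound[OF M])
  thus "((\<lambda>A. \<Sum>n\<in>A. L n) \<longlongrightarrow> infsum L X) (finite_subsets_at_top X)"
    by (rule infsum_tendsto)
qed (use Y in auto)

text \<open>The variable is x = - ln q, so that passing from q to q^2 doubles x, as for the sech
  sums.\<close>

definition theta3 :: "real \<Rightarrow> real" where
  "theta3 x = infsum (\<lambda>n::int. exp (- x * of_int (n\<^sup>2))) UNIV"

definition theta4 :: "real \<Rightarrow> real" where
  "theta4 x = infsum (\<lambda>n. altsgn n * exp (- x * of_int (n\<^sup>2))) UNIV"

text \<open>With \<open>q = exp (-x)\<close> this is \<open>q^(-1/4) theta2(q)\<close>, as \<open>(n + 1/2)^2 = n (n + 1) + 1/4\<close>.\<close>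
definition theta2r :: "real \<Rightarrow> real" where
  "theta2r x = infsum (\<lambda>n::int. exp (- x * of_int (n * (n + 1)))) UNIV"

lemma int_abs_le_sq: "\<bar>n\<bar> \<le> (n::int)\<^sup>2"
proof (cases "n = 0")
  case False
  hence "\<bar>n\<bar> * 1 \<le> \<bar>n\<bar> * \<bar>n\<bar>" by (intro mult_left_mono) auto
  thus ?thesis by (simp add: power2_eq_square)
qed simp

text \<open>The loss of 1 is forced by n = -1, where the right side is 0.\<close>

lemma int_abs_le_pronic: "\<bar>n\<bar> - 1 \<le> (n::int) * (n + 1)"
proof (cases "n \<ge> 0")
  case True
  have "0 \<le> n * n" by simp
  with True show ?thesis by (simp add: algebra_simps)
next
  case False
  have "0 \<le> (n + 1) * (n + 1)" by simp
  with False show ?thesis by (simp add: algebra_simps)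
qed

lemma summable_exp_abs:
  fixes x :: real
  assumes "x > 0" shows "(\<lambda>n::int. exp (- x * of_int \<bar>n\<bar>)) summable_on UNIV"
  using summable_on_int_power_exp[OF assms, of 0] by simp

lemma summable_theta3:
  fixes x :: real
  assumes "x > 0" shows "(\<lambda>n::int. exp (- x * of_int (n\<^sup>2))) summable_on UNIV"
proof (rule summable_on_real_bound[OF summable_exp_abs[OF assms]])
  show "\<bar>exp (- x * of_int (n\<^sup>2))\<bar> \<le> exp (- x * of_int \<bar>n\<bar>)" for n
    using assms int_abs_le_sq[of n] by (simp del: of_int_power of_int_abs)
qed

lemma summable_theta4:
  fixes x :: real
  assumes "x > 0" shows "(\<lambda>n. altsgn n * exp (- x * of_int (n\<^sup>2))) summable_on UNIV"
  by (rule summable_on_real_bound[OF summable_theta3[OF assms]]) (simp add: abs_mult)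

lemma exp_pronic_le:
  fixes x :: real
  assumes "x > 0"
  shows "exp (- x * of_int (n * (n + 1))) \<le> exp x * exp (- x * of_int \<bar>n\<bar>)"
proof -
  have "x * of_int (\<bar>n\<bar> - 1) \<le> x * of_int (n * (n + 1))"
    using assms int_abs_le_pronic[of n] by (intro mult_left_mono) (auto simp del: of_int_mult of_int_add of_int_diff)
  thus ?thesis by (simp add: algebra_simps flip: exp_add)
qed

lemma summable_theta2r:
  fixes x :: real
  assumes "x > 0" shows "(\<lambda>n::int. exp (- x * of_int (n * (n + 1)))) summable_on UNIV"
proof (rule summable_on_real_bound)
  show "(\<lambda>n::int. exp x * exp (- x * of_int \<bar>n\<bar>)) summable_on UNIV"
    by (intro summable_on_cmult_right summable_exp_abs assms)
qed (use exp_pronic_le[OF assms] in auto)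

lemma has_sum_Times_real:
  fixes f :: "'a \<Rightarrow> real" and g :: "'b \<Rightarrow> real"
  assumes "f summable_on A" "g summable_on B"
  shows "((\<lambda>(a, b). f a * g b) has_sum (infsum f A * infsum g B)) (A \<times> B)"
  using assms by (intro has_sum_Times) (metis summable_on_iff_abs_summable_on_real)+

text \<open>Rotation by 45 degrees: (u + v)^2 + (u - v)^2 = 2 u^2 + 2 v^2 turns quadratic forms at x
  into forms at 2x.\<close>

lemma bij_betw_int_even_pairs:
  "bij_betw (\<lambda>(u, v). (u + v, u - v)) UNIV {p :: int \<times> int. even (fst p + snd p)}"
proof (rule bij_betw_byWitness[where f' = "\<lambda>(m, n). ((m + n) div 2, (m - n) div 2)"])
  have "(a + b) div 2 + (a - b) div 2 = a \<and> (a + b) div 2 - (a - b) div 2 = b" if "even (a + b)" for a b :: int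
    using that by presburger
  thus "\<forall>p\<in>{p :: int \<times> int. even (fst p + snd p)}.
      (case case p of (m, n) \<Rightarrow> ((m + n) div 2, (m - n) div 2) of (u, v) \<Rightarrow> (u + v, u - v)) = p"
    by (simp add: case_prod_unfold prod_eq_iff)
qed auto

text \<open>The odd counterpart: (u + v + 1)^2 + (u - v)^2 = 2 u (u + 1) + 2 v (v + 1) + 1, so that
  \<open>theta2r (2 * x)\<close> and a factor exp(-x) appear.\<close>

lemma bij_betw_int_odd_pairs:
  "bij_betw (\<lambda>(u, v). (u + v + 1, u - v)) UNIV {p :: int \<times> int. odd (fst p + snd p)}"
proof (rule bij_betw_byWitness[where f' = "\<lambda>(m, n). ((m + n) div 2, (m - n) div 2)"])
  have "(a + b) div 2 + (a - b) div 2 + 1 = a \<and> (a + b) div 2 - (a - b) div 2 = b" if "odd (a + b)" for a b :: int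
    using that by presburger
  thus "\<forall>p\<in>{p :: int \<times> int. odd (fst p + snd p)}.
      (case case p of (m, n) \<Rightarrow> ((m + n) div 2, (m - n) div 2) of (u, v) \<Rightarrow> (u + v + 1, u - v)) = p"
    by (simp add: case_prod_unfold prod_eq_iff)
qed auto

text \<open>\<open>theta3\<close> squared sums over all pairs, \<open>theta4\<close> squared weights
  them by the parity of m + n. Half the sum and half the difference keep the pairs of even and of
  odd coordinate sum, which the two bijections above parametrise.\<close>

lemma
  assumes x: "x > 0"
  shows theta_sum_sq: "(theta3 x)\<^sup>2 + (theta4 x)\<^sup>2 = 2 * (theta3 (2 * x))\<^sup>2"
    and theta_diff_sq: "(theta3 x)\<^sup>2 - (theta4 x)\<^sup>2 = 2 * (exp (- x) * (theta2r (2 * x))\<^sup>2)"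
proof -
  define e where "e = (\<lambda>(m, n). exp (- x * of_int (m\<^sup>2 + n\<^sup>2)))"
  have 3: "(e has_sum (theta3 x)\<^sup>2) UNIV"
    using has_sum_Times_real[OF summable_theta3 summable_theta3] x
    by (simp add: e_def theta3_def power2_eq_square algebra_simps case_prod_unfold flip: exp_add)
  have 4: "((\<lambda>p. altsgn (fst p + snd p) * e p) has_sum (theta4 x)\<^sup>2) UNIV"
  proof -
    have "altsgn (fst p + snd p) * e p = (case p of (m, n) \<Rightarrow>
        altsgn m * exp (- x * of_int (m\<^sup>2)) * (altsgn n * exp (- x * of_int (n\<^sup>2))))" for p
      by (simp add: e_def case_prod_unfold altsgn_add exp_add [symmetric] distrib_left)
    thus ?thesis
      using has_sum_Times_real[OF summable_theta4[OF x] summable_theta4[OF x]]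
      by (simp only: theta4_def power2_eq_square UNIV_Times_UNIV)
  qed
  have "((\<lambda>p. (e p + altsgn (fst p + snd p) * e p) / 2) has_sum ((theta3 x)\<^sup>2 + (theta4 x)\<^sup>2) / 2) UNIV"
    by (intro has_sum_divide_const has_sum_add 3 4)
  also have "?this \<longleftrightarrow> (e has_sum ((theta3 x)\<^sup>2 + (theta4 x)\<^sup>2) / 2) {p. even (fst p + snd p)}"
    by (rule has_sum_cong_neutral) (auto simp: altsgn_def)
  also have "\<dots> \<longleftrightarrow> ((\<lambda>(u, v). exp (- (2 * x) * of_int (u\<^sup>2)) * exp (- (2 * x) * of_int (v\<^sup>2)))
      has_sum ((theta3 x)\<^sup>2 + (theta4 x)\<^sup>2) / 2) UNIV"
    by (subst has_sum_reindex_bij_betw[OF bij_betw_int_even_pairs, symmetric], intro has_sum_cong)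
       (auto simp: e_def power2_eq_square algebra_simps simp flip: exp_add)
  finally have "((\<lambda>(u, v). exp (- (2 * x) * of_int (u\<^sup>2)) * exp (- (2 * x) * of_int (v\<^sup>2)))
      has_sum ((theta3 x)\<^sup>2 + (theta4 x)\<^sup>2) / 2) UNIV" .
  moreover have "((\<lambda>(u, v). exp (- (2 * x) * of_int (u\<^sup>2)) * exp (- (2 * x) * of_int (v\<^sup>2)))
      has_sum (theta3 (2 * x) * theta3 (2 * x))) UNIV"
    using has_sum_Times_real[OF summable_theta3 summable_theta3, of "2 * x" "2 * x"] x
    by (simp add: theta3_def)
  ultimately have "((theta3 x)\<^sup>2 + (theta4 x)\<^sup>2) / 2 = theta3 (2 * x) * theta3 (2 * x)"
    by (rule has_sum_unique)
  thus "(theta3 x)\<^sup>2 + (theta4 x)\<^sup>2 = 2 * (theta3 (2 * x))\<^sup>2"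
    by (simp add: power2_eq_square)
  have "((\<lambda>p. (e p + - (altsgn (fst p + snd p) * e p)) / 2) has_sum ((theta3 x)\<^sup>2 + - (theta4 x)\<^sup>2) / 2) UNIV"
    by (intro has_sum_divide_const has_sum_add has_sum_uminusI 3 4)
  also have "?this \<longleftrightarrow> (e has_sum ((theta3 x)\<^sup>2 + - (theta4 x)\<^sup>2) / 2) {p. odd (fst p + snd p)}"
    by (rule has_sum_cong_neutral) (auto simp: altsgn_def)
  also have "\<dots> \<longleftrightarrow> ((\<lambda>p. exp (- x) * (case p of (u, v) \<Rightarrow> exp (- (2 * x) * of_int (u * (u + 1))) *
       exp (- (2 * x) * of_int (v * (v + 1)))))
      has_sum ((theta3 x)\<^sup>2 + - (theta4 x)\<^sup>2) / 2) UNIV"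
    by (subst has_sum_reindex_bij_betw[OF bij_betw_int_odd_pairs, symmetric], intro has_sum_cong)
       (auto simp: e_def power2_eq_square algebra_simps simp flip: exp_add)
  finally have "((\<lambda>p. exp (- x) * (case p of (u, v) \<Rightarrow> exp (- (2 * x) * of_int (u * (u + 1))) *
       exp (- (2 * x) * of_int (v * (v + 1)))))
      has_sum ((theta3 x)\<^sup>2 + - (theta4 x)\<^sup>2) / 2) UNIV" .
  moreover have "((\<lambda>p. exp (- x) * (case p of (u, v) \<Rightarrow> exp (- (2 * x) * of_int (u * (u + 1))) *
       exp (- (2 * x) * of_int (v * (v + 1)))))
      has_sum (exp (- x) * (theta2r (2 * x) * theta2r (2 * x)))) UNIV"
    using has_sum_Times_real[OF summable_theta2r summable_theta2r, of "2 * x" "2 * x"] x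
    by (intro has_sum_cmult_right) (simp add: theta2r_def)
  ultimately have "((theta3 x)\<^sup>2 + - (theta4 x)\<^sup>2) / 2 = exp (- x) * (theta2r (2 * x) * theta2r (2 * x))"
    by (rule has_sum_unique)
  thus "(theta3 x)\<^sup>2 - (theta4 x)\<^sup>2 = 2 * (exp (- x) * (theta2r (2 * x))\<^sup>2)"
    by (simp add: power2_eq_square)
qed

text \<open>On pairs of even sum the exponent becomes 2 u (u + 1) + 2 v^2. The reflection n to -1 -
  n fixes n (n + 1) and exchanges the parities, so the odd pairs contribute the same amount.\<close>

lemma theta2r_sq:
  assumes x: "x > 0"
  shows "(theta2r x)\<^sup>2 = 2 * theta2r (2 * x) * theta3 (2 * x)"
proof -
  define e where "e = (\<lambda>(m, n). exp (- x * of_int (m * (m + 1) + n * (n + 1))))"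
  let ?s = "theta2r (2 * x) * theta3 (2 * x)"
  have all: "(e has_sum (theta2r x)\<^sup>2) UNIV"
    using has_sum_Times_real[OF summable_theta2r summable_theta2r] x
    by (simp add: e_def theta2r_def power2_eq_square algebra_simps case_prod_unfold flip: exp_add)
  have "((\<lambda>(u, v). exp (- (2 * x) * of_int (u * (u + 1))) * exp (- (2 * x) * of_int (v\<^sup>2)))
      has_sum ?s) UNIV"
    using has_sum_Times_real[OF summable_theta2r summable_theta3, of "2 * x" "2 * x"] x
    by (simp add: theta2r_def theta3_def)
  also have "?this \<longleftrightarrow> (e has_sum ?s) {p. even (fst p + snd p)}"
    by (subst has_sum_reindex_bij_betw[OF bij_betw_int_even_pairs, symmetric], intro has_sum_cong)
       (auto simp: e_def power2_eq_square algebra_simps simp flip: exp_add)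
  finally have ev: "(e has_sum ?s) {p. even (fst p + snd p)}" .
  also have "?this \<longleftrightarrow> (e has_sum ?s) {p. odd (fst p + snd p)}"
    by (rule has_sum_reindex_bij_witness[where j = "\<lambda>(m, n). (m, - 1 - n)"
          and i = "\<lambda>(m, n). (m, - 1 - n)"])
       (auto simp: e_def algebra_simps)
  finally have "(e has_sum (?s + ?s)) ({p. even (fst p + snd p)} \<union> {p. odd (fst p + snd p)})"
    by (intro has_sum_Un_disjoint ev) auto
  also have "{p. even (fst p + snd p)} \<union> {p. odd (fst p + snd p)} = (UNIV :: (int \<times> int) set)"
    by auto
  finally show ?thesis
    using has_sum_unique[OF all] by (simp add: mult_ac)
qed

text \<open>Jacobi's identity theta3^4 = theta2^4 + theta4^4: the product of the two quadratic
  relations is a perfect square up to exp(-x), and \<open>theta2r_sq\<close> extracts its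
  root.\<close>

lemma theta_quartic:
  assumes x: "x > 0"
  shows "(theta3 x)^4 - (theta4 x)^4 = exp (- x) * (theta2r x)^4"
proof -
  have "(theta3 x)^4 - (theta4 x)^4 = ((theta3 x)\<^sup>2 + (theta4 x)\<^sup>2) * ((theta3 x)\<^sup>2 - (theta4 x)\<^sup>2)"
    by (simp add: power4_eq_xxxx power2_eq_square algebra_simps)
  also have "\<dots> = exp (- x) * (2 * theta2r (2 * x) * theta3 (2 * x))\<^sup>2"
    unfolding theta_sum_sq[OF x] theta_diff_sq[OF x] by (simp add: power_mult_distrib)
  also have "\<dots> = exp (- x) * (theta2r x)^4"
    unfolding theta2r_sq[OF x, symmetric] by simp
  finally show ?thesis .
qed

section \<open>Behaviour as x tends to infinity, and identification of the sech sums\<close>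

lemma infsum_int_single: "infsum (\<lambda>n::int. if n = 0 then (c::real) else 0) UNIV = c"
  by (subst infsum_cong_neutral[where T = "{0}" and g = "\<lambda>_. c"]) auto

lemma infsum_pos:
  fixes f :: "'a \<Rightarrow> real"
  assumes "f summable_on A" "\<And>n. n \<in> A \<Longrightarrow> f n \<ge> 0" "k \<in> A" "f k > 0"
  shows "infsum f A > 0"
proof -
  have "f k \<le> infsum f A"
    using finite_sum_le_infsum[OF assms(1), of "{k}"] assms(2,3) by auto
  with assms(4) show ?thesis by simp
qed

lemma tendsto_exp_neg_mult:
  fixes c :: real assumes "c > 0"
  shows "((\<lambda>x. exp (- x * c)) \<longlongrightarrow> 0) at_top"
  using assms by real_asymp

lemma theta3_tendsto: "(theta3 \<longlongrightarrow> 1) at_top"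
proof -
  have "((\<lambda>x::real. infsum (\<lambda>n::int. exp (- x * of_int (n\<^sup>2))) UNIV) \<longlongrightarrow>
      infsum (\<lambda>n::int. if n = 0 then 1 else 0) UNIV) at_top"
  proof (rule tendsto_infsum_dominated)
    show "((\<lambda>x::real. exp (- x * of_int (n\<^sup>2))) \<longlongrightarrow> (if n = 0 then 1 else 0 :: real)) at_top" for n :: int
      using tendsto_exp_neg_mult[of "of_int (n\<^sup>2)"] by auto
    show "\<bar>exp (- x * of_int (n\<^sup>2))\<bar> \<le> exp (- 1 * of_int (n\<^sup>2))"
      if "x \<in> {1..}" for n :: int and x :: real
      using that mult_right_mono[of 1 x "(of_int n)\<^sup>2"] by simp
  qed (use summable_theta3[of 1] eventually_ge_at_top[of "1::real"] in auto)
  thus ?thesis unfolding theta3_def infsum_int_single .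
qed

lemma theta2r_tendsto: "(theta2r \<longlongrightarrow> 2) at_top"
proof -
  have "((\<lambda>x::real. infsum (\<lambda>n::int. exp (- x * of_int (n * (n + 1)))) UNIV) \<longlongrightarrow>
      infsum (\<lambda>n::int. if n \<in> {0, -1} then 1 else 0) UNIV) at_top"
  proof (rule tendsto_infsum_dominated)
    show "((\<lambda>x::real. exp (- x * of_int (n * (n + 1)))) \<longlongrightarrow> (if n \<in> {0, -1} then 1 else 0 :: real)) at_top"
      for n :: int
    proof (cases "n \<in> {0, -1}")
      case False
      hence "n * (n + 1) > 0" by (auto simp: zero_less_mult_iff)
      hence "((\<lambda>x. exp (- x * of_int (n * (n + 1)))) \<longlongrightarrow> (0::real)) at_top"
        by (intro tendsto_exp_neg_mult) (simp only: of_int_0_less_iff)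
      with False show ?thesis by simp
    qed auto
    show "\<bar>exp (- x * of_int (n * (n + 1)))\<bar> \<le> exp (- 1 * of_int (n * (n + 1)))"
      if "x \<in> {1..}" for n :: int and x :: real
    proof -
      have "n * (n + 1) \<ge> 0" by (cases "n \<ge> 0") (auto simp: zero_le_mult_iff)
      hence "1 * of_int (n * (n + 1)) \<le> x * of_int (n * (n + 1))"
        using that by (intro mult_right_mono) (auto simp only: atLeast_iff of_int_0_le_iff)
      thus ?thesis by simp
    qed
  qed (use summable_theta2r[of 1] eventually_ge_at_top[of "1::real"] in auto)
  also have "infsum (\<lambda>n::int. if n \<in> {0, -1} then 1 else 0) UNIV = (2::real)"
    by (subst infsum_cong_neutral[where T = "{0, -1}" and g = "\<lambda>_. 1"]) auto
  finally show ?thesis unfolding theta2r_def .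
qed

lemma sech_sum_tendsto: "((\<lambda>x. infsum (sech x) UNIV) \<longlongrightarrow> 1) at_top"
proof -
  have le: "sech x n \<le> 2 * exp (- x * of_int \<bar>n\<bar>)" if "x \<ge> 1" for x n
    using that by (intro sech_le_exp) auto
  have "((\<lambda>x. infsum (\<lambda>n. sech x n) UNIV) \<longlongrightarrow>
      infsum (\<lambda>n::int. if n = 0 then 1 else 0) UNIV) at_top"
  proof (rule tendsto_infsum_dominated)
    show "((\<lambda>x. sech x n) \<longlongrightarrow> (if n = 0 then 1 else 0)) at_top" for n
    proof (cases "n = 0")
      case False
      have "((\<lambda>x. sech x n) \<longlongrightarrow> 0) at_top"
      proof (rule tendsto_sandwich[where f = "\<lambda>_. 0"])
        show "((\<lambda>x. 2 * exp (- x * of_int \<bar>n\<bar>)) \<longlongrightarrow> (0::real)) at_top"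
          using tendsto_mult_right_zero[OF tendsto_exp_neg_mult[of "of_int \<bar>n\<bar>"]] False by simp
        show "eventually (\<lambda>x. sech x n \<le> 2 * exp (- x * of_int \<bar>n\<bar>)) at_top"
          using eventually_ge_at_top[of 1] by eventually_elim (rule le)
      qed (auto simp: sech_pos less_imp_le)
      with False show ?thesis by simp
    qed (simp add: sech_def)
    show "\<bar>sech x n\<bar> \<le> 2 * exp (- 1 * of_int \<bar>n\<bar>)" if "x \<in> {1..}" for n and x
    proof -
      have "1 * of_int \<bar>n\<bar> \<le> x * of_int \<bar>n\<bar>" using that by (intro mult_right_mono) auto
      hence "exp (- x * of_int \<bar>n\<bar>) \<le> exp (- 1 * of_int \<bar>n\<bar>)" by simp
      moreover have "sech x n \<le> 2 * exp (- x * of_int \<bar>n\<bar>)" using that by (intro le) simp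
      ultimately show ?thesis using sech_pos[of x n] by linarith
    qed
    show "(\<lambda>n::int. 2 * exp (- 1 * of_int \<bar>n\<bar>) :: real) summable_on UNIV"
      by (intro summable_on_cmult_right summable_exp_abs) auto
  qed (use eventually_ge_at_top[of "1::real"] in auto)
  thus ?thesis unfolding infsum_int_single .
qed

lemma sech_2_less: "x > 0 \<Longrightarrow> n \<noteq> 0 \<Longrightarrow> sech (2 * x) n < sech x n"
proof -
  assume *: "x > 0" "n \<noteq> 0"
  have "cosh \<bar>x * of_int n\<bar> < cosh \<bar>2 * x * of_int n\<bar>"
    using * by (subst cosh_real_nonneg_less_iff) (auto simp: abs_mult)
  thus ?thesis
    by (simp add: sech_def frac_less2 cosh_real_abs)
qed

lemma sech_2_le: "x > 0 \<Longrightarrow> sech (2 * x) n \<le> sech x n"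
  using sech_2_less[of x n] by (cases "n = 0") (auto simp: sech_def less_imp_le)

lemma sech_sum_diff:
  assumes "x > 0"
  shows "infsum (sech x) UNIV - infsum (sech (2 * x)) UNIV = infsum (\<lambda>n. sech x n - sech (2 * x) n) UNIV"
    and "(\<lambda>n. sech x n - sech (2 * x) n) summable_on UNIV"
proof -
  have "((\<lambda>n. sech x n + - sech (2 * x) n) has_sum (infsum (sech x) UNIV + - infsum (sech (2 * x)) UNIV)) UNIV"
    using assms by (intro has_sum_add has_sum_uminusI has_sum_infsum summable_sech) auto
  thus "infsum (sech x) UNIV - infsum (sech (2 * x)) UNIV = infsum (\<lambda>n. sech x n - sech (2 * x) n) UNIV"
    and "(\<lambda>n. sech x n - sech (2 * x) n) summable_on UNIV"
    by (auto simp: has_sum_iff)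
qed

text \<open>The indices 1 and -1 contribute 2 exp(-x) each to leading order. The term at 0 cancels,
  and the remaining ones are of smaller order.\<close>

lemma sech_sum_diff_tendsto:
  "((\<lambda>x. exp x * (infsum (sech x) UNIV - infsum (sech (2 * x)) UNIV)) \<longlongrightarrow> 4) at_top"
proof -
  let ?L = "\<lambda>n::int. if n \<in> {1, -1} then 2 else 0 :: real"
  let ?f = "\<lambda>n x. exp x * (sech x n - sech (2 * x) n)"
  have le: "\<bar>?f n x\<bar> \<le> 2 * exp (- x * (of_int \<bar>n\<bar> - 1))" if "x \<ge> 1" for x n
  proof -
    have "\<bar>?f n x\<bar> \<le> exp x * sech x n"
      using sech_2_le[of x n] that by (auto simp: sech_pos less_imp_le)
    also have "\<dots> \<le> exp x * (2 * exp (- x * of_int \<bar>n\<bar>))"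
      using that by (intro mult_left_mono sech_le_exp) auto
    finally show ?thesis by (simp add: algebra_simps exp_diff exp_minus divide_inverse)
  qed
  have "((\<lambda>x. infsum (\<lambda>n. ?f n x) UNIV) \<longlongrightarrow> infsum ?L UNIV) at_top"
  proof (rule tendsto_infsum_dominated)
    show "(?f n \<longlongrightarrow> ?L n) at_top" for n
    proof -
      consider "n = 0" | "n \<in> {1, -1}" | "\<bar>n\<bar> \<ge> 2" by force
      thus ?thesis
      proof cases
        case 2
        have "((\<lambda>x::real. exp x * (1 / cosh x - 1 / cosh (2 * x))) \<longlongrightarrow> 2) at_top"
          unfolding cosh_field_def by real_asymp
        with 2 show ?thesis by (auto simp: sech_def)
      next
        case 3
        have "(?f n \<longlongrightarrow> 0) at_top"
        proof (rule tendsto_rabs_zero_cancel, rule tendsto_sandwich[where f = "\<lambda>_. 0"])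
          show "((\<lambda>x. 2 * exp (- x * (of_int \<bar>n\<bar> - 1))) \<longlongrightarrow> (0::real)) at_top"
            using tendsto_mult_right_zero[OF tendsto_exp_neg_mult[of "of_int \<bar>n\<bar> - 1"]] 3 by simp
          show "eventually (\<lambda>x. \<bar>?f n x\<bar> \<le> 2 * exp (- x * (of_int \<bar>n\<bar> - 1))) at_top"
            using eventually_ge_at_top[of 1] by eventually_elim (rule le)
        qed auto
        with 3 show ?thesis by auto
      qed (simp add: sech_def)
    qed
    show "\<bar>?f n x\<bar> \<le> 2 * exp 1 * exp (- 1 * of_int \<bar>n\<bar>)" if "x \<in> {1..}" for n and x
    proof (cases "n = 0")
      case False
      hence "1 * (of_int \<bar>n\<bar> - 1) \<le> x * (of_int \<bar>n\<bar> - 1)"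
        using that by (intro mult_right_mono) auto
      hence "exp (- x * (of_int \<bar>n\<bar> - 1)) \<le> exp (1 + - 1 * of_int \<bar>n\<bar>)" by simp
      thus ?thesis using le[of x n] that unfolding exp_add by simp
    qed (simp add: sech_def)
    show "(\<lambda>n::int. 2 * exp 1 * exp (- 1 * of_int \<bar>n\<bar>) :: real) summable_on UNIV"
      by (intro summable_on_cmult_right summable_exp_abs) auto
  qed (use eventually_ge_at_top[of "1::real"] in auto)
  also have "infsum ?L UNIV = 4"
    by (subst infsum_cong_neutral[where T = "{1, -1}" and g = "\<lambda>_. 2"]) auto
  finally show ?thesis
  proof (rule Lim_transform_eventually)
    show "\<forall>\<^sub>F x in at_top. infsum (\<lambda>n. ?f n x) UNIV = exp x * (infsum (sech x) UNIV - infsum (sech (2 * x)) UNIV)"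
      using eventually_gt_at_top[of 0]
      by eventually_elim (simp add: sech_sum_diff infsum_cmult_right)
  qed
qed

lemma theta3_sq_diff: "x > 0 \<Longrightarrow> (theta3 x)\<^sup>2 - (theta3 (2 * x))\<^sup>2 = exp (- x) * (theta2r (2 * x))\<^sup>2"
  using theta_sum_sq[of x] theta_diff_sq[of x] by simp

lemma theta3_pos: "x > 0 \<Longrightarrow> theta3 x > 0"
  unfolding theta3_def by (rule infsum_pos[OF summable_theta3, where k = 0]) auto

lemma theta2r_pos: "x > 0 \<Longrightarrow> theta2r x > 0"
  unfolding theta2r_def by (rule infsum_pos[OF summable_theta2r, where k = 0]) auto

text \<open>The Lambert series form of Jacobi's two-square theorem. Both functions satisfy the
  hypotheses of \<open>agm_le\<close>, which is applied in both directions.\<close>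

lemma sech_sum_eq_theta3_sq:
  assumes "x > 0"
  shows "infsum (sech x) UNIV = (theta3 x)\<^sup>2"
proof -
  define P A where "P y = infsum (sech y) UNIV" and "A y = (theta3 y)\<^sup>2" for y
  have P_pos: "P y > 0" if "y > 0" for y
    unfolding P_def by (rule infsum_pos[OF summable_sech[OF that], where k = 0]) (auto simp: sech_pos less_imp_le)
  have A_pos: "A y > 0" if "y > 0" for y using theta3_pos[OF that] by (simp add: A_def)
  have wP_pos: "P y - P (2 * y) > 0" if "y > 0" for y
    unfolding P_def sech_sum_diff(1)[OF that]
    by (rule infsum_pos[OF sech_sum_diff(2)[OF that], where k = 1])
       (use that sech_2_le[OF that] sech_2_less[OF that] in auto)
  have wA: "A y - A (2 * y) = exp (- y) * (theta2r (2 * y))\<^sup>2" if "y > 0" for y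
    using theta3_sq_diff[OF that] by (simp add: A_def)
  have wA_pos: "A y - A (2 * y) > 0" if "y > 0" for y
    using theta2r_pos[of "2 * y"] that by (simp add: wA)
  have agmP: "(P y - P (2 * y))\<^sup>2 = 4 * (P (2 * y) - P (4 * y)) * P (4 * y)" if "y > 0" for y
    using sech_agm[OF that] by (simp add: P_def)
  have agmA: "(A y - A (2 * y))\<^sup>2 = 4 * (A (2 * y) - A (4 * y)) * A (4 * y)" if "y > 0" for y
  proof -
    have "A (2 * y) - A (4 * y) = exp (- (2 * y)) * (theta2r (4 * y))\<^sup>2"
      using wA[of "2 * y"] that by simp
    moreover have "(theta2r (2 * y))\<^sup>2 = 2 * theta2r (4 * y) * theta3 (4 * y)"
      using theta2r_sq[of "2 * y"] that by simp
    moreover have "(exp (- y))\<^sup>2 = exp (- (2 * y))" by (simp flip: exp_of_nat_mult)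
    ultimately show ?thesis
      using that by (simp only: wA) (simp add: A_def power_mult_distrib)
  qed
  have limP: "(P \<longlongrightarrow> 1) at_top" unfolding P_def by (rule sech_sum_tendsto)
  have limA: "(A \<longlongrightarrow> 1) at_top"
    using tendsto_power[OF theta3_tendsto, of 2] unfolding A_def by simp
  \<comment> \<open>The theta difference is exp(-y) times the square of
    \<open>theta2r (2 * y)\<close>, which tends to 2^2; the leading constants 4 agree and the
    quotient tends to 1.\<close>
  have *: "((\<lambda>y. exp y * (P y - P (2 * y)) / (theta2r (2 * y))\<^sup>2) \<longlongrightarrow> 4 / 2\<^sup>2) at_top"
    unfolding P_def
    by (intro tendsto_divide sech_sum_diff_tendsto tendsto_power filterlim_compose[OF theta2r_tendsto])
       (real_asymp, simp)
  have ratio: "((\<lambda>y. (P y - P (2 * y)) / (A y - A (2 * y))) \<longlongrightarrow> 1) at_top"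
    by (rule Lim_transform_eventually[OF *[simplified]])
       (use eventually_gt_at_top[of 0] in \<open>eventually_elim, simp only: wA exp_minus, simp add: divide_inverse mult_ac\<close>)
  from tendsto_inverse[OF this] have ratio': "((\<lambda>y. (A y - A (2 * y)) / (P y - P (2 * y))) \<longlongrightarrow> 1) at_top"
    by simp
  have "P x \<le> A x"
    by (rule agm_le) (fact P_pos A_pos wP_pos wA_pos agmP agmA limP limA ratio assms)+
  moreover have "A x \<le> P x"
    by (rule agm_le) (fact P_pos A_pos wP_pos wA_pos agmP agmA limP limA ratio' assms)+
  ultimately show ?thesis by (simp add: P_def A_def)
qed

text \<open>The alternating sum is M(x) = 2 P(2x) - P(x), and \<open>theta_sum_sq\<close> is the
  same relation for the theta squares.\<close>

lemma altsgn_sech_sum_eq_theta4_sq: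
  assumes x: "x > 0"
  shows "infsum (\<lambda>n. altsgn n * sech x n) UNIV = (theta4 x)\<^sup>2"
  using infsum_even_int[OF summable_sech[OF x]] theta_sum_sq[OF x] x
  unfolding infsum_even_sech by (simp add: sech_sum_eq_theta3_sq)

text \<open>The right side is 4 f(q) at q = exp(-x), because theta2^4 = q \<open>theta2r\<close>^4.
  Jacobi's identity replaces theta3^4 - theta4^4 in the second moment.\<close>

lemma theta_product_lambert:
  assumes x: "x > 0"
  shows "((\<lambda>n. - (altsgn n * (of_int n)\<^sup>2 * sech x n)) has_sum
           (exp (- x) * (theta2r x)^4 * (theta4 x)\<^sup>2 / 4)) UNIV"
proof -
  have "- (- (theta4 x)\<^sup>2 * (((theta3 x)\<^sup>2)\<^sup>2 - ((theta4 x)\<^sup>2)\<^sup>2) / 4) = exp (- x) * (theta2r x)^4 * (theta4 x)\<^sup>2 / 4"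
    using theta_quartic[OF x] by simp
  thus ?thesis
    using has_sum_uminusI[OF altsgn_sech_second_moment[OF x]]
    unfolding sech_sum_eq_theta3_sq[OF x] altsgn_sech_sum_eq_theta4_sq[OF x] by metis
qed

section \<open>The coefficients of the modular form\<close>

lemma altsgn_conv_power: "altsgn m = (-1) ^ nat \<bar>m\<bar>"
  by (cases "even m") (auto simp: altsgn_def even_nat_iff)

definition theta_exponent :: "int \<times> int \<times> int \<times> int \<times> int \<times> int \<Rightarrow> int" where
  "theta_exponent = (\<lambda>(n1, n2, n3, n4, m1, m2). 1 + n1 * (n1 + 1) + n2 * (n2 + 1) + n3 * (n3 + 1)
     + n4 * (n4 + 1) + m1\<^sup>2 + m2\<^sup>2)"

definition theta_sign :: "int \<times> int \<times> int \<times> int \<times> int \<times> int \<Rightarrow> real" where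
  "theta_sign = (\<lambda>(n1, n2, n3, n4, m1, m2). altsgn (m1 + m2))"

lemma pronic_nonneg: "n * (n + 1) \<ge> (0::int)"
  by (cases "n \<ge> 0") (auto simp: zero_le_mult_iff)

lemma theta_exponent_pos: "theta_exponent t > 0"
proof -
  obtain n1 n2 n3 n4 m1 m2 where t: "t = (n1, n2, n3, n4, m1, m2)"
    by (metis prod_cases3)
  have "m1\<^sup>2 \<ge> 0" "m2\<^sup>2 \<ge> 0" by simp_all
  with pronic_nonneg[of n1] pronic_nonneg[of n2] pronic_nonneg[of n3] pronic_nonneg[of n4]
  show ?thesis unfolding theta_exponent_def t prod.case by linarith
qed

lemma fcoeff_eq: "fcoeff N = (\<Sum>t | nat (theta_exponent t) = N. theta_sign t) / 16"
proof -
  \<comment> \<open>All exponents are positive, so \<open>nat\<close> folds no lattice point into N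
    = 0.\<close>
  have "{t. nat (theta_exponent t) = N} = {t. theta_exponent t = int N}"
    using theta_exponent_pos by (metis int_nat_eq less_imp_le nat_int)
  thus ?thesis
    by (simp add: fcoeff_def theta_exponent_def theta_sign_def altsgn_conv_power case_prod_unfold)
qed

lemma has_sum_theta_product:
  assumes x: "x > 0"
  shows "((\<lambda>t. theta_sign t * exp (- x) ^ nat (theta_exponent t)) has_sum
      (exp (- x) * (theta2r x)^4 * (theta4 x)\<^sup>2)) UNIV"
proof -
  define f where "f n = exp (- x * of_int (n * (n + 1)))" for n :: int
  define g where "g n = altsgn n * exp (- x * of_int (n\<^sup>2))" for n :: int
  have f: "f summable_on UNIV" "infsum f UNIV = theta2r x"
    using summable_theta2r[OF x] by (simp_all add: f_def [abs_def] theta2r_def)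
  have g: "g summable_on UNIV" "infsum g UNIV = theta4 x"
    using summable_theta4[OF x] by (simp_all add: g_def [abs_def] theta4_def)
  have step: "((\<lambda>(a, b). u a * v b) has_sum (U * V)) UNIV"
    if "(u has_sum U) UNIV" "(v has_sum V) UNIV"
    for u :: "int \<Rightarrow> real" and v :: "'b \<Rightarrow> real" and U V
    using has_sum_Times_real[of u UNIV v UNIV] that by (simp add: has_sum_iff)
  have F: "(f has_sum theta2r x) UNIV" and G: "(g has_sum theta4 x) UNIV"
    using f g by (auto simp: has_sum_iff)
  let ?h = "\<lambda>(n1, n2, n3, n4, m1, m2). f n1 * (f n2 * (f n3 * (f n4 * (g m1 * g m2))))"
  have "(?h has_sum (theta2r x * (theta2r x * (theta2r x * (theta2r x * (theta4 x * theta4 x)))))) UNIV"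
    using step[OF F step[OF F step[OF F step[OF F step[OF G G]]]]] by (simp add: case_prod_unfold)
  hence "((\<lambda>t. exp (- x) * ?h t) has_sum
     (exp (- x) * (theta2r x * (theta2r x * (theta2r x * (theta2r x * (theta4 x * theta4 x))))))) UNIV"
    by (rule has_sum_cmult_right)
  moreover have "exp (- x) * ?h t = theta_sign t * exp (- x) ^ nat (theta_exponent t)" for t
  proof -
    have "exp (- x) ^ nat (theta_exponent t) = exp (- x * of_int (theta_exponent t))"
      using theta_exponent_pos[of t] by (simp flip: exp_of_nat2_mult)
    thus ?thesis
      by (simp add: case_prod_unfold theta_exponent_def theta_sign_def f_def g_def altsgn_add
            exp_add [symmetric] algebra_simps)
  qed
  ultimately show ?thesis
    by (simp add: power2_eq_square power4_eq_xxxx mult_ac)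
qed

text \<open>Used with powers of exp(-x) as \<open>z\<close> for generating functions and with N powr
  (-s) for the Dirichlet series.\<close>

lemma sums_by_key:
  fixes c :: "'a \<Rightarrow> 'b :: {real_normed_field, banach}"
  assumes "((\<lambda>t. c t * z (key t)) has_sum S) UNIV" and fin: "\<And>N. finite {t. key t = N}"
  shows "(\<lambda>N::nat. (\<Sum>t | key t = N. c t) * z N) sums S"
proof -
  have "((\<lambda>N. infsum (\<lambda>t. c t * z (key t)) {t \<in> UNIV. key t = N}) has_sum S) UNIV"
    using has_sum_by_key[of "\<lambda>t. c t * z (key t)" UNIV key] assms(1) by (simp add: has_sum_iff)
  also have "(\<lambda>N. infsum (\<lambda>t. c t * z (key t)) {t \<in> UNIV. key t = N}) =
      (\<lambda>N. (\<Sum>t | key t = N. c t) * z N)"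
    using fin by (auto simp: sum_distrib_right intro!: sum.cong)
  finally show ?thesis by (rule has_sum_imp_sums)
qed

text \<open>Finiteness is read off from convergence at x = 1: an infinite fibre would make a nonzero
  constant family summable.\<close>

lemma finite_theta_exponent: "finite {t. nat (theta_exponent t) = N}"
proof (rule ccontr)
  assume inf: "infinite {t. nat (theta_exponent t) = N}"
  have "(\<lambda>t. theta_sign t * exp (- 1) ^ nat (theta_exponent t)) summable_on UNIV"
    using has_sum_theta_product[of 1] by (auto simp: summable_on_def)
  hence "(\<lambda>t. \<bar>theta_sign t * exp (- 1) ^ nat (theta_exponent t)\<bar>) summable_on UNIV"
    by (metis (no_types, lifting) real_norm_def summable_on_cong summable_on_iff_abs_summable_on_real)
  hence "(\<lambda>t. exp (- 1 :: real) ^ nat (theta_exponent t)) summable_on UNIV"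
    by (simp add: abs_mult theta_sign_def case_prod_unfold)
  hence "(\<lambda>t. exp (- 1 :: real) ^ nat (theta_exponent t)) summable_on {t. nat (theta_exponent t) = N}"
    by (rule summable_on_subset_banach) auto
  also have "?this \<longleftrightarrow> (\<lambda>t. exp (- 1 :: real) ^ N) summable_on {t. nat (theta_exponent t) = N}"
    by (rule summable_on_cong) auto
  finally show False using infsum_diverge_constant[OF inf, of "exp (- 1 :: real) ^ N"] by auto
qed

text \<open>The pair (i, k) encodes the factorisation N = d (2k + 1) with d = i + 1.\<close>

definition lambert_key :: "nat \<times> nat \<Rightarrow> nat" where
  "lambert_key = (\<lambda>(i, k). Suc i * (2 * k + 1))"

definition lambert_coeff :: "nat \<times> nat \<Rightarrow> real" where
  "lambert_coeff = (\<lambda>(i, k). (-1) ^ (i + k) * (real (Suc i))\<^sup>2)"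

lemma finite_lambert_key: "finite {t. lambert_key t = N}"
proof (rule finite_subset)
  show "{t. lambert_key t = N} \<subseteq> {..N} \<times> {..N}"
  proof
    fix t assume "t \<in> {t. lambert_key t = N}"
    then obtain i k where t: "t = (i, k)" and N: "N = Suc i * (2 * k + 1)"
      by (cases t) (auto simp: lambert_key_def)
    have "Suc i * 1 \<le> N" "1 * (2 * k + 1) \<le> N" unfolding N by (intro mult_le_mono; simp)+
    thus "t \<in> {..N} \<times> {..N}" by (simp add: t)
  qed
qed auto

text \<open>The geometric expansion of 2r / (1 + r^2) = sech y, where r = exp(-y) and y = x (i +
  1).\<close>

lemma sech_eq_alternating_sum:
  assumes "x > 0"
  shows "((\<lambda>k. 2 * (-1) ^ k * exp (- x) ^ (Suc i * (2 * k + 1))) has_sum sech x (int (Suc i))) UNIV"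
    and "(\<lambda>k. exp (- x) ^ (Suc i * (2 * k + 1))) summable_on UNIV"
proof -
  define r where "r = exp (- x) ^ Suc i"
  have r: "0 < r" "r < 1" using assms by (auto simp: r_def power_less_one_iff simp del: power_Suc)
  hence r2: "r\<^sup>2 < 1" by (simp add: power_less_one_iff)
  have geo: "(\<lambda>k. c ^ k) sums (1 / (1 - c)) \<and> summable (\<lambda>k. norm (c ^ k))" if "norm c < 1" for c :: real
    using that by (simp add: geometric_sums power_abs summable_geometric)
  have e: "exp (- x) ^ (Suc i * (2 * k + 1)) = r * (r\<^sup>2) ^ k" for k
    unfolding r_def power_mult [symmetric] power_add by (simp flip: power_add power_mult add: algebra_simps)
  have "((\<lambda>k. (- (r\<^sup>2)) ^ k) has_sum (1 / (1 - (- (r\<^sup>2))))) UNIV"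
    using geo[of "- (r\<^sup>2)"] r2 by (intro norm_summable_imp_has_sum) auto
  hence "((\<lambda>k. 2 * r * (- (r\<^sup>2)) ^ k) has_sum (2 * r * (1 / (1 - (- (r\<^sup>2)))))) UNIV"
    by (rule has_sum_cmult_right)
  also have "(\<lambda>k. 2 * r * (- (r\<^sup>2)) ^ k) = (\<lambda>k. 2 * (-1) ^ k * exp (- x) ^ (Suc i * (2 * k + 1)))"
    unfolding e by (simp add: power_minus[of "r\<^sup>2"] mult_ac)
  also have "2 * r * (1 / (1 - (- (r\<^sup>2)))) = sech x (int (Suc i))"
  proof -
    have "x * of_int (int (Suc i)) = - ln r"
      by (simp add: r_def ln_realpow del: power_Suc)
    hence "sech x (int (Suc i)) = 1 / ((inverse r + r) / 2)"
      using r by (simp add: sech_def cosh_field_def exp_minus)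
    thus ?thesis using r by (simp add: field_simps power2_eq_square)
  qed
  finally show "((\<lambda>k. 2 * (-1) ^ k * exp (- x) ^ (Suc i * (2 * k + 1))) has_sum sech x (int (Suc i))) UNIV" .
  show "(\<lambda>k. exp (- x) ^ (Suc i * (2 * k + 1))) summable_on UNIV"
    unfolding e using geo[of "r\<^sup>2"] r2 r
    by (intro summable_on_cmult_right norm_summable_imp_summable_on) auto
qed

text \<open>Folding the sum over the integers onto positive n halves the value of
  \<open>theta_product_lambert\<close>. Expanding sech brings out a factor 2 and halves it once
  more, so the denominator 4 becomes 16.\<close>

lemma has_sum_lambert:
  assumes x: "x > 0"
  shows "((\<lambda>t. lambert_coeff t * exp (- x) ^ lambert_key t) has_sum
      (exp (- x) * (theta2r x)^4 * (theta4 x)\<^sup>2 / 16)) UNIV"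
proof -
  define S where "S = exp (- x) * (theta2r x)^4 * (theta4 x)\<^sup>2 / 4"
  let ?q = "exp (- x)"
  have q: "0 < ?q" "?q < 1" using x by auto
  let ?f = "\<lambda>n. - (altsgn n * (of_int n)\<^sup>2 * sech x n)"
  have f: "(?f has_sum S) UNIV"
    unfolding S_def by (rule theta_product_lambert[OF x])
  define Z where "Z = infsum (\<lambda>i. ?f (int (Suc i))) UNIV"
  have "?f summable_on range (\<lambda>i. int (Suc i))"
    by (rule summable_on_subset_banach[of ?f UNIV]) (use f in \<open>auto simp: summable_on_def\<close>)
  hence Z: "((\<lambda>i. ?f (int (Suc i))) has_sum Z) UNIV"
    unfolding Z_def by (subst (asm) summable_on_reindex) (auto simp: inj_on_def o_def)
  have "(?f has_sum 2 * Z) (UNIV - {0})"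
    by (rule has_sum_int_even_fun[OF _ Z]) (simp add: altsgn_def)
  also have "?this \<longleftrightarrow> (?f has_sum 2 * Z) UNIV"
    by (rule has_sum_cong_neutral) auto
  finally have ZS: "2 * Z = S" using f by (intro has_sum_unique)
  let ?g = "\<lambda>t. lambert_coeff t * ?q ^ lambert_key t"
  have "?g summable_on UNIV \<times> UNIV"
  \<comment> \<open>Since (i + 1) (2k + 1) >= (i + 1) + 2k, the double series is dominated by a
    product of two single ones.\<close>
  proof (rule summable_on_real_bound[where g = "\<lambda>(i, k). (real (Suc i))\<^sup>2 * (?q ^ Suc i) * (?q\<^sup>2) ^ k"])
    have "(\<lambda>(i, k). ((real (Suc i))\<^sup>2 * (?q ^ Suc i)) * (?q\<^sup>2) ^ k) summable_on UNIV \<times> UNIV"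
    proof -
      have "(\<lambda>i. real i ^ 2 * exp (- x * real i)) summable_on UNIV"
      proof -
        have "(\<lambda>n::int. of_int \<bar>n\<bar> ^ 2 * exp (- x * of_int \<bar>n\<bar>)) summable_on range int"
          by (rule summable_on_subset_banach[OF summable_on_int_power_exp[OF x]]) auto
        thus ?thesis by (subst (asm) summable_on_reindex) (auto simp: o_def)
      qed
      hence "(\<lambda>i. real i ^ 2 * exp (- x * real i)) summable_on range Suc"
        by (rule summable_on_subset_banach) auto
      hence "(\<lambda>i. (real (Suc i))\<^sup>2 * exp (- x * real (Suc i))) summable_on UNIV"
        by (subst (asm) summable_on_reindex) (auto simp: o_def)
      moreover have "exp (- x * real (Suc i)) = ?q ^ Suc i" for i
        by (simp only: exp_of_nat2_mult)
      ultimately have 1: "(\<lambda>i. (real (Suc i))\<^sup>2 * ?q ^ Suc i) summable_on UNIV" by simp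
      have "summable (\<lambda>k. (?q\<^sup>2) ^ k)"
        using q by (intro summable_geometric) (simp add: power_less_one_iff)
      hence 2: "(\<lambda>k. (?q\<^sup>2) ^ k) summable_on UNIV"
        by (rule summable_nonneg_imp_summable_on) auto
      show ?thesis
        using has_sum_Times_real[OF 1 2] by (auto simp: summable_on_def)
    qed
    thus "(\<lambda>(i, k). (real (Suc i))\<^sup>2 * (?q ^ Suc i) * (?q\<^sup>2) ^ k) summable_on UNIV \<times> UNIV"
      by simp
    fix t :: "nat \<times> nat"
    obtain i k where t: "t = (i, k)" by force
    have "\<bar>?g t\<bar> = (real (Suc i))\<^sup>2 * ?q ^ (Suc i * (2 * k + 1))"
      by (simp add: t lambert_coeff_def lambert_key_def abs_mult power_abs)
    also have "\<dots> \<le> (real (Suc i))\<^sup>2 * ?q ^ (Suc i + 2 * k)"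
      using q by (intro mult_left_mono power_decreasing) auto
    also have "?q ^ (Suc i + 2 * k) = ?q ^ Suc i * (?q\<^sup>2) ^ k"
      by (simp only: power_add power_mult)
    finally show "\<bar>?g t\<bar> \<le> (case t of (i, k) \<Rightarrow> (real (Suc i))\<^sup>2 * (?q ^ Suc i) * (?q\<^sup>2) ^ k)"
      by (simp only: t prod.case mult.assoc)
  qed
  then obtain Y where Y: "(?g has_sum Y) (UNIV \<times> UNIV)" by (auto simp: summable_on_def)
  have "((\<lambda>i. 1 / 2 * ?f (int (Suc i))) has_sum Y) UNIV"
  proof (rule has_sum_SigmaD[OF Y])
    fix i :: nat
    have "((\<lambda>k. ((-1) ^ i * (real (Suc i))\<^sup>2 / 2) * (2 * (-1) ^ k * ?q ^ (Suc i * (2 * k + 1)))) has_sum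
        ((-1) ^ i * (real (Suc i))\<^sup>2 / 2) * sech x (int (Suc i))) UNIV"
      by (intro has_sum_cmult_right sech_eq_alternating_sum x)
    moreover have "((-1) ^ i * (real (Suc i))\<^sup>2 / 2) * sech x (int (Suc i)) = 1 / 2 * ?f (int (Suc i))"
      by (cases "even i") (simp_all add: altsgn_def)
    moreover have "((-1) ^ i * (real (Suc i))\<^sup>2 / 2) * (2 * (-1) ^ k * ?q ^ (Suc i * (2 * k + 1))) = ?g (i, k)" for k
      by (simp add: lambert_coeff_def lambert_key_def power_add)
    ultimately show "((\<lambda>k. ?g (i, k)) has_sum 1 / 2 * ?f (int (Suc i))) UNIV"
      by (simp only:)
  qed
  moreover have "((\<lambda>i. 1 / 2 * ?f (int (Suc i))) has_sum 1 / 2 * Z) UNIV"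
    by (intro has_sum_cmult_right Z)
  ultimately have "Y = 1 / 2 * Z" by (rule has_sum_unique)
  hence "Y = exp (- x) * (theta2r x)^4 * (theta4 x)\<^sup>2 / 16" using ZS by (simp add: S_def)
  with Y show ?thesis by simp
qed

text \<open>A zero of a nontrivial power series at the origin is isolated, whereas the points
  exp(-x) come arbitrarily close to it. The assumption on \<open>c 0\<close> places the zero at the
  origin.\<close>

lemma powser_zero_coeffs:
  fixes c :: "nat \<Rightarrow> real"
  assumes z: "\<And>x. x > 0 \<Longrightarrow> (\<lambda>n. c n * exp (- x) ^ n) sums 0" and c0: "c 0 = 0"
  shows "c n = 0"
proof (rule ccontr)
  assume cn: "c n \<noteq> 0"
  define f where "f y = suminf (\<lambda>n. c n * y ^ n)" for y
  have sm: "(\<lambda>n. c n * y ^ n) sums f y" if "\<bar>y\<bar> < exp (- 1)" for y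
  proof -
    have "summable (\<lambda>n. c n * exp (- 1) ^ n)" using z[of 1] by (simp add: sums_iff)
    hence "summable (\<lambda>n. c n * y ^ n)" by (rule powser_inside) (use that in auto)
    thus ?thesis unfolding f_def by (rule summable_sums)
  qed
  have "f 0 = 0" unfolding f_def using c0 by (simp add: powser_zero)
  with sm cn c0 obtain s where s: "s > 0" "\<And>z. z \<in> cball 0 s - {0} \<Longrightarrow> f z \<noteq> 0"
    using powser_0_nonzero[of "exp (- 1)" 0 c f n] by (cases n) auto
  define y where "y = min s (exp (- 1)) / 2"
  have y: "0 < y" "y < s" "y < exp (- 1)" using s(1) by (auto simp: y_def min_def)
  hence "f y \<noteq> 0" by (intro s(2)) auto
  moreover have "exp (- 1) < (1::real)" by simp
  with y have "ln y < 0" by (intro ln_less_zero) linarith+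
  hence "(\<lambda>n. c n * y ^ n) sums 0" using z[of "- ln y"] y by simp
  hence "f y = 0" unfolding f_def by (simp add: sums_iff)
  ultimately show False by contradiction
qed

text \<open>The Eisenstein form of f: both generating functions sum to f(exp(-x)) for every x >
  0.\<close>

lemma fcoeff_eq_lambert: "fcoeff N = (\<Sum>t | lambert_key t = N. lambert_coeff t)"
proof -
  define d where "d N = (\<Sum>t | lambert_key t = N. lambert_coeff t)" for N
  have "fcoeff N - d N = 0"
  proof (rule powser_zero_coeffs)
    fix x :: real assume x: "x > 0"
    define S where "S = exp (- x) * (theta2r x)^4 * (theta4 x)\<^sup>2"
    have "(\<lambda>N. (\<Sum>t | nat (theta_exponent t) = N. theta_sign t) * exp (- x) ^ N) sums S"
      unfolding S_def by (rule sums_by_key[OF has_sum_theta_product[OF x] finite_theta_exponent])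
    from sums_divide[OF this, of 16] have "(\<lambda>N. fcoeff N * exp (- x) ^ N) sums (S / 16)"
      by (simp add: fcoeff_eq)
    moreover have "(\<lambda>N. d N * exp (- x) ^ N) sums (S / 16)"
      unfolding S_def d_def by (rule sums_by_key[OF has_sum_lambert[OF x] finite_lambert_key])
    ultimately show "(\<lambda>N. (fcoeff N - d N) * exp (- x) ^ N) sums 0"
      using sums_diff by (fastforce simp: left_diff_distrib)
  next
    have "{t. nat (theta_exponent t) = 0} = {}"
      using theta_exponent_pos by (auto simp: not_le)
    moreover have "{t. lambert_key t = 0} = {}" by (auto simp: lambert_key_def)
    ultimately show "fcoeff 0 - d 0 = 0" unfolding fcoeff_eq d_def by (simp only: sum.empty)
  qed
  thus ?thesis by (simp add: d_def)
qed

section \<open>Continuation of alternating Hurwitz series\<close>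

text \<open>The iterated difference D^k of y powr (-s), with the sign D g(y) = g(y) - g(y + 1) that
  suits alternating sums.\<close>

primrec fdiff :: "nat \<Rightarrow> real \<Rightarrow> complex \<Rightarrow> complex" where
  "fdiff 0 x s = of_real x powr (- s)"
| "fdiff (Suc k) x s = fdiff k x s - fdiff k (x + 1) s"

lemma holomorphic_fdiff: "x > 0 \<Longrightarrow> fdiff k x holomorphic_on A"
proof (induction k arbitrary: x)
  case 0
  have "fdiff 0 x = (\<lambda>s. of_real x powr (- s))" by auto
  thus ?case using 0 by (auto intro!: holomorphic_intros)
next
  case (Suc k)
  have "fdiff (Suc k) x = (\<lambda>s. fdiff k x s - fdiff k (x + 1) s)" by auto
  thus ?case using Suc by (auto intro!: holomorphic_intros)
qed

lemma fdiff_has_vector_derivative: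
  "x > 0 \<Longrightarrow> ((\<lambda>x. fdiff k x s) has_vector_derivative (- s * fdiff k x (s + 1))) (at x within T)"
proof (induction k arbitrary: x T)
  case 0
  have "((\<lambda>z. z powr (- s)) has_field_derivative (- s * of_real x powr (- s - 1))) (at (of_real x))"
    using 0 by (intro has_field_derivative_powr) auto
  from has_vector_derivative_real_field[OF this] show ?case by simp
next
  case (Suc k)
  have shift: "((\<lambda>x. x + 1) has_vector_derivative 1) (at x within T)"
    by (auto intro!: derivative_eq_intros)
  have "((\<lambda>y. fdiff k y s) has_vector_derivative (- s * fdiff k (x + 1) (s + 1)))
      (at (x + 1) within (\<lambda>x. x + 1) ` T)"
    using Suc by auto
  from vector_diff_chain_within[OF shift this]
  have "((\<lambda>x. fdiff k (x + 1) s) has_vector_derivative (- s * fdiff k (x + 1) (s + 1))) (at x within T)"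
    by (simp add: o_def)
  from has_vector_derivative_diff[OF Suc.IH[OF Suc.prems] this] show ?case
    by (simp add: algebra_simps)
qed

text \<open>One more difference is the integral over [x, x+1] of s times the previous difference at
  s + 1. So each difference costs a factor |s + j| and gains a power of x. The sign condition makes
  the power decreasing, hence largest at the left end.\<close>

lemma norm_fdiff_le:
  "x > 0 \<Longrightarrow> Re s + real k \<ge> 0 \<Longrightarrow>
   norm (fdiff k x s) \<le> (\<Prod>j<k. norm (s + of_nat j)) * x powr (- (Re s + real k))"
proof (induction k arbitrary: x s)
  case 0
  thus ?case by (simp add: norm_powr_real_powr)
next
  case (Suc k)
  define B where "B = (\<Prod>j<Suc k. norm (s + of_nat j)) * x powr (- (Re s + real (Suc k)))"
  have "((\<lambda>y. - s * fdiff k y (s + 1)) has_integral (fdiff k (x + 1) s - fdiff k x s)) {x..x+1}"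
    using Suc.prems by (intro fundamental_theorem_of_calculus fdiff_has_vector_derivative) auto
  moreover have "norm (- s * fdiff k y (s + 1)) \<le> B" if y: "y \<in> {x..x+1} - {}" for y
  proof -
    have "norm (fdiff k y (s + 1)) \<le> (\<Prod>j<k. norm (s + 1 + of_nat j)) * y powr (- (Re (s + 1) + real k))"
      using Suc.prems y by (intro Suc.IH) auto
    also have "\<dots> \<le> (\<Prod>j<k. norm (s + 1 + of_nat j)) * x powr (- (Re (s + 1) + real k))"
      using Suc.prems y by (intro mult_left_mono powr_mono2' prod_nonneg) auto
    finally have "norm (- s * fdiff k y (s + 1)) \<le>
        norm s * ((\<Prod>j<k. norm (s + 1 + of_nat j)) * x powr (- (Re (s + 1) + real k)))"
      unfolding norm_mult by (simp add: mult_left_mono)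
    also have "\<dots> = B"
      unfolding B_def prod.lessThan_Suc_shift by (simp add: add_ac)
    finally show ?thesis .
  qed
  moreover have "B \<ge> 0" unfolding B_def by (intro mult_nonneg_nonneg prod_nonneg) auto
  ultimately have "norm (fdiff k (x + 1) s - fdiff k x s) \<le> B * measure lborel {x..x+1}"
    by (intro has_integral_bound_real[where S = "{}"]) auto
  thus ?case by (simp add: B_def norm_minus_commute)
qed

section \<open>Euler's transformation and the gluing of its levels\<close>

definition euler_tail :: "nat \<Rightarrow> real \<Rightarrow> complex \<Rightarrow> complex" where
  "euler_tail k a s = (\<Sum>n. (-1) ^ n * fdiff k (real n + a) s)"

definition euler_sum :: "nat \<Rightarrow> real \<Rightarrow> complex \<Rightarrow> complex" where
  "euler_sum k a s = (\<Sum>j<k. fdiff j a s / 2 ^ Suc j) + euler_tail k a s / 2 ^ k"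

text \<open>A majorant independent of s on bounded parts of a closed half-plane, for Weierstrass'
  test. Dropping \<open>a\<close> from the base requires n >= 1.\<close>

lemma norm_fdiff_le_uniform:
  assumes "a > 0" "n \<ge> 1" "Re s \<ge> \<sigma>" "\<sigma> + real k > 0" "norm s \<le> R"
  shows "norm ((-1) ^ n * fdiff k (real n + a) s) \<le> (\<Prod>j<k. R + real j) * real n powr (- (\<sigma> + real k))"
proof -
  have "norm (fdiff k (real n + a) s) \<le>
      (\<Prod>j<k. norm (s + of_nat j)) * (real n + a) powr (- (Re s + real k))"
    using assms by (intro norm_fdiff_le) auto
  also have "\<dots> \<le> (\<Prod>j<k. R + real j) * (real n + a) powr (- (Re s + real k))"
    using assms
    by (intro mult_right_mono prod_mono) (auto intro: order_trans[OF norm_triangle_ineq])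
  also have "(real n + a) powr (- (Re s + real k)) \<le> (real n + a) powr (- (\<sigma> + real k))"
    using assms by (intro powr_mono) auto
  also have "\<dots> \<le> real n powr (- (\<sigma> + real k))"
    using assms by (intro powr_mono2') auto
  finally show ?thesis
    using order_trans[OF norm_ge_zero assms(5)]
    by (simp add: norm_mult norm_power mult_left_mono prod_nonneg)
qed

lemma summable_fdiff:
  assumes "a > 0" "Re s > 1 - real k"
  shows "summable (\<lambda>n. norm ((-1) ^ n * fdiff k (real n + a) s))"
proof (rule summable_comparison_test_ev)
  show "\<forall>\<^sub>F n in sequentially. norm (norm ((-1) ^ n * fdiff k (real n + a) s)) \<le>
      (\<Prod>j<k. norm s + real j) * real n powr (- (Re s + real k))"
    using eventually_ge_at_top[of 1]
  proof eventually_elim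
    case (elim n)
    from norm_fdiff_le_uniform[OF assms(1) elim, of "Re s" s k "norm s"] assms(2)
    show ?case by simp
  qed
  show "summable (\<lambda>n. (\<Prod>j<k. norm s + real j) * real n powr (- (Re s + real k)))"
    using assms by (intro summable_mult) (simp add: summable_real_powr_iff)
qed

lemma holomorphic_euler_tail:
  assumes a: "a > 0"
  shows "euler_tail k a holomorphic_on {s. Re s > 1 - real k}"
proof (rule holomorphic_uniform_sequence)
  show "open {s. Re s > 1 - real k}" by (rule open_halfspace_Re_gt)
  show "(\<lambda>s. \<Sum>n<N. (-1) ^ n * fdiff k (real n + a) s) holomorphic_on {s. Re s > 1 - real k}" for N
    using a by (intro holomorphic_intros holomorphic_fdiff) auto
  fix s0 assume s0: "s0 \<in> {s. Re s > 1 - real k}"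
  \<comment> \<open>Half the distance from s0 to the line Re s = 1 - k, so that the exponent in the
    majorant stays beyond 1.\<close>
  define d where "d = (Re s0 - (1 - real k)) / 2"
  have d: "d > 0" using s0 by (simp add: d_def)
  have Re_ge: "Re s \<ge> Re s0 - d" if "s \<in> cball s0 d" for s
    using that abs_Re_le_cmod[of "s0 - s"] by (auto simp: dist_norm)
  have sub: "cball s0 d \<subseteq> {s. Re s > 1 - real k}"
  proof
    fix s assume "s \<in> cball s0 d"
    from Re_ge[OF this] show "s \<in> {s. Re s > 1 - real k}" using s0 by (simp add: d_def field_simps)
  qed
  have "uniform_limit (cball s0 d) (\<lambda>N s. \<Sum>n<N. (-1) ^ n * fdiff k (real n + a) s)
      (euler_tail k a) sequentially"
    unfolding euler_tail_def [abs_def]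
  proof (rule Weierstrass_m_test_ev)
    let ?M = "\<lambda>n. (\<Prod>j<k. (norm s0 + d) + real j) * real n powr (- ((Re s0 - d) + real k))"
    show "\<forall>\<^sub>F n in sequentially. \<forall>s\<in>cball s0 d. norm ((-1) ^ n * fdiff k (real n + a) s) \<le> ?M n"
      using eventually_ge_at_top[of 1]
    proof eventually_elim
      case (elim n)
      show ?case
      proof
        fix s assume s: "s \<in> cball s0 d"
        have "norm s \<le> norm s0 + d"
          using s norm_triangle_sub[of s s0] by (simp add: dist_norm norm_minus_commute)
        moreover have "Re s0 - d + real k > 0" using s0 by (simp add: d_def field_simps)
        ultimately show "norm ((-1) ^ n * fdiff k (real n + a) s) \<le> ?M n"
          using Re_ge[OF s] by (intro norm_fdiff_le_uniform a elim) auto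
      qed
    qed
    show "summable ?M"
      using s0 by (intro summable_mult) (simp add: summable_real_powr_iff d_def field_simps)
  qed
  with d sub show "\<exists>d>0. cball s0 d \<subseteq> {s. Re s > 1 - real k} \<and>
      uniform_limit (cball s0 d) (\<lambda>N s. \<Sum>n<N. (-1) ^ n * fdiff k (real n + a) s) (euler_tail k a) sequentially"
    by blast
qed

lemma holomorphic_euler_sum:
  assumes "a > 0"
  shows "euler_sum k a holomorphic_on {s. Re s > 1 - real k}"
  unfolding euler_sum_def [abs_def] using assms
  by (intro holomorphic_intros holomorphic_euler_tail holomorphic_fdiff) auto

text \<open>With t_n the n-th summant at level k, the summand at level k + 1 is t_n + t_(n+1). The
  new tail is thus twice the old one minus t_0.\<close>

lemma euler_tail_Suc:
  assumes "a > 0" "Re s > 1 - real k"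
  shows "euler_tail k a s = fdiff k a s / 2 + euler_tail (Suc k) a s / 2"
proof -
  let ?f = "\<lambda>n. (-1) ^ n * fdiff k (real n + a) s"
  have f: "summable ?f" using summable_fdiff[OF assms] by (rule summable_norm_cancel)
  have eq: "(-1) ^ n * fdiff (Suc k) (real n + a) s = ?f n + ?f (Suc n)" for n
    by (simp add: algebra_simps)
  have "euler_tail (Suc k) a s = (\<Sum>n. ?f n + ?f (Suc n))"
    unfolding euler_tail_def eq ..
  also have "\<dots> = (\<Sum>n. ?f n) + (\<Sum>n. ?f (Suc n))"
    using f summable_Suc_iff[of ?f] by (intro suminf_add [symmetric]) auto
  also have "(\<Sum>n. ?f (Suc n)) = (\<Sum>n. ?f n) - ?f 0"
    by (rule suminf_split_head[OF f])
  finally show ?thesis by (simp add: euler_tail_def diff_divide_distrib)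
qed

lemma euler_sum_add:
  assumes "a > 0" "Re s > 1 - real k"
  shows "euler_sum (k + m) a s = euler_sum k a s"
proof (induction m)
  case (Suc m)
  have "euler_tail (k + m) a s = fdiff (k + m) a s / 2 + euler_tail (Suc (k + m)) a s / 2"
    using assms by (intro euler_tail_Suc) auto
  hence "euler_sum (Suc (k + m)) a s = euler_sum (k + m) a s"
    by (simp add: euler_sum_def add_divide_distrib mult.commute)
  with Suc show ?case by simp
qed simp

text \<open>The alternating Hurwitz zeta function, the continuation of sum (-1)^n (n + a)^(-s). The
  level is chosen from s so that Re s > 1 - k always holds.\<close>

definition alt_hurwitz :: "real \<Rightarrow> complex \<Rightarrow> complex" where
  "alt_hurwitz a s = euler_sum (nat \<lceil>2 - Re s\<rceil>) a s"

text \<open>Two admissible levels l and k agree because both agree with level l + k.\<close>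

lemma alt_hurwitz_eq_euler_sum:
  assumes "a > 0" "Re s > 1 - real k"
  shows "alt_hurwitz a s = euler_sum k a s"
proof -
  define l where "l = nat \<lceil>2 - Re s\<rceil>"
  have l: "Re s > 1 - real l" unfolding l_def by linarith
  have "euler_sum l a s = euler_sum (l + k) a s"
    using euler_sum_add[OF assms(1) l, of k] by simp
  also have "\<dots> = euler_sum k a s"
    using euler_sum_add[OF assms, of l] by (simp add: add.commute)
  finally show ?thesis by (simp add: alt_hurwitz_def l_def)
qed

lemma holomorphic_alt_hurwitz:
  assumes "a > 0"
  shows "alt_hurwitz a holomorphic_on A"
proof -
  have "alt_hurwitz a holomorphic_on (\<Union>k. {s. Re s > 1 - real k})"
  proof (rule holomorphic_on_UN_open)
    show "alt_hurwitz a holomorphic_on {s. Re s > 1 - real k}" for k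
      using holomorphic_euler_sum[OF assms, of k]
      by (rule holomorphic_transform) (use alt_hurwitz_eq_euler_sum[OF assms] in auto)
  qed (auto intro: open_halfspace_Re_gt)
  moreover have "s \<in> (\<Union>k. {s. Re s > 1 - real k})" for s
    using reals_Archimedean2[of "1 - Re s"] by (auto simp: algebra_simps)
  ultimately show ?thesis by (meson holomorphic_on_subset subsetI)
qed

lemma alt_hurwitz_has_sum:
  assumes "a > 0" "Re s > 1"
  shows "((\<lambda>n. (-1) ^ n * of_real (real n + a) powr (- s)) has_sum alt_hurwitz a s) UNIV"
    and "(\<lambda>n. norm ((-1) ^ n * complex_of_real (real n + a) powr (- s))) summable_on UNIV"
proof -
  have s: "summable (\<lambda>n. norm ((-1) ^ n * complex_of_real (real n + a) powr (- s)))"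
    using summable_fdiff[OF assms(1), of 0 s] assms(2) by simp
  show "(\<lambda>n. norm ((-1) ^ n * complex_of_real (real n + a) powr (- s))) summable_on UNIV"
    by (rule summable_nonneg_imp_summable_on[OF s]) auto
  have "alt_hurwitz a s = (\<Sum>n. (-1) ^ n * of_real (real n + a) powr (- s))"
    using alt_hurwitz_eq_euler_sum[OF assms(1), of 0 s] assms(2)
    by (simp add: euler_sum_def euler_tail_def)
  thus "((\<lambda>n. (-1) ^ n * of_real (real n + a) powr (- s)) has_sum alt_hurwitz a s) UNIV"
    using s by (intro norm_summable_imp_has_sum) (auto simp: summable_norm_cancel summable_sums)
qed

text \<open>The point s = 1 lies outside the half-plane of level 0. At level 1 the tail pairs
  neighbours of the alternating harmonic series and equals 2 ln 2 - 1; together with the leading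
  term, 1/2 + (2 ln 2 - 1)/2 = ln 2.\<close>

lemma alt_hurwitz_1_1: "alt_hurwitz 1 1 = of_real (ln 2)"
proof -
  define f where "f n = (-1) ^ n / real (Suc n)" for n
  have f: "f sums ln 2"
    unfolding f_def using alternating_harmonic_series_sums by simp
  hence "(\<lambda>n. f (Suc n)) sums (ln 2 - f 0)" by (subst sums_Suc_iff) simp
  with f have "(\<lambda>n. f n + f (Suc n)) sums (ln 2 + (ln 2 - f 0))" by (intro sums_add)
  hence "(\<lambda>n. f n + f (Suc n)) sums (2 * ln 2 - 1)" by (simp add: f_def)
  hence "(\<lambda>n. complex_of_real (f n + f (Suc n))) sums of_real (2 * ln 2 - 1)"
    by (subst sums_of_real_iff)
  also have "(\<lambda>n. complex_of_real (f n + f (Suc n))) = (\<lambda>n. (-1) ^ n * fdiff 1 (real n + 1) 1)"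
    by (simp add: f_def fun_eq_iff powr_minus divide_inverse algebra_simps flip: of_real_add)
  finally have "euler_tail 1 1 1 = of_real (2 * ln 2 - 1)"
    unfolding euler_tail_def by (simp add: sums_iff)
  moreover have "alt_hurwitz 1 1 = euler_sum 1 1 1"
    by (rule alt_hurwitz_eq_euler_sum) auto
  ultimately show ?thesis by (simp add: euler_sum_def diff_divide_distrib)
qed

section \<open>Evaluation of the Kampe de Feriet series\<close>

text \<open>The normalised central binomial coefficient C(2n, n) / 4^n.\<close>

definition cbin :: "nat \<Rightarrow> real" where
  "cbin n = pochhammer (1/2) n / fact n"

lemma cbin_0 [simp]: "cbin 0 = 1"
  by (simp add: cbin_def)

lemma cbin_pos: "cbin n > 0"
  by (simp add: cbin_def pochhammer_pos)

lemma cbin_Suc: "cbin (Suc n) = cbin n * ((2 * real n + 1) / (2 * real n + 2))"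
  by (simp add: cbin_def pochhammer_Suc field_simps)

text \<open>Squaring keeps the induction rational: the step is (2n + 1)^2 (n + 2) <= 4 (n +
  1)^3.\<close>

lemma cbin_sq_le: "(cbin n)\<^sup>2 \<le> 1 / (real n + 1)"
proof (induction n)
  case (Suc n)
  have "(cbin (Suc n))\<^sup>2 = (cbin n)\<^sup>2 * ((2 * real n + 1) / (2 * real n + 2))\<^sup>2"
    unfolding cbin_Suc by (rule power_mult_distrib)
  also have "\<dots> \<le> 1 / (real n + 1) * ((2 * real n + 1) / (2 * real n + 2))\<^sup>2"
    by (intro mult_right_mono Suc.IH) auto
  also have "\<dots> \<le> 1 / (real (Suc n) + 1)"
    by (simp add: divide_simps power2_eq_square) (simp add: algebra_simps)
  finally show ?case .
qed simp

lemma tendsto_zero_of_sq_le: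
  fixes f :: "nat \<Rightarrow> real"
  assumes "\<And>n. (f n)\<^sup>2 \<le> 1 / (real n + 1)"
  shows "f \<longlonglongrightarrow> 0"
proof -
  have "(\<lambda>n. 1 / (real n + 1)) \<longlonglongrightarrow> 0" by real_asymp
  hence "(\<lambda>n. (f n)\<^sup>2) \<longlonglongrightarrow> 0"
    by (rule tendsto_sandwich[OF _ _ tendsto_const, rotated 2]) (use assms in auto)
  thus ?thesis by simp
qed

lemma cbin_tendsto: "cbin \<longlonglongrightarrow> 0"
  using cbin_sq_le by (rule tendsto_zero_of_sq_le)

text \<open>The majorant \<open>cbin n / (n + 1)\<close> is twice the difference of consecutive
  values of \<open>cbin\<close> and telescopes.\<close>

lemma summable_cbin_over: "summable (\<lambda>n. cbin n / (2 * real n + 1))"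
proof (rule summable_comparison_test')
  have "(\<lambda>n. cbin n - cbin (Suc n)) sums (cbin 0 - 0)"
    by (rule telescope_sums') (rule cbin_tendsto)
  hence "summable (\<lambda>n. 2 * (cbin n - cbin (Suc n)))"
    by (intro summable_mult) (rule sums_summable)
  also have "(\<lambda>n. 2 * (cbin n - cbin (Suc n))) = (\<lambda>n. cbin n / (real n + 1))"
    by (simp add: cbin_Suc fun_eq_iff divide_simps) (simp add: algebra_simps)
  finally show "summable (\<lambda>n. cbin n / (real n + 1))" .
  show "norm (cbin n / (2 * real n + 1)) \<le> cbin n / (real n + 1)" for n
    using cbin_pos[of n] by (simp add: frac_le)
qed

text \<open>The values \<open>F k\<close> of Gauss' series \<open>2F1(1/2, 1/2; k + 1/2; 1)\<close> satisfy
  \<open>(4 k^2 - 1) F k = 4 k^2 F (k + 1)\<close> and tend to 1, so \<open>F 1\<close> is Wallis' product.\<close>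
definition gauss_term :: "nat \<Rightarrow> nat \<Rightarrow> real" where
  "gauss_term k n = (pochhammer (1/2) n)\<^sup>2 / (fact n * pochhammer (real k + 1/2) n)"

lemma gauss_term_nonneg: "gauss_term k n \<ge> 0"
  by (simp add: gauss_term_def pochhammer_nonneg)

lemma pochhammer_3_2: "pochhammer (3/2 :: real) n = pochhammer (1/2) n * (2 * real n + 1)"
proof (induction n)
  case (Suc n)
  thus ?case by (simp add: pochhammer_Suc field_simps)
qed simp

lemma gauss_term_1: "gauss_term 1 n = cbin n / (2 * real n + 1)"
proof -
  define m where "m = 2 * real n + 1"
  have "pochhammer (1/2 :: real) n > 0" by (rule pochhammer_pos) simp
  moreover have "real 1 + 1/2 = 3/2" by simp
  ultimately show ?thesis
    unfolding gauss_term_def cbin_def m_def [symmetric] by (simp add: pochhammer_3_2 power2_eq_square m_def [symmetric])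
qed

lemma gauss_term_Suc: "gauss_term k (Suc n) =
    gauss_term k n * ((2 * real n + 1)\<^sup>2 / (2 * (real n + 1) * (2 * real k + 2 * real n + 1)))"
proof -
  have "pochhammer (real k + 1/2) n > 0" by (intro pochhammer_pos) auto
  moreover have "2 * real k + 2 * real n + 1 > 0" "real k + 1/2 + real n > 0" by auto
  ultimately show ?thesis
    by (simp add: gauss_term_def pochhammer_Suc power_mult_distrib divide_simps power2_eq_square)
       (simp add: algebra_simps)?
qed

lemma gauss_term_0 [simp]: "gauss_term k 0 = 1"
  by (simp add: gauss_term_def)

text \<open>The constant is the quotient of the two terms at n = 1, and the ratio of consecutive
  terms decreases in k. This yields both summability and F k - 1 = O(1/k).\<close>

lemma gauss_term_le:
  assumes "k \<ge> 1" "n \<ge> 1"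
  shows "gauss_term k n \<le> 3 / (2 * real k + 1) * gauss_term 1 n"
  using assms(2)
proof (induction n rule: dec_induct)
  case base
  show ?case using gauss_term_Suc[of k 0] gauss_term_Suc[of 1 0] by (simp add: field_simps)
next
  case (step n)
  let ?c = "\<lambda>k. (2 * real n + 1)\<^sup>2 / (2 * (real n + 1) * (2 * real k + 2 * real n + 1))"
  have "gauss_term k (Suc n) \<le> 3 / (2 * real k + 1) * gauss_term 1 n * ?c 1"
    unfolding gauss_term_Suc using assms(1) step.IH
    by (intro mult_mono frac_le mult_nonneg_nonneg gauss_term_nonneg) auto
  thus ?case by (simp add: gauss_term_Suc mult.assoc)
qed

lemma summable_gauss_term: "k \<ge> 1 \<Longrightarrow> summable (gauss_term k)"
proof (rule summable_comparison_test_ev)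
  assume k: "k \<ge> 1"
  show "\<forall>\<^sub>F n in sequentially. norm (gauss_term k n) \<le> 3 / (2 * real k + 1) * gauss_term 1 n"
    using eventually_ge_at_top[of 1] by eventually_elim (use gauss_term_le[OF k] gauss_term_nonneg in auto)
  show "summable (\<lambda>n. 3 / (2 * real k + 1) * gauss_term 1 n)"
    unfolding gauss_term_1 by (intro summable_mult summable_cbin_over)
qed

text \<open>A telescoping certificate: the combination in k is a difference in n of 2 (2k + 1) n
  \<open>gauss_term k n\<close>, so summing over n gives the recursion for F.\<close>

lemma gauss_term_contiguous:
  "(4 * (real k)\<^sup>2 - 1) * gauss_term k n - 4 * (real k)\<^sup>2 * gauss_term (Suc k) n =
   2 * (2 * real k + 1) * (real n * gauss_term k n - real (Suc n) * gauss_term k (Suc n))"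
proof -
  have "gauss_term (Suc k) n = gauss_term k n * ((2 * real k + 1) / (2 * real k + 2 * real n + 1))"
  proof -
    have "pochhammer (real k + 1/2) (Suc n) = (real k + 1/2) * pochhammer (real k + 1/2 + 1) n"
      by (rule pochhammer_rec)
    moreover have "pochhammer (real k + 1/2) (Suc n) = pochhammer (real k + 1/2) n * (real k + 1/2 + real n)"
      by (rule pochhammer_Suc)
    ultimately have "pochhammer (real (Suc k) + 1/2) n =
        pochhammer (real k + 1/2) n * ((2 * real k + 2 * real n + 1) / (2 * real k + 1))"
      by (simp add: field_simps)
    thus ?thesis by (simp add: gauss_term_def)
  qed
  note S = this
  define T p q y where "T = gauss_term k n" and "p = real k" and "q = real n" and "y = 2 * p + 2 * q + 1"
  have pos: "y > 0" "q + 1 > 0" by (simp_all add: p_def q_def y_def add_pos_nonneg)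
  have "(4 * p\<^sup>2 - 1) - 4 * p\<^sup>2 * ((2 * p + 1) / y) =
      2 * (2 * p + 1) * (q - (q + 1) * ((2 * q + 1)\<^sup>2 / (2 * (q + 1) * y)))"
    using pos by (simp add: divide_simps) (simp add: y_def power2_eq_square algebra_simps)
  from arg_cong[OF this, of "\<lambda>z. T * z"] show ?thesis
    unfolding S gauss_term_Suc T_def [symmetric] p_def [symmetric] q_def [symmetric] y_def [symmetric]
    by (simp add: q_def [symmetric] algebra_simps)
qed

text \<open>The arcsine series at its endpoint 1, which is F 1. Iterating the recursion n times
  gives a partial Wallis product times F (n + 1).\<close>

lemma cbin_over_sums: "(\<lambda>n. cbin n / (2 * real n + 1)) sums (pi / 2)"
proof -
  define F where "F k = suminf (gauss_term k)" for k
  have F: "gauss_term k sums F k" if "k \<ge> 1" for k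
    unfolding F_def by (rule summable_sums[OF summable_gauss_term[OF that]])
  have rec: "F k = 4 * (real k)\<^sup>2 / (4 * (real k)\<^sup>2 - 1) * F (Suc k)" if k: "k \<ge> 1" for k
  proof -
    have lim: "(\<lambda>n. real n * gauss_term k n) \<longlonglongrightarrow> 0"
    proof (rule tendsto_sandwich[where f = "\<lambda>_. 0"])
      show "\<forall>\<^sub>F n in sequentially. real n * gauss_term k n \<le> 3 / (2 * real k + 1) * (cbin n * (real n / (2 * real n + 1)))"
        using eventually_ge_at_top[of 1]
      proof eventually_elim
        case (elim n)
        from mult_left_mono[OF gauss_term_le[OF k elim], of "real n"] show ?case
          by (simp add: gauss_term_1 mult_ac del: One_nat_def)
      qed
      have "(\<lambda>n. real n / (2 * real n + 1)) \<longlonglongrightarrow> 1 / 2" by real_asymp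
      from tendsto_mult[OF cbin_tendsto this]
      have "(\<lambda>n. 3 / (2 * real k + 1) * (cbin n * (real n / (2 * real n + 1)))) \<longlonglongrightarrow>
          3 / (2 * real k + 1) * (0 * (1 / 2))" by (rule tendsto_mult_left)
      thus "(\<lambda>n. 3 / (2 * real k + 1) * (cbin n * (real n / (2 * real n + 1)))) \<longlonglongrightarrow> 0" by simp
    qed (auto simp: gauss_term_nonneg)
    have "(\<lambda>n. real n * gauss_term k n - real (Suc n) * gauss_term k (Suc n)) sums (real 0 * gauss_term k 0 - 0)"
      by (rule telescope_sums') (rule lim)
    hence "(\<lambda>n. 2 * (2 * real k + 1) * (real n * gauss_term k n - real (Suc n) * gauss_term k (Suc n))) sums
        (2 * (2 * real k + 1) * (real 0 * gauss_term k 0 - 0))"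
      by (rule sums_mult)
    hence "(\<lambda>n. (4 * (real k)\<^sup>2 - 1) * gauss_term k n - 4 * (real k)\<^sup>2 * gauss_term (Suc k) n) sums 0"
      unfolding gauss_term_contiguous by simp
    moreover have "(\<lambda>n. (4 * (real k)\<^sup>2 - 1) * gauss_term k n - 4 * (real k)\<^sup>2 * gauss_term (Suc k) n) sums
        ((4 * (real k)\<^sup>2 - 1) * F k - 4 * (real k)\<^sup>2 * F (Suc k))"
      using k by (intro sums_diff sums_mult F) auto
    ultimately have "(4 * (real k)\<^sup>2 - 1) * F k = 4 * (real k)\<^sup>2 * F (Suc k)"
      using sums_unique2 by fastforce
    moreover have "1 \<le> (real k)\<^sup>2" using k by simp
    ultimately show ?thesis by (simp add: field_simps)
  qed
  have prod: "F 1 = (\<Prod>k=1..n. 4 * (real k)\<^sup>2 / (4 * (real k)\<^sup>2 - 1)) * F (Suc n)" for n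
  proof (induction n)
    case (Suc n)
    thus ?case using rec[of "Suc n"] by (simp add: prod.nat_ivl_Suc' mult_ac)
  qed simp
  have "(\<lambda>n. F (Suc n)) \<longlonglongrightarrow> 1"
  proof (rule tendsto_sandwich)
    have bound: "1 \<le> F k \<and> F k \<le> 1 + 3 / (2 * real k + 1) * F 1" if k: "k \<ge> 1" for k
    proof -
      have s: "summable (gauss_term k)" "summable (gauss_term 1)"
        using k by (auto intro: summable_gauss_term)
      have 1: "F k = gauss_term k 0 + (\<Sum>n. gauss_term k (Suc n))"
        unfolding F_def using suminf_split_head[OF s(1)] by simp
      have "(\<Sum>n. gauss_term k (Suc n)) \<le> (\<Sum>n. 3 / (2 * real k + 1) * gauss_term 1 (Suc n))"
        using s summable_Suc_iff[of "gauss_term k"] summable_Suc_iff[of "gauss_term 1"]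
        by (intro suminf_le gauss_term_le[OF k] summable_mult) auto
      also have "\<dots> = 3 / (2 * real k + 1) * (F 1 - 1)"
        using s(2) summable_Suc_iff[of "gauss_term 1"] suminf_split_head[OF s(2)]
        by (subst suminf_mult) (auto simp: F_def)
      also have "\<dots> \<le> 3 / (2 * real k + 1) * F 1"
        by (intro mult_left_mono) auto
      finally have "F k \<le> 1 + 3 / (2 * real k + 1) * F 1" using 1 by simp
      moreover have "(\<Sum>n. gauss_term k (Suc n)) \<ge> 0"
        using s(1) summable_Suc_iff[of "gauss_term k"] by (intro suminf_nonneg gauss_term_nonneg) auto
      ultimately show ?thesis using 1 by simp
    qed
    show "\<forall>\<^sub>F n in sequentially. 1 \<le> F (Suc n)" using bound by auto
    show "\<forall>\<^sub>F n in sequentially. F (Suc n) \<le> 1 + 3 / (2 * real (Suc n) + 1) * F 1"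
      using bound by (intro always_eventually) (auto simp del: of_nat_Suc)
    have "(\<lambda>n. 3 / (2 * real (Suc n) + 1)) \<longlonglongrightarrow> 0" by real_asymp
    from tendsto_add[OF tendsto_const[of 1] tendsto_mult[OF this tendsto_const[of "F 1"]]]
    show "(\<lambda>n. 1 + 3 / (2 * real (Suc n) + 1) * F 1) \<longlonglongrightarrow> 1" by simp
  qed auto
  from tendsto_mult[OF wallis this]
  have "(\<lambda>n. F 1) \<longlonglongrightarrow> pi / 2 * 1" unfolding prod [symmetric] .
  hence "F 1 = pi / 2" by (simp add: LIMSEQ_const_iff del: One_nat_def)
  note F1 = this
  have "(\<lambda>n. gauss_term 1 n) sums (pi / 2)" using F[OF order_refl] unfolding F1 .
  thus ?thesis unfolding gauss_term_1 .
qed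

text \<open>The series of the integral of t^(2N) / sqrt (1 - t^2) over [0, 1]. The induction is its
  reduction formula, with \<open>?g\<close> as the telescoping certificate.\<close>

lemma cbin_over_shift_sums: "(\<lambda>n. cbin n / (2 * real n + 2 * real N + 1)) sums (pi / 2 * cbin N)"
proof (induction N)
  case 0
  show ?case using cbin_over_sums by simp
next
  case (Suc N)
  let ?g = "\<lambda>n. cbin n * (2 * real n / (2 * real n + 2 * real N + 1))"
  have "(\<lambda>n. 2 * real n / (2 * real n + 2 * real N + 1)) \<longlonglongrightarrow> 1" by real_asymp
  from tendsto_mult[OF cbin_tendsto this] have "?g \<longlonglongrightarrow> 0" by simp
  hence "(\<lambda>n. ?g n - ?g (Suc n)) sums (?g 0 - 0)" by (rule telescope_sums')
  from sums_add[OF this sums_mult[OF Suc.IH, of "2 * real N + 1"]]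
  have "(\<lambda>n. 1 / (2 * real N + 2) * (?g n - ?g (Suc n) + (2 * real N + 1) * (cbin n / (2 * real n + 2 * real N + 1))))
      sums (1 / (2 * real N + 2) * ((2 * real N + 1) * (pi / 2 * cbin N)))"
    by (intro sums_mult) simp
  also have "(\<lambda>n. 1 / (2 * real N + 2) * (?g n - ?g (Suc n) + (2 * real N + 1) * (cbin n / (2 * real n + 2 * real N + 1)))) =
      (\<lambda>n. cbin n / (2 * real n + 2 * real (Suc N) + 1))"
  proof
    fix n
    define y where "y = 2 * real n + 2 * real N + 1"
    have y: "y > 0" "y + 2 > 0" by (simp_all add: y_def)
    have e: "2 * real (Suc n) + 2 * real N + 1 = y + 2" "2 * real n + 2 * real (Suc N) + 1 = y + 2"
      by (simp_all add: y_def)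
    have "?g (Suc n) = cbin n * ((2 * real n + 1) / (y + 2))"
      unfolding e cbin_Suc by (simp add: divide_simps)
    moreover have "?g n = cbin n * (2 * real n / y)" by (simp add: y_def)
    ultimately have "?g n - ?g (Suc n) + (2 * real N + 1) * (cbin n / y) =
        cbin n * (2 * real n / y - (2 * real n + 1) / (y + 2) + (2 * real N + 1) / y)"
      by (simp only:) (simp add: ring_distribs)
    also have "2 * real n / y - (2 * real n + 1) / (y + 2) + (2 * real N + 1) / y = (2 * real N + 2) / (y + 2)"
      using y by (simp add: divide_simps) (simp add: y_def algebra_simps)
    finally have "?g n - ?g (Suc n) + (2 * real N + 1) * (cbin n / y) = cbin n * ((2 * real N + 2) / (y + 2))" .
    thus "1 / (2 * real N + 2) * (?g n - ?g (Suc n) + (2 * real N + 1) * (cbin n / (2 * real n + 2 * real N + 1))) =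
      cbin n / (2 * real n + 2 * real (Suc N) + 1)"
      unfolding e y_def [symmetric] by simp
  qed
  also have "1 / (2 * real N + 2) * ((2 * real N + 1) * (pi / 2 * cbin N)) = pi / 2 * cbin (Suc N)"
    by (simp add: cbin_Suc)
  finally show ?case .
qed

section \<open>Odd harmonic numbers and logarithmic sums\<close>

definition odd_harm :: "nat \<Rightarrow> real" where
  "odd_harm n = (\<Sum>j\<le>n. 1 / (2 * real j + 1))"

lemma ln_2_pairs_sums: "(\<lambda>k. 1 / (2 * real k + 1) - 1 / (2 * real k + 2)) sums ln 2"
proof -
  have "(\<lambda>n. \<Sum>i\<in>{n * 2..<n * 2 + 2}. (-1) ^ i / real (Suc i)) sums ln 2"
    by (rule sums_group[OF alternating_harmonic_series_sums]) simp
  moreover have "{n * 2..<n * 2 + 2} = {n * 2, Suc (n * 2)}" for n :: nat by auto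
  hence "(\<Sum>i\<in>{n * 2..<n * 2 + 2}. (-1) ^ i / real (Suc i)) = 1 / (2 * real n + 1) - 1 / (2 * real n + 2)" for n
    by (simp add: mult.commute add.commute)
  ultimately show ?thesis by simp
qed

text \<open>With N = i + 1 these are the partial fractions of (2n + 1) / (2N (2n + 2N + 1)). For n =
  0 a telescoping series of sum 1 minus the series for ln 2 remains; each step adds a telescoping
  series of sum 1 / (2n + 3).\<close>

lemma odd_harm_sums:
  "(\<lambda>i. 1 / (2 * real i + 2) - 1 / (2 * real i + 2 * real n + 3)) sums (odd_harm n - ln 2)"
proof (induction n)
  case 0
  have lim: "(\<lambda>k. 1 / (2 * real k + 1)) \<longlonglongrightarrow> 0" by real_asymp
  have "(\<lambda>k. 1 / (2 * real k + 1) - 1 / (2 * real (Suc k) + 1)) sums (1 / (2 * real 0 + 1) - 0)"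
    by (rule telescope_sums') (rule lim)
  from sums_diff[OF this ln_2_pairs_sums] show ?case by (simp add: odd_harm_def add_ac)
next
  case (Suc n)
  have lim: "(\<lambda>i. 1 / (2 * real i + 2 * real n + 3)) \<longlonglongrightarrow> 0" by real_asymp
  have "(\<lambda>i. 1 / (2 * real i + 2 * real n + 3) - 1 / (2 * real (Suc i) + 2 * real n + 3)) sums
      (1 / (2 * real 0 + 2 * real n + 3) - 0)"
    by (rule telescope_sums') (rule lim)
  from sums_add[OF Suc.IH this] show ?case by (simp add: odd_harm_def algebra_simps)
qed

text \<open>For \<open>Y k = (\<Sum>N\<ge>1. (1/2)_N / (N (k + 1)_N))\<close> the difference
  \<open>Y k - Y (k + 1)\<close> telescopes to \<open>1/(k + 1/2) - 1/(k + 1)\<close>.\<close>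
lemma cbin_log_sums: "(\<lambda>i. cbin (Suc i) / (2 * real (Suc i))) sums ln 2"
proof -
  define z where "z k n = pochhammer (1/2 :: real) n / pochhammer (real k + 1) n" for k n
  have z0: "z 0 n = cbin n" for n by (simp add: z_def cbin_def pochhammer_fact)
  have z_nonneg: "z k n \<ge> 0" for k n by (simp add: z_def pochhammer_nonneg)
  have z_Suc: "z k (Suc n) = z k n * ((real n + 1/2) / (real n + real k + 1))" for k n
    by (simp add: z_def pochhammer_Suc add_ac)
  \<comment> \<open>The ratios of \<open>z k\<close> are at most those of \<open>z 0\<close>, and
    the first values differ by the factor 1 / (k + 1). This forces Y k to 0.\<close>
  have z_le: "z k (Suc n) \<le> cbin (Suc n) / (real k + 1)" for k n
  proof (induction n)
    case 0
    show ?case by (simp add: z_def cbin_def)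
  next
    case (Suc n)
    have "z k (Suc (Suc n)) \<le> cbin (Suc n) / (real k + 1) * ((real (Suc n) + 1/2) / (real (Suc n) + real 0 + 1))"
      unfolding z_Suc[of k "Suc n"] using Suc.IH cbin_pos[of "Suc n"]
      by (intro mult_mono frac_le) (auto simp: z_nonneg less_imp_le)
    thus ?case unfolding z0 [symmetric] z_Suc[of 0 "Suc n"] by (simp add: mult_ac)
  qed
  define Y where "Y k = (\<Sum>i. z k (Suc i) / real (Suc i))" for k
  have "summable (\<lambda>i. cbin (Suc i) / real (Suc i))"
  proof (rule summable_comparison_test')
    show "summable (\<lambda>i. 3 * (cbin (Suc i) / (2 * real (Suc i) + 1)))"
      using summable_cbin_over by (intro summable_mult) (subst summable_Suc_iff)
    show "norm (cbin (Suc i) / real (Suc i)) \<le> 3 * (cbin (Suc i) / (2 * real (Suc i) + 1))" for i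
      using cbin_pos[of "Suc i"] by (simp add: divide_simps)
  qed
  note sb = this
  have sz: "summable (\<lambda>i. z k (Suc i) / real (Suc i))" for k
  proof (rule summable_comparison_test'[OF sb])
    show "norm (z k (Suc i) / real (Suc i)) \<le> cbin (Suc i) / real (Suc i)" for i
    proof -
      have "z k (Suc i) \<le> cbin (Suc i) / 1"
        by (rule order_trans[OF z_le]) (use cbin_pos[of "Suc i"] in \<open>intro divide_left_mono, auto\<close>)
      thus ?thesis using z_nonneg[of k "Suc i"] by (simp add: divide_right_mono)
    qed
  qed
  have Y: "(\<lambda>i. z k (Suc i) / real (Suc i)) sums Y k" for k
    unfolding Y_def by (rule summable_sums[OF sz])
  have zlim: "(\<lambda>i. z k (Suc i)) \<longlonglongrightarrow> 0" for k
  proof (rule tendsto_sandwich[where f = "\<lambda>_. 0"])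
    have "(\<lambda>i. cbin (Suc i) / (real k + 1)) \<longlonglongrightarrow> 0 / (real k + 1)"
      by (intro tendsto_divide tendsto_const LIMSEQ_Suc cbin_tendsto) auto
    thus "(\<lambda>i. cbin (Suc i) / (real k + 1)) \<longlonglongrightarrow> 0" by simp
  qed (use z_le z_nonneg in auto)
  \<comment> \<open>The difference of the summands in k is the difference in i of
    \<open>z k (Suc i) / (k + 1/2)\<close>, so only the first value survives.\<close>
  have diff: "Y k - Y (Suc k) = 2 * (1 / (2 * real k + 1) - 1 / (2 * real k + 2))" for k
  proof -
    have "(\<lambda>i. z k (Suc i) - z k (Suc (Suc i))) sums (z k (Suc 0) - 0)"
      by (rule telescope_sums') (rule zlim)
    from sums_divide[OF this, of "real k + 1/2"]
    have "(\<lambda>i. (z k (Suc i) - z k (Suc (Suc i))) / (real k + 1/2)) sums (z k (Suc 0) / (real k + 1/2))" by simp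
    also have "(\<lambda>i. (z k (Suc i) - z k (Suc (Suc i))) / (real k + 1/2)) =
        (\<lambda>i. z k (Suc i) / real (Suc i) - z (Suc k) (Suc i) / real (Suc i))"
    proof
      fix i
      have "pochhammer (real k + 1) (Suc (Suc i)) = (real k + 1) * pochhammer (real (Suc k) + 1) (Suc i)"
        using pochhammer_rec[of "real k + 1" "Suc i"] by (simp add: add_ac)
      moreover have "pochhammer (real k + 1) (Suc (Suc i)) =
          pochhammer (real k + 1) (Suc i) * (real k + real (Suc i) + 1)"
        using pochhammer_Suc[of "real k + 1" "Suc i"] by (simp add: add_ac)
      ultimately have "pochhammer (real (Suc k) + 1) (Suc i) =
          pochhammer (real k + 1) (Suc i) * ((real k + real (Suc i) + 1) / (real k + 1))"
        by (simp add: field_simps)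
      hence zk: "z (Suc k) (Suc i) = z k (Suc i) * ((real k + 1) / (real k + real (Suc i) + 1))"
        by (simp add: z_def)
      define p q where "p = real k" and "q = real (Suc i)"
      have pq: "p + 1/2 > 0" "q > 0" "q + p + 1 > 0" by (auto simp: p_def q_def)
      have "(1 - (q + 1/2) / (q + p + 1)) / (p + 1/2) = 1 / q - (p + 1) / (p + q + 1) / q"
        using pq by (simp add: divide_simps) (simp add: algebra_simps)
      from arg_cong[OF this, of "\<lambda>t. z k (Suc i) * t"]
      show "(z k (Suc i) - z k (Suc (Suc i))) / (real k + 1/2) = z k (Suc i) / real (Suc i) - z (Suc k) (Suc i) / real (Suc i)"
        unfolding zk z_Suc[of k "Suc i"] p_def [symmetric] q_def [symmetric]
        by (simp add: right_diff_distrib diff_divide_distrib)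
    qed
    finally have "Y k - Y (Suc k) = z k (Suc 0) / (real k + 1/2)"
      using sums_diff[OF Y[of k] Y[of "Suc k"]] by (intro sums_unique2)
    also have "z k (Suc 0) = (1/2) / (real k + 1)" by (simp add: z_def)
    finally show ?thesis by (simp add: divide_simps) (simp add: algebra_simps)
  qed
  have "Y \<longlonglongrightarrow> 0"
  proof (rule tendsto_sandwich)
    show "\<forall>\<^sub>F k in sequentially. 0 \<le> Y k"
      unfolding Y_def by (intro always_eventually allI suminf_nonneg sz) (simp add: z_nonneg)
    show "\<forall>\<^sub>F k in sequentially. Y k \<le> (\<Sum>i. cbin (Suc i) / real (Suc i)) * (1 / (real k + 1))"
    proof (intro always_eventually allI)
      fix k
      have "z k (Suc i) / real (Suc i) \<le> cbin (Suc i) / real (Suc i) * (1 / (real k + 1))" for i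
        using divide_right_mono[OF z_le[of k i], of "real (Suc i)"] by (simp add: mult.commute)
      hence "Y k \<le> (\<Sum>i. cbin (Suc i) / real (Suc i) * (1 / (real k + 1)))"
        unfolding Y_def
        by (intro suminf_le sz summable_mult2 sb)
      thus "Y k \<le> (\<Sum>i. cbin (Suc i) / real (Suc i)) * (1 / (real k + 1))"
        by (subst (asm) suminf_mult2 [OF sb, symmetric])
    qed
    have "(\<lambda>k. 1 / (real k + 1)) \<longlonglongrightarrow> 0" by real_asymp
    from tendsto_mult[OF tendsto_const this]
    show "(\<lambda>k. (\<Sum>i. cbin (Suc i) / real (Suc i)) * (1 / (real k + 1))) \<longlonglongrightarrow> 0" by simp
  qed auto
  hence "(\<lambda>k. Y k - Y (Suc k)) sums (Y 0 - 0)" by (rule telescope_sums')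
  hence "(\<lambda>k. 2 * (1 / (2 * real k + 1) - 1 / (2 * real k + 2))) sums Y 0" by (simp only: diff diff_zero)
  moreover have "(\<lambda>k. 2 * (1 / (2 * real k + 1) - 1 / (2 * real k + 2))) sums (2 * ln 2)"
    by (intro sums_mult ln_2_pairs_sums)
  ultimately have "Y 0 = 2 * ln 2" by (rule sums_unique2)
  with sums_divide[OF Y[of 0], of 2] show ?thesis
    unfolding z0 by (simp add: mult.commute del: of_nat_Suc)
qed

lemma cbin_odd_harm_has_sum: "((\<lambda>n. cbin n * odd_harm n / (2 * real n + 1)) has_sum (pi * ln 2)) UNIV"
proof -
  define V where "V i n = 1 / (2 * real i + 2) * (cbin n / (2 * real i + 2 * real n + 3))" for i n
  have V_nonneg: "V i n \<ge> 0" for i n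
    unfolding V_def using cbin_pos[of n] by (intro mult_nonneg_nonneg divide_nonneg_nonneg) auto
  have inner1: "(V i has_sum (1 / (2 * real i + 2) * (pi / 2 * cbin (Suc i)))) UNIV" for i
  proof (rule sums_nonneg_imp_has_sum)
    have "(\<lambda>n. 1 / (2 * real i + 2) * (cbin n / (2 * real n + 2 * real (Suc i) + 1))) sums
        (1 / (2 * real i + 2) * (pi / 2 * cbin (Suc i)))"
      by (intro sums_mult cbin_over_shift_sums)
    thus "V i sums (1 / (2 * real i + 2) * (pi / 2 * cbin (Suc i)))"
      by (simp add: V_def [abs_def] add_ac)
  qed (rule V_nonneg)
  have outer1: "((\<lambda>i. 1 / (2 * real i + 2) * (pi / 2 * cbin (Suc i))) has_sum (pi / 2 * ln 2)) UNIV"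
  proof (rule sums_nonneg_imp_has_sum)
    from sums_mult[OF cbin_log_sums, of "pi / 2"]
    show "(\<lambda>i. 1 / (2 * real i + 2) * (pi / 2 * cbin (Suc i))) sums (pi / 2 * ln 2)"
      by (simp add: mult_ac distrib_left add.commute)
    show "1 / (2 * real i + 2) * (pi / 2 * cbin (Suc i)) \<ge> 0" for i
      using cbin_pos[of "Suc i"] by (simp del: of_nat_Suc)
  qed
  have sV: "(\<lambda>(i, n). V i n) summable_on UNIV \<times> UNIV"
  proof (rule summable_on_SigmaI)
    show "((\<lambda>n. case (i, n) of (i, n) \<Rightarrow> V i n) has_sum (1 / (2 * real i + 2) * (pi / 2 * cbin (Suc i)))) UNIV" for i
      using inner1 by simp
    show "(\<lambda>i. 1 / (2 * real i + 2) * (pi / 2 * cbin (Suc i))) summable_on UNIV"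
      using outer1 by (auto simp: summable_on_def)
  qed (use V_nonneg in auto)
  have total: "((\<lambda>(i, n). V i n) has_sum (pi / 2 * ln 2)) (UNIV \<times> UNIV)"
    by (rule has_sum_SigmaI[OF _ outer1 sV]) (use inner1 in simp)
  have "((\<lambda>n. cbin n / (2 * real n + 1) * (odd_harm n - ln 2)) has_sum (pi / 2 * ln 2)) UNIV"
  proof (rule has_sum_SigmaD)
    show "((\<lambda>(n, i). V i n) has_sum (pi / 2 * ln 2)) (UNIV \<times> UNIV)"
      using total by (subst has_sum_swap) simp
    show "((\<lambda>i. case (n, i) of (n, i) \<Rightarrow> V i n) has_sum (cbin n / (2 * real n + 1) * (odd_harm n - ln 2))) UNIV" for n
    proof (rule sums_nonneg_imp_has_sum)
      have "(\<lambda>i. cbin n / (2 * real n + 1) * (1 / (2 * real i + 2) - 1 / (2 * real i + 2 * real n + 3))) sums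
          (cbin n / (2 * real n + 1) * (odd_harm n - ln 2))"
        by (intro sums_mult odd_harm_sums)
      moreover have "cbin n / (2 * real n + 1) * (1 / (2 * real i + 2) - 1 / (2 * real i + 2 * real n + 3)) = V i n" for i
      proof -
        define p q where "p = 2 * real n + 1" and "q = 2 * real i + 2"
        have pq: "p > 0" "q > 0" "2 * real i + 2 * real n + 3 = p + q" by (simp_all add: p_def q_def)
        have "1 / p * (1 / q - 1 / (p + q)) = 1 / q * (1 / (p + q))"
          using pq by (simp add: divide_simps)
        from arg_cong[OF this, of "\<lambda>t. cbin n * t"] show ?thesis
          unfolding V_def pq(3) p_def [symmetric] q_def [symmetric] by simp
      qed
      ultimately show "(\<lambda>i. case (n, i) of (n, i) \<Rightarrow> V i n) sums (cbin n / (2 * real n + 1) * (odd_harm n - ln 2))"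
        by simp
    qed (use V_nonneg in auto)
  qed
  \<comment> \<open>The ln 2 subtracted from \<open>odd_harm\<close> is added back; it contributes
    another (pi / 2) ln 2.\<close>
  moreover have "((\<lambda>n. ln 2 * (cbin n / (2 * real n + 1))) has_sum (ln 2 * (pi / 2))) UNIV"
    by (intro has_sum_cmult_right sums_nonneg_imp_has_sum cbin_over_sums) (simp add: cbin_pos less_imp_le)
  ultimately have "((\<lambda>n. cbin n / (2 * real n + 1) * (odd_harm n - ln 2) + ln 2 * (cbin n / (2 * real n + 1)))
      has_sum (pi / 2 * ln 2 + ln 2 * (pi / 2))) UNIV"
    by (rule has_sum_add)
  thus ?thesis by (simp add: algebra_simps flip: add_divide_distrib)
qed

text \<open>The factor of the double series that couples m and n: (2)_k / (5/2)_k is 3/2 times its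
  value at k + 1.\<close>

definition rquot :: "nat \<Rightarrow> real" where
  "rquot n = fact n / pochhammer (3/2) n"

lemma rquot_pos: "rquot n > 0"
  by (simp add: rquot_def pochhammer_pos)

lemma rquot_0 [simp]: "rquot 0 = 1"
  by (simp add: rquot_def)

lemma rquot_Suc: "rquot (Suc n) = rquot n * ((2 * real n + 2) / (2 * real n + 3))"
proof -
  have "pochhammer (3/2 :: real) n > 0" by (rule pochhammer_pos) simp
  thus ?thesis by (simp add: rquot_def pochhammer_Suc field_simps)
qed

lemma rquot_sq_le: "(rquot n)\<^sup>2 \<le> 1 / (real n + 1)"
proof (induction n)
  case (Suc n)
  have "(rquot (Suc n))\<^sup>2 = (rquot n)\<^sup>2 * ((2 * real n + 2) / (2 * real n + 3))\<^sup>2"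
    unfolding rquot_Suc by (rule power_mult_distrib)
  also have "\<dots> \<le> 1 / (real n + 1) * ((2 * real n + 2) / (2 * real n + 3))\<^sup>2"
    by (intro mult_right_mono Suc.IH) auto
  also have "\<dots> \<le> 1 / (real (Suc n) + 1)"
    by (simp add: divide_simps power2_eq_square) (simp add: algebra_simps)
  finally show ?case .
qed simp

lemma rquot_tendsto: "rquot \<longlonglongrightarrow> 0"
  using rquot_sq_le by (rule tendsto_zero_of_sq_le)

lemma rquot_cbin: "rquot n * cbin n = 1 / (2 * real n + 1)"
proof -
  have "pochhammer (1/2 :: real) n > 0" by (rule pochhammer_pos) simp
  thus ?thesis by (simp add: rquot_def cbin_def pochhammer_3_2)
qed

text \<open>For n = 0 the summand is twice a difference of \<open>rquot\<close>. The summand for n +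
  1 is (2n + 2) / (2n + 3) times the one for n plus a telescoping difference over n + 1. The factor
  is the ratio of \<open>rquot\<close> values, and the difference supplies the new odd
  reciprocal.\<close>

lemma rquot_sums: "(\<lambda>m. rquot (m + n + 1) / (real m + 1)) sums (2 * odd_harm n * rquot n)"
proof (induction n)
  case 0
  have "(\<lambda>m. 2 * (rquot m - rquot (Suc m))) sums (2 * (rquot 0 - 0))"
    by (intro sums_mult telescope_sums' rquot_tendsto)
  moreover have "2 * (rquot m - rquot (Suc m)) = rquot (m + 0 + 1) / (real m + 1)" for m
    by (simp add: rquot_Suc divide_simps) (simp add: algebra_simps)
  ultimately show ?case by (simp add: odd_harm_def)
next
  case (Suc n)
  have "(\<lambda>m. rquot (m + n + 1) - rquot (Suc m + n + 1)) sums (rquot (0 + n + 1) - 0)"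
  proof (rule telescope_sums')
    show "(\<lambda>m. rquot (m + n + 1)) \<longlonglongrightarrow> 0"
      using LIMSEQ_ignore_initial_segment[OF rquot_tendsto, of "n + 1"] by (simp add: add_ac)
  qed
  from sums_mult[OF sums_add[OF Suc.IH sums_divide[OF this, of "real n + 1"]], of "(2 * real n + 2) / (2 * real n + 3)"]
  have "(\<lambda>m. (2 * real n + 2) / (2 * real n + 3) * (rquot (m + n + 1) / (real m + 1) +
        (rquot (m + n + 1) - rquot (Suc m + n + 1)) / (real n + 1))) sums
     ((2 * real n + 2) / (2 * real n + 3) * (2 * odd_harm n * rquot n + rquot (Suc n) / (real n + 1)))"
    by simp
  also have "(2 * real n + 2) / (2 * real n + 3) * (2 * odd_harm n * rquot n + rquot (Suc n) / (real n + 1)) =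
      2 * odd_harm (Suc n) * rquot (Suc n)"
    by (simp add: rquot_Suc odd_harm_def divide_simps) (simp add: algebra_simps)
  also have "(\<lambda>m. (2 * real n + 2) / (2 * real n + 3) * (rquot (m + n + 1) / (real m + 1) +
        (rquot (m + n + 1) - rquot (Suc m + n + 1)) / (real n + 1))) = (\<lambda>m. rquot (m + Suc n + 1) / (real m + 1))"
  proof
    fix m
    define p q R where "p = real m" and "q = real n" and "R = rquot (m + n + 1)"
    have pq: "p + 1 > 0" "q + 1 > 0" "2 * p + 2 * q + 5 > 0" "2 * q + 3 > 0" by (simp_all add: p_def q_def add_nonneg_pos)
    have R': "rquot (Suc m + n + 1) = R * ((2 * p + 2 * q + 4) / (2 * p + 2 * q + 5))"
      using rquot_Suc[of "m + n + 1"] by (simp add: R_def p_def q_def algebra_simps)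
    have "(2 * q + 2) / (2 * q + 3) * (1 / (p + 1) + (1 - (2 * p + 2 * q + 4) / (2 * p + 2 * q + 5)) / (q + 1)) =
        (2 * p + 2 * q + 4) / (2 * p + 2 * q + 5) / (p + 1)"
      using pq by (simp add: divide_simps) (simp add: algebra_simps)
    note main = this
    define A W where "A = (2 * q + 2) / (2 * q + 3)" and "W = (2 * p + 2 * q + 4) / (2 * p + 2 * q + 5)"
    have "A * (R / (p + 1) + (R - R * W) / (q + 1)) = R * (A * (1 / (p + 1) + (1 - W) / (q + 1)))"
      by (simp add: distrib_left right_diff_distrib diff_divide_distrib mult_ac)
    also have "A * (1 / (p + 1) + (1 - W) / (q + 1)) = W / (p + 1)"
      unfolding A_def W_def by (rule main)
    finally have "(2 * q + 2) / (2 * q + 3) * (R / (p + 1) + (R - rquot (Suc m + n + 1)) / (q + 1)) =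
        rquot (Suc m + n + 1) / (p + 1)"
      unfolding R' A_def W_def by simp
    thus "(2 * real n + 2) / (2 * real n + 3) * (rquot (m + n + 1) / (real m + 1) +
        (rquot (m + n + 1) - rquot (Suc m + n + 1)) / (real n + 1)) = rquot (m + Suc n + 1) / (real m + 1)"
      by (simp add: p_def q_def R_def)
  qed
  finally show ?case .
qed

lemma pochhammer_2: "pochhammer (2::real) m = fact (Suc m)"
proof -
  have "pochhammer (1::real) (Suc m) = 1 * pochhammer (1 + 1) m" by (rule pochhammer_rec)
  thus ?thesis by (simp add: pochhammer_fact [symmetric])
qed

lemma pochhammer_quot_rquot: "pochhammer 2 k / pochhammer (5/2) k = 3 / 2 * rquot (Suc k)"
proof -
  have p: "pochhammer (3/2::real) (Suc k) = 3/2 * pochhammer (5/2) k"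
    using pochhammer_rec[of "3/2::real" k] by simp
  show ?thesis unfolding rquot_def pochhammer_2 p by simp
qed

text \<open>All terms are nonnegative, so the sum over m may come first. It leaves
  \<open>cbin n\<close>^2 \<open>rquot n\<close>, which is \<open>cbin n\<close> / (2n + 1), times
  the odd harmonic number.\<close>

lemma kdf_value: "kdf [2] [5/2] [1, 1] [2] [1/2, 1/2] [1] 1 1 = 3 * pi * ln 2"
proof -
  define T where "T m n = 3 / 2 * (cbin n)\<^sup>2 * (rquot (m + n + 1) / (real m + 1))" for m n
  have T_eq: "(pochhammer 2 (m + n) * (pochhammer 1 m * pochhammer 1 m) * (pochhammer (1/2) n * pochhammer (1/2) n)) /
      (pochhammer (5/2) (m + n) * pochhammer 2 m * pochhammer 1 n) / (fact m * fact n) = T m n" for m n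
  proof -
    have "(pochhammer (2::real) (m + n) * (pochhammer 1 m * pochhammer 1 m) * (pochhammer (1/2) n * pochhammer (1/2) n)) /
      (pochhammer (5/2) (m + n) * pochhammer 2 m * pochhammer 1 n) / (fact m * fact n) =
      pochhammer 2 (m + n) / pochhammer (5/2) (m + n) * (fact m / pochhammer 2 m) * (pochhammer (1/2) n / fact n)\<^sup>2"
      by (simp add: pochhammer_fact [symmetric] power2_eq_square)
    also have "\<dots> = 3 / 2 * rquot (Suc (m + n)) * (fact m / pochhammer 2 m) * (cbin n)\<^sup>2"
      by (simp only: pochhammer_quot_rquot cbin_def)
    also have "fact m / pochhammer 2 m = 1 / (real m + 1)"
      by (simp add: pochhammer_2 add_ac)
    finally show ?thesis by (simp add: T_def mult_ac)
  qed
  have T_nonneg: "T m n \<ge> 0" for m n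
    using rquot_pos[of "m + n + 1"] by (simp add: T_def less_imp_le)
  let ?U = "\<lambda>n. 3 * (cbin n * odd_harm n / (2 * real n + 1))"
  have inner: "((\<lambda>m. T m n) has_sum ?U n) UNIV" for n
  proof (rule sums_nonneg_imp_has_sum)
    have "(\<lambda>m. T m n) sums (3 / 2 * (cbin n)\<^sup>2 * (2 * odd_harm n * rquot n))"
      unfolding T_def by (intro sums_mult rquot_sums)
    also have "3 / 2 * (cbin n)\<^sup>2 * (2 * odd_harm n * rquot n) = 3 * cbin n * odd_harm n * (rquot n * cbin n)"
      by (simp add: power2_eq_square)
    also have "\<dots> = ?U n" unfolding rquot_cbin by simp
    finally show "(\<lambda>m. T m n) sums ?U n" .
  qed (rule T_nonneg)
  have outer: "(?U has_sum (3 * (pi * ln 2))) UNIV"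
    by (intro has_sum_cmult_right cbin_odd_harm_has_sum)
  have "(\<lambda>(n, m). T m n) summable_on UNIV \<times> UNIV"
  proof (rule summable_on_SigmaI)
    show "((\<lambda>m. case (n, m) of (n, m) \<Rightarrow> T m n) has_sum ?U n) UNIV" for n
      using inner by simp
    show "?U summable_on UNIV" using outer by (auto simp: summable_on_def)
  qed (use T_nonneg in auto)
  hence "((\<lambda>(n, m). T m n) has_sum (3 * (pi * ln 2))) (UNIV \<times> UNIV)"
    by (intro has_sum_SigmaI[OF _ outer]) (use inner in auto)
  hence "((\<lambda>(m, n). T m n) has_sum (3 * (pi * ln 2))) (UNIV \<times> UNIV)"
    by (subst has_sum_swap) simp
  hence "infsum (\<lambda>(m, n). T m n) UNIV = 3 * (pi * ln 2)"
    by (simp add: infsumI)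
  moreover have "kdf [2] [5/2] [1, 1] [2] [1/2, 1/2] [1] 1 1 = infsum (\<lambda>(m, n). T m n) UNIV"
    unfolding kdf_def by (rule infsum_cong) (auto simp: T_eq [symmetric])
  ultimately show ?thesis by simp
qed

section \<open>Evaluation of the $L$-function\<close>

lemma critical_strip:
  assumes "0 < Re z" "Re z < 1"
  shows "z \<notin> \<int>\<^sub>\<le>\<^sub>0" "1 - z \<notin> \<int>\<^sub>\<le>\<^sub>0" "sin (of_real pi * z) \<noteq> 0"
proof -
  have "Re w \<le> 0" if "w \<in> \<int>\<^sub>\<le>\<^sub>0" for w :: complex
    using that by (auto elim!: nonpos_Ints_cases)
  from this[of z] this[of "1 - z"] show "z \<notin> \<int>\<^sub>\<le>\<^sub>0" "1 - z \<notin> \<int>\<^sub>\<le>\<^sub>0"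
    using assms by fastforce+
  show "sin (of_real pi * z) \<noteq> 0"
  proof
    assume "sin (of_real pi * z) = 0"
    then obtain n :: int where "of_real pi * z = of_real (n * pi)"
      by (auto simp: sin_eq_0)
    hence "z = of_int n" by (simp add: mult.commute)
    with assms show False by auto
  qed
qed

text \<open>The logarithmic derivative of Gamma z Gamma (1 - z) = pi / sin (pi z), taken on an open
  strip free of poles and of zeros of the sine.\<close>

lemma Digamma_reflection:
  assumes z: "z \<in> {z. 0 < Re z \<and> Re z < 1}"
  shows "Digamma (1 - z) - Digamma z = of_real pi * cos (of_real pi * z) / sin (of_real pi * z)"
proof -
  have S: "open {z. 0 < Re z \<and> Re z < 1}"
    unfolding Collect_conj_eq by (intro open_Int open_halfspace_Re_gt open_halfspace_Re_lt)
  have nz: "z \<notin> \<int>\<^sub>\<le>\<^sub>0" "1 - z \<notin> \<int>\<^sub>\<le>\<^sub>0" and sin: "sin (of_real pi * z) \<noteq> 0"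
    using critical_strip[of z] z by auto
  have "((\<lambda>z. Gamma z * Gamma (1 - z)) has_field_derivative
      (Gamma z * Digamma z * Gamma (1 - z) - Gamma z * (Gamma (1 - z) * Digamma (1 - z)))) (at z)"
    using nz by (auto intro!: derivative_eq_intros simp: algebra_simps)
  hence "((\<lambda>z. of_real pi / sin (of_real pi * z)) has_field_derivative
      (Gamma z * Digamma z * Gamma (1 - z) - Gamma z * (Gamma (1 - z) * Digamma (1 - z)))) (at z)"
    by (rule has_field_derivative_transform_within_open[OF _ S z]) (rule Gamma_reflection_complex)
  moreover have "((\<lambda>z. of_real pi / sin (of_real pi * z)) has_field_derivative
      (- (of_real pi * (of_real pi * cos (of_real pi * z))) / (sin (of_real pi * z))\<^sup>2)) (at z)"
    using sin by (auto intro!: derivative_eq_intros simp: power2_eq_square)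
  ultimately have "Gamma z * Digamma z * Gamma (1 - z) - Gamma z * (Gamma (1 - z) * Digamma (1 - z)) =
      - (of_real pi * (of_real pi * cos (of_real pi * z))) / (sin (of_real pi * z))\<^sup>2"
    by (rule DERIV_unique)
  hence "(Gamma z * Gamma (1 - z)) * (Digamma (1 - z) - Digamma z) =
      of_real pi * (of_real pi * cos (of_real pi * z)) / (sin (of_real pi * z))\<^sup>2"
    by (simp add: algebra_simps)
  also have "\<dots> = (of_real pi / sin (of_real pi * z)) * (of_real pi * cos (of_real pi * z) / sin (of_real pi * z))"
    by (simp add: power2_eq_square)
  finally show ?thesis
    unfolding Gamma_reflection_complex using sin by (subst (asm) mult_left_cancel) auto
qed

text \<open>Two further derivatives of the Digamma reflection. At z = 1/4 it provides the value of
  beta(3).\<close>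

lemma Polygamma_2_reflection:
  assumes z: "z \<in> {z. 0 < Re z \<and> Re z < 1}"
  shows "Polygamma 2 (1 - z) - Polygamma 2 z =
    2 * of_real pi ^ 3 * cos (of_real pi * z) / sin (of_real pi * z) ^ 3"
proof -
  let ?S = "{z. 0 < Re z \<and> Re z < 1}"
  let ?s = "\<lambda>z. sin (of_real pi * z) :: complex" and ?c = "\<lambda>z. cos (of_real pi * z) :: complex"
  have S: "open ?S"
    unfolding Collect_conj_eq by (intro open_Int open_halfspace_Re_gt open_halfspace_Re_lt)
  have nz: "z \<notin> \<int>\<^sub>\<le>\<^sub>0" "1 - z \<notin> \<int>\<^sub>\<le>\<^sub>0" and sin: "?s z \<noteq> 0" if "z \<in> ?S" for z
    using critical_strip[of z] that by auto
  have 1: "Polygamma 1 (1 - z) + Polygamma 1 z = of_real pi ^ 2 / ?s z ^ 2" if z: "z \<in> ?S" for z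
  proof -
    have "((\<lambda>z. Digamma (1 - z) - Digamma z) has_field_derivative
        (- Polygamma 1 (1 - z) - Polygamma 1 z)) (at z)"
      using nz[OF z] by (auto intro!: derivative_eq_intros)
    hence "((\<lambda>z. of_real pi * ?c z / ?s z) has_field_derivative
        (- Polygamma 1 (1 - z) - Polygamma 1 z)) (at z)"
      by (rule has_field_derivative_transform_within_open[OF _ S z]) (rule Digamma_reflection)
    moreover have "((\<lambda>z. of_real pi * ?c z / ?s z) has_field_derivative
        (- (of_real pi ^ 2 / ?s z ^ 2))) (at z)"
    proof -
      have "?s z * ?s z + ?c z * ?c z = 1"
        using sin_cos_squared_add[of "of_real pi * z"] by (simp add: power2_eq_square)
      thus ?thesis
        using sin[OF z]
        by (auto intro!: derivative_eq_intros simp: power2_eq_square divide_simps)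
           (simp flip: distrib_left distrib_right add: algebra_simps)
    qed
    ultimately have "- Polygamma 1 (1 - z) - Polygamma 1 z = - (of_real pi ^ 2 / ?s z ^ 2)"
      by (rule DERIV_unique)
    thus ?thesis by (simp add: algebra_simps)
  qed
  have "((\<lambda>z. Polygamma 1 (1 - z) + Polygamma 1 z) has_field_derivative
      (- Polygamma 2 (1 - z) + Polygamma 2 z)) (at z)"
    using nz[OF z] by (auto intro!: derivative_eq_intros simp: numeral_2_eq_2)
  hence "((\<lambda>z. of_real pi ^ 2 / ?s z ^ 2) has_field_derivative
      (- Polygamma 2 (1 - z) + Polygamma 2 z)) (at z)"
    by (rule has_field_derivative_transform_within_open[OF _ S z]) (rule 1)
  moreover have "((\<lambda>z. of_real pi ^ 2 / ?s z ^ 2) has_field_derivative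
      (- (2 * of_real pi ^ 3 * ?c z / ?s z ^ 3))) (at z)"
    using sin[OF z] by (auto intro!: derivative_eq_intros simp: power2_eq_square power3_eq_cube field_simps)
  ultimately have "- Polygamma 2 (1 - z) + Polygamma 2 z = - (2 * of_real pi ^ 3 * ?c z / ?s z ^ 3)"
    by (rule DERIV_unique)
  thus ?thesis by (simp add: algebra_simps)
qed

text \<open>Pairing neighbours splits the series into cubes over j + 1/4 and j + 3/4, scaled by 1/8.
  These are values of \<open>Polygamma 2\<close>, whose difference is 4 pi^3 by reflection. The
  result is 8 beta(3).\<close>

lemma alt_hurwitz_half_3: "alt_hurwitz (1/2) 3 = of_real (pi ^ 3 / 4)"
proof -
  have cubes: "(\<lambda>k. inverse ((z + of_nat k) ^ 3)) sums (- (Polygamma 2 z / 2))" if "z \<noteq> 0" for z :: complex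
    using Polygamma_LIMSEQ[of z 2] that by (simp add: numeral_3_eq_3 numeral_2_eq_2)
  have val: "Polygamma 2 (3/4 :: complex) - Polygamma 2 (1/4) = 4 * of_real pi ^ 3"
  proof -
    have e: "complex_of_real pi * (1/4) = of_real (pi / 4)" by simp
    have "cos (complex_of_real pi * (1/4)) = of_real (sqrt 2 / 2)"
      and "sin (complex_of_real pi * (1/4)) = of_real (sqrt 2 / 2)"
      unfolding e by (simp_all only: cos_of_real sin_of_real cos_45 sin_45)
    moreover have "(complex_of_real (sqrt 2 / 2)) ^ 3 = of_real (sqrt 2 / 2) * (1 / 2)"
      by (simp add: power3_eq_cube flip: of_real_mult)
    moreover have "Polygamma 2 (1 - 1/4) - Polygamma 2 (1/4) =
        2 * complex_of_real pi ^ 3 * cos (of_real pi * (1/4)) / sin (of_real pi * (1/4)) ^ 3"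
      by (rule Polygamma_2_reflection) simp
    moreover have "1 - 1/4 = (3/4 :: complex)" by simp
    ultimately have "Polygamma 2 (3/4 :: complex) - Polygamma 2 (1/4) =
        2 * complex_of_real pi ^ 3 * of_real (sqrt 2 / 2) / (of_real (sqrt 2 / 2) * (1 / 2))"
      by (simp only:)
    thus ?thesis by simp
  qed
  have "(\<lambda>n. (-1) ^ n * complex_of_real (real n + 1/2) powr (- 3)) sums alt_hurwitz (1/2) 3"
    by (rule has_sum_imp_sums, rule alt_hurwitz_has_sum) auto
  from sums_group[OF this, of 2]
  have "(\<lambda>n. \<Sum>i\<in>{n * 2..<n * 2 + 2}. (-1) ^ i * complex_of_real (real i + 1/2) powr (- 3)) sums alt_hurwitz (1/2) 3"
    by simp
  moreover have "(\<Sum>i\<in>{n * 2..<n * 2 + 2}. (-1) ^ i * complex_of_real (real i + 1/2) powr (- 3)) =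
      1 / 8 * (inverse ((1/4 + of_nat n) ^ 3) - inverse ((3/4 + of_nat n) ^ 3))" for n
  proof -
    have p: "complex_of_real y powr (- 3) = inverse (of_real y ^ 3)" if "y > 0" for y
      using that by (simp add: powr_minus)
    have c: "inverse (complex_of_real (2 * y) ^ 3) = 1 / 8 * inverse (of_real y ^ 3)" for y
      by (simp add: power_mult_distrib)
    have "{n * 2..<n * 2 + 2} = {n * 2, Suc (n * 2)}" by auto
    hence "(\<Sum>i\<in>{n * 2..<n * 2 + 2}. (-1) ^ i * complex_of_real (real i + 1/2) powr (- 3)) =
      complex_of_real (2 * (real n + 1/4)) powr (- 3) - complex_of_real (2 * (real n + 3/4)) powr (- 3)"
      by (simp add: algebra_simps)
    also have "\<dots> = inverse (complex_of_real (2 * (real n + 1/4)) ^ 3) - inverse (complex_of_real (2 * (real n + 3/4)) ^ 3)"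
      by (subst (1 2) p) auto
    also have "\<dots> = 1 / 8 * (inverse ((1/4 + of_nat n) ^ 3) - inverse ((3/4 + of_nat n) ^ 3))"
      unfolding c by (simp add: algebra_simps)
    finally show ?thesis .
  qed
  ultimately have "(\<lambda>n. 1 / 8 * (inverse ((1/4 + of_nat n) ^ 3) - inverse ((3/4 + of_nat n) ^ 3))) sums alt_hurwitz (1/2) 3"
    by (simp only:)
  moreover have "(\<lambda>n. 1 / 8 * (inverse ((1/4 + of_nat n) ^ 3) - inverse ((3/4 + of_nat n) ^ 3))) sums
      (1 / 8 * (- (Polygamma 2 (1/4) / 2) - - (Polygamma 2 (3/4 :: complex) / 2)))"
    by (intro sums_mult sums_diff cubes) auto
  ultimately have "alt_hurwitz (1/2) 3 = 1 / 8 * (- (Polygamma 2 (1/4) / 2) - - (Polygamma 2 (3/4) / 2))"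
    by (rule sums_unique2)
  also have "\<dots> = 1 / 16 * (Polygamma 2 (3/4) - Polygamma 2 (1/4))" by (simp add: field_simps)
  finally show ?thesis unfolding val by simp
qed

text \<open>The product eta(s - 2) beta(s); the factor 2 powr (-s) turns k + 1/2 into 2k +
  1.\<close>

definition Lfun :: "complex \<Rightarrow> complex" where
  "Lfun s = alt_hurwitz 1 (s - 2) * (2 powr (- s) * alt_hurwitz (1/2) s)"

lemma holomorphic_Lfun: "Lfun holomorphic_on UNIV"
proof -
  have "(\<lambda>s. alt_hurwitz 1 (s - 2)) holomorphic_on UNIV"
    by (rule holomorphic_on_compose[of "\<lambda>s. s - 2" UNIV "alt_hurwitz 1", unfolded o_def])
       (auto intro!: holomorphic_intros holomorphic_alt_hurwitz)
  thus ?thesis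
    unfolding Lfun_def [abs_def] by (intro holomorphic_intros holomorphic_alt_hurwitz) auto
qed

lemma Lfun_3: "Lfun 3 = of_real (pi ^ 3 * ln 2 / 32)"
  by (simp add: Lfun_def alt_hurwitz_1_1 alt_hurwitz_half_3 powr_minus)

text \<open>For Re s > 3 both factors converge absolutely, so their product may be regrouped by N =
  d (2k + 1). The shift of s by 2 in the first factor accounts for the weight d^2.\<close>

lemma Lfun_sums:
  assumes s: "Re s > 3"
  shows "(\<lambda>n. complex_of_real (fcoeff (Suc n)) / of_nat (Suc n) powr s) sums Lfun s"
proof -
  define u where "u i = (-1) ^ i * complex_of_real (real i + 1) powr (- (s - 2))" for i
  define v where "v k = 2 powr (- s) * ((-1) ^ k * complex_of_real (real k + 1/2) powr (- s))" for k
  have u: "(\<lambda>i. norm (u i)) summable_on UNIV" "infsum u UNIV = alt_hurwitz 1 (s - 2)"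
    using alt_hurwitz_has_sum[of 1 "s - 2"] s unfolding u_def [abs_def] by (simp_all add: infsumI)
  have v: "(\<lambda>k. norm (v k)) summable_on UNIV" "infsum v UNIV = 2 powr (- s) * alt_hurwitz (1/2) s"
  proof -
    have "(\<lambda>k. norm (2 powr (- s)) * norm ((-1) ^ k * complex_of_real (real k + 1/2) powr (- s))) summable_on UNIV"
      using alt_hurwitz_has_sum(2)[of "1/2" s] s by (intro summable_on_cmult_right) auto
    thus "(\<lambda>k. norm (v k)) summable_on UNIV" by (simp add: v_def norm_mult)
    have "(v has_sum 2 powr (- s) * alt_hurwitz (1/2) s) UNIV"
      unfolding v_def [abs_def] using s by (intro has_sum_cmult_right alt_hurwitz_has_sum) auto
    thus "infsum v UNIV = 2 powr (- s) * alt_hurwitz (1/2) s" by (rule infsumI)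
  qed
  have "((\<lambda>(i, k). u i * v k) has_sum Lfun s) (UNIV \<times> UNIV)"
    using has_sum_Times[OF u(1) v(1)] unfolding u(2) v(2) Lfun_def .
  moreover have "(\<lambda>(i, k). u i * v k) = (\<lambda>t. of_real (lambert_coeff t) * of_nat (lambert_key t) powr (- s))"
  proof
    fix t :: "nat \<times> nat"
    obtain i k where t: "t = (i, k)" by force
    have "complex_of_real (real i + 1) powr (- (s - 2)) = of_nat (Suc i) powr (- s) * of_nat (Suc i) ^ 2"
    proof -
      have "complex_of_real (real i + 1) = of_nat (Suc i)" by simp
      moreover have "- (s - 2) = - s + 2" by simp
      ultimately show ?thesis by (simp only: powr_add) simp
    qed
    moreover have "2 powr (- s) * complex_of_real (real k + 1/2) powr (- s) = of_nat (2 * k + 1) powr (- s)"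
    proof -
      have "(2 * complex_of_real (real k + 1/2)) powr (- s) = 2 powr (- s) * complex_of_real (real k + 1/2) powr (- s)"
        by (rule powr_times_real) auto
      moreover have "2 * complex_of_real (real k + 1/2) = of_nat (2 * k + 1)" by (simp add: algebra_simps)
      ultimately show ?thesis by (simp only:)
    qed
    moreover have "of_nat (Suc i) powr (- s) * of_nat (2 * k + 1) powr (- s) = of_nat (lambert_key t) powr (- s)"
      unfolding t lambert_key_def prod.case of_nat_mult by (rule powr_times_real [symmetric]) auto
    moreover have "complex_of_real (lambert_coeff t) = (-1) ^ i * (-1) ^ k * of_nat (Suc i) ^ 2"
      by (simp add: t lambert_coeff_def power_add)
    ultimately show "(case t of (i, k) \<Rightarrow> u i * v k) =
        of_real (lambert_coeff t) * of_nat (lambert_key t) powr (- s)"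
      by (simp add: t u_def v_def mult_ac del: of_nat_Suc)
  qed
  ultimately have "((\<lambda>t. of_real (lambert_coeff t) * of_nat (lambert_key t) powr (- s)) has_sum Lfun s) UNIV"
    by (simp only: UNIV_Times_UNIV)
  from sums_by_key[OF this finite_lambert_key]
  have "(\<lambda>N. complex_of_real (fcoeff N) * of_nat N powr (- s)) sums Lfun s"
    by (simp add: fcoeff_eq_lambert)
  \<comment> \<open>The term at N = 0 vanishes, since 0 powr (-s) is 0.\<close>
  hence "(\<lambda>N. complex_of_real (fcoeff (Suc N)) * of_nat (Suc N) powr (- s)) sums Lfun s"
    by (subst sums_Suc_iff) simp
  thus ?thesis by (simp add: powr_minus divide_inverse del: of_nat_Suc)
qed

text \<open>An entire function is determined by its values on a half-plane, so the existential
  statement pins down g as the continuation of the Dirichlet series and g 3 as L(f, 3).\<close>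

theorem theorem1:
  shows "\<exists>g :: complex \<Rightarrow> complex. g holomorphic_on UNIV
    \<and> (\<exists>\<sigma>::real. \<forall>s. Re s > \<sigma> \<longrightarrow>
          (\<lambda>n. complex_of_real (fcoeff (Suc n)) / (of_nat (Suc n)) powr s) sums g s)
    \<and> g 3 = complex_of_real (pi ^ 2 / 96 *
          kdf [2] [5/2] [1, 1] [2] [1/2, 1/2] [1] 1 1)"
proof (intro exI[of _ Lfun] conjI exI[of _ 3] allI impI holomorphic_Lfun Lfun_sums)
  show "Lfun 3 = complex_of_real (pi ^ 2 / 96 * kdf [2] [5/2] [1, 1] [2] [1/2, 1/2] [1] 1 1)"
    unfolding Lfun_3 kdf_value by (simp add: power2_eq_square power3_eq_cube)
qed

end
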